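(* Let $k\geq0$ be an integer and $(u_0,v_0)\in L^{2,k}_{\mathcal{E}}\times L^{2,k}_{\mathcal{E}}$. Then there exists a unique solution $(u,v)\in\mathcal{C}^\infty\big(\mathbb{R},L^{2,k}_{\mathcal{E}}\times L^{2,k}_{\mathcal{E}}\big)$ to the system $$i\partial_t u=\Pi(|v|^2u),\qquad i\partial_t v=\Pi(|u|^2v),\qquad u(0,\cdot)=u_0,\quad v(0,\cdot)=v_0,$$ and it satisfies, for all $t\in\mathbb{R}$, $$\|\langle z\rangle^ku(t)\|_{L^2(\mathbb{C})}+\|\langle z\rangle^kv(t)\|_{L^2(\mathbb{C})}\lesssim(1+|t|)^{\frac{k-1}{4}}\quad\text{if } k\geq3,$$ $$\|\langle z\rangle^2u(t)\|_{L^2(\mathbb{C})}+\|\langle z\rangle^2v(t)\|_{L^2(\mathbb{C})}\lesssim(1+|t|)^{\frac12}\quad\text{if } k=2.$$ Moreover, if $\langle z\rangle^3u_0\in L^2(\mathbb{C})$ and $\langle z\rangle^3v_0\in L^2(\mathbb{C})$, then $$\|\langle z\rangle^2u(t)\|_{L^2(\mathbb{C})}+\|\langle z\rangle^2v(t)\|_{L^2(\mathbb{C})}\lesssim(1+|t|)^{\frac14}.$$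
   Context: $L$ is Lebesgue measure on $\mathbb{C}$ and $\langle z\rangle=(1+|z|^2)^{1/2}$. The Bargmann-Fock space is $\mathcal{E}=\{u(z)=e^{-|z|^2/2}f(z):\ f \text{ entire holomorphic}\}\cap L^2(\mathbb{C})$. For $s\ge0$, $L^{2,s}_{\mathcal{E}}=\{u\in\mathcal{E}:\ \langle z\rangle^su\in L^2(\mathbb{C})\}$, with norm $\|\langle z\rangle^su\|_{L^2(\mathbb{C})}$. $\Pi$ is the orthogonal projection onto $\mathcal{E}$, given by $[\Pi u](z)=\frac1\pi e^{-|z|^2/2}\int_{\mathbb{C}}e^{\overline{w}z-|w|^2/2}u(w)\,dL(w)$. The notation $A(t)\lesssim B(t)$ means $A(t)\le C\,B(t)$ for all $t\in\mathbb{R}$, with $C$ a constant that may depend on $k$ and on the initial data $(u_0,v_0)$ but not on $t$. *)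

theory Defs
  imports "HOL-Analysis.Analysis" "HOL-Complex_Analysis.Complex_Analysis"
begin

definition square_integrable :: "(complex \<Rightarrow> complex) \<Rightarrow> bool" where
  "square_integrable u \<longleftrightarrow>
     u \<in> borel_measurable lborel \<and> integrable lborel (\<lambda>z. (cmod (u z))\<^sup>2)"

text \<open>Meaningful only for square-integrable arguments: the Bochner integral of a
  non-integrable function is 0.\<close>

definition L2_norm :: "(complex \<Rightarrow> complex) \<Rightarrow> real" where
  "L2_norm u = sqrt (\<integral>z. (cmod (u z))\<^sup>2 \<partial>lborel)"

definition japanese :: "complex \<Rightarrow> real" where
  "japanese z = sqrt (1 + (cmod z)\<^sup>2)"

definition weighted :: "real \<Rightarrow> (complex \<Rightarrow> complex) \<Rightarrow> complex \<Rightarrow> complex" where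
  "weighted s u = (\<lambda>z. complex_of_real (japanese z powr s) * u z)"

text \<open>Elements of the Bargmann-Fock space are continuous, so they are represented by
  functions instead of classes modulo null sets: two of them agreeing almost everywhere
  are equal.\<close>

definition bargmann_fock :: "(complex \<Rightarrow> complex) set" where
  "bargmann_fock =
     {u. (\<exists>f. f holomorphic_on UNIV \<and>
              u = (\<lambda>z. complex_of_real (exp (- (cmod z)\<^sup>2 / 2)) * f z))
         \<and> square_integrable u}"

definition L2E :: "real \<Rightarrow> (complex \<Rightarrow> complex) set" where
  "L2E s = {u \<in> bargmann_fock. square_integrable (weighted s u)}"

definition L2E_norm :: "real \<Rightarrow> (complex \<Rightarrow> complex) \<Rightarrow> real" where
  "L2E_norm s u = L2_norm (weighted s u)"

definition fock_proj :: "(complex \<Rightarrow> complex) \<Rightarrow> complex \<Rightarrow> complex" where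
  "fock_proj u z =
     complex_of_real (exp (- (cmod z)\<^sup>2 / 2) / pi) *
       (\<integral>w. exp (cnj w * z - complex_of_real ((cmod w)\<^sup>2 / 2)) * u w \<partial>lborel)"

text \<open>The curve \<open>u\<close> has derivative \<open>d \<in> L2E s\<close> at time \<open>t\<close>: the difference quotients
  converge to \<open>d\<close> in the norm of \<open>L2E s\<close>.\<close>

definition has_L2E_derivative ::
  "real \<Rightarrow> (real \<Rightarrow> complex \<Rightarrow> complex) \<Rightarrow> (complex \<Rightarrow> complex) \<Rightarrow> real \<Rightarrow> bool" where
  "has_L2E_derivative s u d t \<longleftrightarrow>
     d \<in> L2E s \<and>
     ((\<lambda>h. L2E_norm s (\<lambda>z. (u (t + h) z - u t z) / complex_of_real h - d z)) \<longlongrightarrow> 0) (at 0)"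

text \<open>Smoothness with values in \<open>L2E s\<close>; \<open>D n\<close> is the derivative of order \<open>n\<close>.\<close>

definition smooth_L2E_curve :: "real \<Rightarrow> (real \<Rightarrow> complex \<Rightarrow> complex) \<Rightarrow> bool" where
  "smooth_L2E_curve s u \<longleftrightarrow>
     (\<exists>D. D 0 = u \<and>
          (\<forall>n t. D n t \<in> L2E s \<and> has_L2E_derivative s (D n) (D (Suc n) t) t))"

text \<open>A curve in the product \<open>L2E s \<times> L2E s\<close> is given by its two components; it is smooth
  if both are.\<close>

definition is_solution ::
  "real \<Rightarrow> (complex \<Rightarrow> complex) \<Rightarrow> (complex \<Rightarrow> complex) \<Rightarrow>
   (real \<Rightarrow> complex \<Rightarrow> complex) \<Rightarrow> (real \<Rightarrow> complex \<Rightarrow> complex) \<Rightarrow> bool" where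
  "is_solution s u0 v0 u v \<longleftrightarrow>
     smooth_L2E_curve s u \<and> smooth_L2E_curve s v \<and>
     (\<forall>t. \<exists>du. has_L2E_derivative s u du t \<and>
        (\<forall>z. \<i> * du z = fock_proj (\<lambda>w. complex_of_real ((cmod (v t w))\<^sup>2) * u t w) z)) \<and>
     (\<forall>t. \<exists>dv. has_L2E_derivative s v dv t \<and>
        (\<forall>z. \<i> * dv z = fock_proj (\<lambda>w. complex_of_real ((cmod (u t w))\<^sup>2) * v t w) z)) \<and>
     u 0 = u0 \<and> v 0 = v0"

end

theory Submission
  imports Defs "HOL-Probability.Distributions"
begin

text \<open>
Everything is carried out on Taylor coefficients. Write
\<open>u(z) = exp (-|z|\<^sup>2/2) \<Sum>\<^sub>n a\<^sub>n z\<^sup>n / sqrt (\<pi> n!)\<close>, and \<open>v\<close> likewise with coefficients \<open>b\<^sub>n\<close>. Since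
\<open>(1+|z|\<^sup>2)\<^sup>k\<close> is radial, distinct monomials are orthogonal for it, so the squared norm of \<open>L2E k\<close> is a
weighted sum of \<open>|a\<^sub>n|\<^sup>2\<close> whose weight is comparable to \<open>(n+1)\<^sup>k\<close>. In these coordinates
\<open>i a' = C(b, M(a,b)) / (2\<pi>)\<close> and \<open>i b' = C(a, M(a,b)) / (2\<pi>)\<close>, where
\<open>M(a,b)\<^sub>S = \<Sum>\<^sub>n\<^sub>+\<^sub>m\<^sub>=\<^sub>S w(S,n) a\<^sub>n b\<^sub>m\<close> with \<open>w(S,n)\<^sup>2 = (S choose n) / 2\<^sup>S\<close> a binomial distribution,
and \<open>C(b,-)\<close> is the adjoint of \<open>M(-,b)\<close> (\<open>fock_proj_cubic\<close>). As the binomial weights sum to one,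
Cauchy-Schwarz shows that \<open>M\<close> and \<open>C\<close> are bounded on the sequence space with weight \<open>(n+1)\<^sup>k\<close>. The vector field is
therefore a bounded cubic form, locally Lipschitz and smooth, on a Hilbert space.

Global existence follows from an a priori bound in the \<open>L2E k\<close> norm: the field is cut off outside a large
ball, which makes it globally Lipschitz, and the bound, which also holds for the cut-off equation, shows
that the cut-off is never felt (\<open>global_solution_of_apriori_bound\<close>). Uniqueness is a Gronwall argument, and
smoothness in time comes from differentiating the equation.

The a priori bound and the growth estimates come from the same computation. Let \<open>E\<^sub>j\<close> be the sum of
\<open>(2n+1)\<^sup>j (|a\<^sub>n|\<^sup>2 + |b\<^sub>n|\<^sup>2)\<close>. The derivative of \<open>E\<^sub>j\<close> is a constant times the imaginary part of
\<open>\<Sum>\<^sub>S M(a,b)\<^sub>S cnj (\<Sum>\<^sub>n\<^sub>+\<^sub>m\<^sub>=\<^sub>S ((2n+1)\<^sup>j + (2m+1)\<^sup>j) w(S,n) a\<^sub>n b\<^sub>m)\<close>. On the antidiagonal \<open>n + m = S\<close> the factor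
\<open>(2n+1)\<^sup>j + (2m+1)\<^sup>j\<close> equals \<open>2 (S+1)\<^sup>j\<close> up to an error of size \<open>(S+1)\<^sup>j\<^sup>-\<^sup>2 (n-m)\<^sup>2\<close>; the main part pairs
\<open>M(a,b)\<^sub>S\<close> with a real multiple of itself and contributes nothing. So \<open>E\<^sub>0\<close> and \<open>E\<^sub>1\<close> are conserved. In the
error the binomial distribution forces \<open>(n-m)\<^sup>2\<close> to be of size \<open>S\<close>, and it also forces both \<open>n\<close> and \<open>m\<close> to be
comparable to \<open>S\<close>, which allows a factor \<open>(n+1)(m+1)\<close> to be traded for \<open>(S+1)\<^sup>2\<close>
(\<open>binom_weight_decay\<close>, \<open>binom_weight_concentration\<close>). Together this gives
\<open>|E\<^sub>j'| \<le> K E\<^sub>1 E\<^sub>j\<^sub>-\<^sub>2\<close> for \<open>j \<ge> 3\<close> and \<open>|E\<^sub>2'| \<le> K E\<^sub>1\<^sup>2\<close> (\<open>flux_bound\<close>).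

As \<open>E\<^sub>1\<close> is constant, \<open>E\<^sub>2\<close> and \<open>E\<^sub>3\<close> grow at most linearly; when \<open>E\<^sub>3\<close> is finite, interpolation between \<open>E\<^sub>1\<close> and
\<open>E\<^sub>3\<close> improves the growth of \<open>E\<^sub>2\<close> to \<open>(1+|t|)\<^sup>1\<^sup>/\<^sup>2\<close>; and induction in steps of two gives \<open>E\<^sub>j \<lesssim> (1+|t|)\<^sup>(\<^sup>j\<^sup>-\<^sup>1\<^sup>)\<^sup>/\<^sup>2\<close> for all
\<open>j \<ge> 3\<close>. Square roots of these bounds are the asserted ones.
\<close>

section \<open>Lebesgue measure on the plane and Parseval for radial weights\<close>

text \<open>The image measure is translation invariant, and two translation-invariant measures are proportional: by
Fubini, integrating \<open>1\<^sub>A(x+y) 1\<^sub>B(y)\<close> in either order gives \<open>\<mu>(A) \<lambda>(B) = \<lambda>(A) \<mu>(B)\<close> for the unit ball \<open>B\<close>. An isometry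
preserves the ball, so the constant is one.\<close>

lemma lborel_distr_linear_isometry:
  fixes T :: "'a::euclidean_space \<Rightarrow> 'a"
  assumes lin: "linear T" and iso: "\<And>x. norm (T x) = norm x"
  shows "distr lborel borel T = lborel"
proof (rule measure_eqI)
  let ?M = "distr lborel borel T"
  have Tm [measurable]: "T \<in> borel_measurable borel"
    using lin by (intro borel_measurable_continuous_onI linear_continuous_on) (simp add: linear_conv_bounded_linear)
  have inj: "inj T"
    using lin iso by (metis linear_injective_0 norm_eq_zero)
  have surj: "surj T"
    using lin inj by (rule linear_inj_imp_surj)
  show "sets ?M = sets lborel" by simp
  interpret M: sigma_finite_measure ?M
  proof
    let ?A = "range (\<lambda>n. ball (0::'a) (real n))"
    have "emeasure ?M (ball 0 (real n)) \<noteq> \<infinity>" for n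
    proof -
      have "T -` ball 0 (real n) = ball 0 (real n)"
        using iso by (auto simp: dist_norm)
      then show ?thesis by (simp add: emeasure_distr emeasure_ball emeasure_cball)
    qed
    moreover have "(\<Union>n. ball (0::'a) (real n)) = UNIV"
      by (auto simp: dist_norm intro: reals_Archimedean2)
    ultimately show "\<exists>A. countable A \<and> A \<subseteq> sets ?M \<and> \<Union>A = space ?M \<and> (\<forall>a\<in>A. emeasure ?M a \<noteq> \<infinity>)"
      by (intro exI[of _ ?A]) auto
  qed
  have trans: "(\<integral>\<^sup>+ x. f (x + y) \<partial>?M) = (\<integral>\<^sup>+ x. f x \<partial>?M)" if [measurable]: "f \<in> borel_measurable borel" for f and y :: 'a
  proof -
    obtain y' where y: "y = T y'" using surj by (metis surj_def)
    have "(\<integral>\<^sup>+ x. f (x + y) \<partial>?M) = (\<integral>\<^sup>+ x. f (T x + T y') \<partial>lborel)"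
      by (simp add: nn_integral_distr y)
    also have "\<dots> = (\<integral>\<^sup>+ x. f (T (y' + x)) \<partial>lborel)"
      using lin by (simp add: linear_add add.commute)
    also have "\<dots> = (\<integral>\<^sup>+ x. f (T x) \<partial>distr lborel borel ((+) y'))"
      by (subst nn_integral_distr) auto
    also have "\<dots> = (\<integral>\<^sup>+ x. f x \<partial>?M)"
      by (simp add: lborel_distr_plus nn_integral_distr)
    finally show ?thesis .
  qed
  have transl: "(\<integral>\<^sup>+ x. f (x + y) \<partial>lborel) = (\<integral>\<^sup>+ x. f x \<partial>lborel)" if [measurable]: "f \<in> borel_measurable borel" for f and y :: 'a
  proof -
    have "(\<integral>\<^sup>+ x. f (x + y) \<partial>lborel) = (\<integral>\<^sup>+ x. f x \<partial>distr lborel borel ((+) y))"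
      by (subst nn_integral_distr) (auto simp: add.commute)
    then show ?thesis by (simp add: lborel_distr_plus)
  qed
  interpret P: pair_sigma_finite ?M "lborel :: 'a measure" ..
  fix A assume "A \<in> sets ?M"
  then have [measurable]: "A \<in> sets borel" by simp
  let ?B = "cball (0::'a) 1"
  define b where "b y = (indicator {..1} (norm y) :: ennreal)" for y :: 'a
  have [measurable]: "b \<in> borel_measurable borel" unfolding b_def by measurable
  have b: "(\<integral>\<^sup>+ y. b y \<partial>N) = emeasure N ?B" if "sets N = sets borel" for N :: "'a measure"
  proof -
    have "b = indicator ?B" by (auto simp: b_def indicator_def fun_eq_iff)
    then show ?thesis using that by simp
  qed
  have I1: "(\<integral>\<^sup>+ y. (\<integral>\<^sup>+ x. indicator A (x + y) * b y \<partial>?M) \<partial>lborel) = emeasure ?M A * emeasure lborel ?B"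
  proof -
    have "(\<integral>\<^sup>+ x. indicator A (x + y) * b y \<partial>?M) = emeasure ?M A * b y" for y
      using trans[of "indicator A" y] by (subst nn_integral_multc) auto
    then show ?thesis by (simp add: nn_integral_cmult b)
  qed
  have I2: "(\<integral>\<^sup>+ x. (\<integral>\<^sup>+ y. indicator A (x + y) * b y \<partial>lborel) \<partial>?M) = emeasure lborel A * emeasure ?M ?B"
  proof -
    have bsym: "b (y - x) = b (x + - y)" for x y :: 'a
      by (simp add: b_def norm_minus_commute[of x y])
    have "(\<integral>\<^sup>+ y. indicator A (x + y) * b y \<partial>lborel) = (\<integral>\<^sup>+ y. indicator A y * b (x + - y) \<partial>lborel)" for x
      using transl[of "\<lambda>y. indicator A y * b (y - x)" x] unfolding bsym[symmetric] by (simp add: add.commute)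
    then have "(\<integral>\<^sup>+ x. (\<integral>\<^sup>+ y. indicator A (x + y) * b y \<partial>lborel) \<partial>?M)
        = (\<integral>\<^sup>+ x. (\<integral>\<^sup>+ y. indicator A y * b (x + - y) \<partial>lborel) \<partial>?M)" by (simp only:)
    also have "\<dots> = (\<integral>\<^sup>+ y. (\<integral>\<^sup>+ x. indicator A y * b (x + - y) \<partial>?M) \<partial>lborel)"
      by (rule P.Fubini'[symmetric]) measurable
    also have "\<dots> = (\<integral>\<^sup>+ y. indicator A y * emeasure ?M ?B \<partial>lborel)"
    proof (rule nn_integral_cong)
      fix y :: 'a
      have "(\<integral>\<^sup>+ x. b (x + - y) \<partial>?M) = emeasure ?M ?B"
        by (rule HOL.trans[OF trans b]) simp_all
      then show "(\<integral>\<^sup>+ x. indicator A y * b (x + - y) \<partial>?M) = indicator A y * emeasure ?M ?B"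
        by (subst nn_integral_cmult) auto
    qed
    also have "\<dots> = emeasure lborel A * emeasure ?M ?B"
      by (simp add: nn_integral_multc)
    finally show ?thesis .
  qed
  have I3: "(\<integral>\<^sup>+ y. (\<integral>\<^sup>+ x. indicator A (x + y) * b y \<partial>?M) \<partial>lborel)
     = (\<integral>\<^sup>+ x. (\<integral>\<^sup>+ y. indicator A (x + y) * b y \<partial>lborel) \<partial>?M)"
    by (rule P.Fubini') measurable
  have I4: "emeasure ?M ?B = emeasure lborel ?B"
  proof -
    have "T -` ?B = ?B" using iso by (auto simp: dist_norm)
    then show ?thesis by (simp add: emeasure_distr emeasure_ball emeasure_cball)
  qed
  have I5: "emeasure lborel ?B \<noteq> 0" "emeasure lborel ?B \<noteq> \<infinity>"
    using unit_ball_vol_pos[of "real DIM('a)"] by (simp_all add: emeasure_cball del: unit_ball_vol_pos)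
  have "emeasure ?M A * emeasure lborel ?B = emeasure lborel A * emeasure lborel ?B"
    using I1 I2 I3 unfolding I4 by metis
  then show "emeasure ?M A = emeasure lborel A"
    using I5 by (simp add: mult.commute[of _ "emeasure lborel (cball 0 1)"] ennreal_mult_cancel_left)
qed

text \<open>Under \<open>z \<mapsto> |z|\<^sup>2\<close> the area measure becomes \<open>\<pi>\<close> times the length measure on the half-line, because
the disc \<open>|z|\<^sup>2 \<le> a\<close> has area \<open>\<pi> a\<close>. This replaces polar coordinates.\<close>

lemma nn_integral_norm_square_complex:
  fixes h :: "real \<Rightarrow> ennreal"
  assumes [measurable]: "h \<in> borel_measurable borel"
  shows "(\<integral>\<^sup>+ z. h ((cmod z)\<^sup>2) \<partial>lborel) = ennreal pi * (\<integral>\<^sup>+ r. h r * indicator {0..} r \<partial>lborel)"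
proof -
  let ?M = "distr lborel borel (\<lambda>z::complex. (cmod z)\<^sup>2)"
  let ?N = "density lborel (\<lambda>r. ennreal pi * indicator {0..} r)"
  have M: "emeasure ?M {..a} = (if a < 0 then 0 else ennreal (pi * a))" for a
  proof -
    have "((cmod z)\<^sup>2 \<le> a) = (if a < 0 then False else cmod z \<le> sqrt a)" for z
    proof (cases "a < 0")
      case True
      then show ?thesis using zero_le_power2[of "cmod z"] by (auto simp del: zero_le_power2 dest: le_less_trans)
    next
      case False
      then show ?thesis using real_sqrt_le_iff[of "(cmod z)\<^sup>2" a] by simp
    qed
    then have "(\<lambda>z::complex. (cmod z)\<^sup>2) -` {..a} = (if a < 0 then {} else cball 0 (sqrt a))"
      by (auto split: if_splits)
    then show ?thesis
      by (simp add: emeasure_distr emeasure_cball unit_ball_vol_2)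
  qed
  have N: "emeasure ?N {..a} = (if a < 0 then 0 else ennreal (pi * a))" for a
  proof -
    have "emeasure ?N {..a} = (\<integral>\<^sup>+ r. ennreal pi * indicator {0..a} r \<partial>lborel)"
      by (subst emeasure_density) (auto intro!: nn_integral_cong simp: indicator_def)
    also have "\<dots> = ennreal pi * emeasure lborel {0..a}" by (simp add: nn_integral_cmult)
    finally show ?thesis by (simp add: ennreal_mult)
  qed
  have "?M = ?N"
  proof (rule measure_eqI_generator_eq[where E = "range atMost" and A = "\<lambda>i. {..real i}" and \<Omega> = UNIV])
    show "Int_stable (range (atMost :: real \<Rightarrow> _))"
      by (auto simp: Int_stable_def)
    show "(\<Union>i. {..real i}) = UNIV"
      by (auto intro: real_arch_simple)
    show "emeasure ?M X = emeasure ?N X" if "X \<in> range atMost" for X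
      using that M N by auto
    show "emeasure ?M {..real i} \<noteq> \<infinity>" for i using M by simp
  qed (auto simp: borel_eq_atMost)
  then have "(\<integral>\<^sup>+ r. h r \<partial>?M) = (\<integral>\<^sup>+ r. h r \<partial>?N)" by simp
  then show ?thesis
    by (simp add: nn_integral_distr nn_integral_density nn_integral_cmult[symmetric] mult_ac)
qed

lemma nn_integral_gaussian_moment:
  assumes c: "c > 0"
  shows "(\<integral>\<^sup>+ z. ennreal (cmod z ^ (2 * n) * exp (- c * (cmod z)\<^sup>2)) \<partial>lborel)
    = ennreal (pi * fact n / c ^ Suc n)"
proof -
  let ?J = "\<integral>\<^sup>+ r. ennreal (r ^ n * exp (- c * r)) * indicator {0..} r \<partial>lborel"
  have "ennreal (fact n) = ennreal \<bar>c\<bar> * (\<integral>\<^sup>+ r. ennreal ((0 + c * r) ^ n * exp (- (0 + c * r))) * indicator {0..} (0 + c * r) \<partial>lborel)"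
    unfolding nn_intergal_power_times_exp_Ici[of n, simplified, symmetric]
    using c by (subst nn_integral_real_affine[where c = c and t = 0]) auto
  also have "\<dots> = ennreal c * (\<integral>\<^sup>+ r. ennreal (c ^ n) * (ennreal (r ^ n * exp (- c * r)) * indicator {0..} r) \<partial>lborel)"
  proof -
    have "ennreal ((0 + c * r) ^ n * exp (- (0 + c * r))) * indicator {0..} (0 + c * r)
      = ennreal (c ^ n) * (ennreal (r ^ n * exp (- c * r)) * indicator {0..} r)" for r
      using c by (auto simp: indicator_def zero_le_mult_iff power_mult_distrib ennreal_mult'[symmetric] mult_ac)
    then show ?thesis using c by simp
  qed
  also have "\<dots> = ennreal (c ^ Suc n) * ?J"
    using c by (simp add: nn_integral_cmult ennreal_mult mult.assoc)
  finally have J: "ennreal (fact n) = ennreal (c ^ Suc n) * ?J" .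
  have "?J = ennreal (fact n / c ^ Suc n)"
  proof -
    have "ennreal (fact n / c ^ Suc n) = ennreal (inverse (c ^ Suc n)) * ennreal (fact n)"
      using c by (simp add: ennreal_mult[symmetric] divide_inverse mult_ac)
    also have "\<dots> = (ennreal (inverse (c ^ Suc n)) * ennreal (c ^ Suc n)) * ?J"
      unfolding J by (simp add: mult_ac)
    also have "ennreal (inverse (c ^ Suc n)) * ennreal (c ^ Suc n) = 1"
      using c by (subst ennreal_mult[symmetric]) (auto simp: field_simps)
    finally show ?thesis by simp
  qed
  then show ?thesis
    using nn_integral_norm_square_complex[of "\<lambda>r. ennreal (r ^ n * exp (- c * r))"] c
    by (simp add: power_mult ennreal_mult[symmetric])
qed

lemma sums_ennreal:
  assumes "x sums s" "\<And>n. 0 \<le> x n"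
  shows "(\<Sum>n. ennreal (x n)) = ennreal s"
  using assms by (subst suminf_ennreal2) (simp_all add: sums_iff)

lemma nn_integral_eq_if_eq_on_discs:
  fixes g h :: "complex \<Rightarrow> ennreal"
  assumes [measurable]: "g \<in> borel_measurable borel" "h \<in> borel_measurable borel"
    and eq: "\<And>R. (\<integral>\<^sup>+ z. indicator (cball 0 (real R)) z * g z \<partial>lborel) = (\<integral>\<^sup>+ z. indicator (cball 0 (real R)) z * h z \<partial>lborel)"
  shows "(\<integral>\<^sup>+ z. g z \<partial>lborel) = (\<integral>\<^sup>+ z. h z \<partial>lborel)"
proof -
  have [measurable]: "cball (0::complex) (real R) \<in> sets borel" for R by simp
  have *: "(\<integral>\<^sup>+ z. g z \<partial>lborel) = (SUP R. \<integral>\<^sup>+ z. indicator (cball 0 (real R)) z * g z \<partial>lborel)"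
    if [measurable]: "g \<in> borel_measurable borel" for g :: "complex \<Rightarrow> ennreal"
  proof -
    have eq: "g z = (SUP R. indicator (cball 0 (real R)) z * g z)" for z
    proof (rule antisym)
      obtain R :: nat where "cmod z \<le> real R" using real_arch_simple by blast
      then have "g z \<le> indicator (cball 0 (real R)) z * g z" by simp
      then show "g z \<le> (SUP R. indicator (cball 0 (real R)) z * g z)"
        by (rule SUP_upper2[rotated]) simp
      show "(SUP R. indicator (cball 0 (real R)) z * g z) \<le> g z"
        by (intro SUP_least) (auto simp: indicator_def)
    qed
    have "(\<integral>\<^sup>+ z. g z \<partial>lborel) = (\<integral>\<^sup>+ z. (SUP R. indicator (cball 0 (real R)) z * g z) \<partial>lborel)"
      by (rule nn_integral_cong) (rule eq)
    also have "\<dots> = (SUP R. \<integral>\<^sup>+ z. indicator (cball 0 (real R)) z * g z \<partial>lborel)"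
      by (rule nn_integral_monotone_convergence_SUP)
         (auto simp: incseq_def le_fun_def intro!: mult_right_mono indicator_leI)
    finally show ?thesis .
  qed
  show ?thesis unfolding *[OF assms(1)] *[OF assms(2)] eq ..
qed

context
  fixes c :: "nat \<Rightarrow> complex" and f :: "complex \<Rightarrow> complex" and W :: "complex \<Rightarrow> real"
  assumes f: "\<And>z. (\<lambda>n. c n * z ^ n) sums f z"
    and W_cont: "continuous_on UNIV W" and W_nonneg: "\<And>z. 0 \<le> W z"
    and W_rot: "\<And>\<omega> z. cmod \<omega> = 1 \<Longrightarrow> W (\<omega> * z) = W z"
begin

lemma radial_weight_measurable: "W \<in> borel_measurable borel"
  using W_cont by (rule borel_measurable_continuous_onI)

lemma disc_integrable:
  fixes g :: "complex \<Rightarrow> 'b::{banach,second_countable_topology}"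
  assumes "continuous_on UNIV g"
  shows "integrable lborel (\<lambda>z. indicator (cball 0 R) z *\<^sub>R g z)"
  by (rule borel_integrable_compact) (auto intro: continuous_on_subset[OF assms])

text \<open>A rotation \<open>z \<mapsto> \<omega> z\<close> leaves the disc, the weight and the measure invariant and multiplies the integrand
by \<open>\<omega>\<^sup>m cnj \<omega>\<^sup>n\<close>; for a suitable \<open>\<omega>\<close> this factor is \<open>-1\<close>.\<close>

lemma disc_monomials_orthogonal:
  assumes "m \<noteq> n"
  shows "(\<integral>z. indicator (cball 0 R) z *\<^sub>R (of_real (W z) * (z ^ m * cnj z ^ n)) \<partial>lborel) = 0" (is "?I = 0")
proof -
  \<comment> \<open>The angle \<open>\<pi> / (m - n)\<close> makes the total phase equal to \<open>\<pi>\<close>.\<close>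
  define d where "d = real m - real n"
  define \<omega> where "\<omega> = cis (pi / d)"
  have d: "d \<noteq> 0" using assms by (simp add: d_def)
  have \<omega>: "cmod \<omega> = 1" by (simp add: \<omega>_def)
  have "\<omega> ^ m * cnj \<omega> ^ n = cis (real m * (pi / d) - real n * (pi / d))"
    unfolding \<omega>_def cis_cnj Complex.DeMoivre cis_mult by (rule arg_cong[where f = cis]) simp
  also have "real m * (pi / d) - real n * (pi / d) = pi"
  proof -
    have "real m * (pi / d) - real n * (pi / d) = d * (pi / d)" by (simp only: d_def left_diff_distrib)
    then show ?thesis using d by simp
  qed
  finally have *: "\<omega> ^ m * cnj \<omega> ^ n = -1" by simp
  let ?g = "\<lambda>z. indicator (cball 0 R) z *\<^sub>R (of_real (W z) * (z ^ m * cnj z ^ n)) :: complex"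
  have "distr lborel borel ((*) \<omega>) = lborel"
    by (rule lborel_distr_linear_isometry) (auto simp: norm_mult \<omega> intro: linear_times)
  then have "?I = (\<integral>z. ?g z \<partial>distr lborel borel ((*) \<omega>))" by simp
  also have "\<dots> = (\<integral>z. ?g (\<omega> * z) \<partial>lborel)"
  proof (rule integral_distr)
    have "integrable lborel ?g" by (intro disc_integrable continuous_intros W_cont)
    then show "?g \<in> borel_measurable borel" by (simp add: borel_measurable_integrable[where M = lborel, simplified])
  qed simp
  also have "\<dots> = (\<integral>z. - ?g z \<partial>lborel)"
  proof (rule Bochner_Integration.integral_cong)
    fix z
    have "?g (\<omega> * z) = (\<omega> ^ m * cnj \<omega> ^ n) * ?g z"
      by (auto simp: indicator_def norm_mult \<omega> W_rot power_mult_distrib)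
    then show "?g (\<omega> * z) = - ?g z" using * by simp
  qed simp
  also have "\<dots> = - ?I" by simp
  finally show ?thesis by simp
qed

lemma disc_partial_sum:
  "(\<integral>z. indicator (cball 0 R) z *\<^sub>R (W z * (cmod (\<Sum>n<N. c n * z ^ n))\<^sup>2) \<partial>lborel)
    = (\<Sum>n<N. (cmod (c n))\<^sup>2 * (\<integral>z. indicator (cball 0 R) z *\<^sub>R (W z * cmod z ^ (2 * n)) \<partial>lborel))"
proof -
  let ?D = "cball (0::complex) R"
  let ?T = "\<lambda>m n z. indicator ?D z *\<^sub>R (of_real (W z) * (z ^ m * cnj z ^ n)) :: complex"
  have int: "integrable lborel (?T m n)" for m n
    by (intro disc_integrable continuous_intros W_cont)
  have diag: "(\<integral>z. ?T n n z \<partial>lborel) = of_real (\<integral>z. indicator ?D z *\<^sub>R (W z * cmod z ^ (2 * n)) \<partial>lborel)" for n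
  proof -
    have "z ^ n * cnj z ^ n = of_real (cmod z ^ (2 * n))" for z
      by (simp only: power_mult of_real_power[of "(cmod z)\<^sup>2" n] complex_norm_square power_mult_distrib)
    then have "?T n n z = of_real (indicator ?D z *\<^sub>R (W z * cmod z ^ (2 * n)))" for z
      by (simp only: of_real_mult scaleR_conv_of_real of_real_eq_id id_apply)
    then show ?thesis by (simp only: integral_complex_of_real)
  qed
  have expand: "of_real (indicator ?D z *\<^sub>R (W z * (cmod (\<Sum>n<N. c n * z ^ n))\<^sup>2))
    = (\<Sum>m<N. \<Sum>n<N. (c m * cnj (c n)) * ?T m n z)" for z
  proof -
    have "of_real (indicator ?D z *\<^sub>R (W z * (cmod (\<Sum>n<N. c n * z ^ n))\<^sup>2))
      = (of_real (indicator ?D z) * of_real (W z)) * ((\<Sum>m<N. c m * z ^ m) * (\<Sum>n<N. cnj (c n) * cnj z ^ n))"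
      by (simp only: of_real_mult real_scaleR_def complex_norm_square) simp
    also have "\<dots> = (\<Sum>m<N. \<Sum>n<N. (c m * cnj (c n)) * ?T m n z)"
      unfolding sum_product unfolding sum_distrib_left
      by (intro sum.cong refl) (simp add: scaleR_conv_of_real mult_ac)
    finally show ?thesis .
  qed
  have "complex_of_real (\<integral>z. indicator ?D z *\<^sub>R (W z * (cmod (\<Sum>n<N. c n * z ^ n))\<^sup>2) \<partial>lborel)
     = (\<integral>z. of_real (indicator ?D z *\<^sub>R (W z * (cmod (\<Sum>n<N. c n * z ^ n))\<^sup>2)) \<partial>lborel)"
    by (rule integral_complex_of_real[symmetric])
  also have "\<dots> = (\<integral>z. (\<Sum>m<N. \<Sum>n<N. (c m * cnj (c n)) * ?T m n z) \<partial>lborel)"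
    unfolding expand ..
  also have "\<dots> = (\<Sum>m<N. \<Sum>n<N. (c m * cnj (c n)) * (\<integral>z. ?T m n z \<partial>lborel))"
  proof -
    have *: "integrable lborel (\<lambda>z. (c m * cnj (c n)) * ?T m n z)" for m n
      by (intro integrable_mult_right int)
    have "(\<integral>z. (\<Sum>m<N. \<Sum>n<N. (c m * cnj (c n)) * ?T m n z) \<partial>lborel)
      = (\<Sum>m<N. \<integral>z. (\<Sum>n<N. (c m * cnj (c n)) * ?T m n z) \<partial>lborel)"
      by (intro Bochner_Integration.integral_sum Bochner_Integration.integrable_sum *)
    also have "\<dots> = (\<Sum>m<N. \<Sum>n<N. \<integral>z. (c m * cnj (c n)) * ?T m n z \<partial>lborel)"
      by (intro sum.cong refl Bochner_Integration.integral_sum *)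
    finally show ?thesis by (simp only: integral_mult_right_zero)
  qed
  also have "\<dots> = (\<Sum>m<N. \<Sum>n<N. if n = m then (c n * cnj (c n)) * (\<integral>z. ?T n n z \<partial>lborel) else 0)"
    by (intro sum.cong refl) (auto simp: disc_monomials_orthogonal)
  also have "\<dots> = (\<Sum>n<N. (c n * cnj (c n)) * (\<integral>z. ?T n n z \<partial>lborel))"
    by (simp add: sum.delta)
  also have "\<dots> = of_real (\<Sum>n<N. (cmod (c n))\<^sup>2 * (\<integral>z. indicator ?D z *\<^sub>R (W z * cmod z ^ (2 * n)) \<partial>lborel))"
    unfolding diag by (simp only: complex_norm_square[symmetric] of_real_sum of_real_mult)
  finally show ?thesis by (simp only: of_real_eq_iff)
qed

lemma power_series_measurable: "f \<in> borel_measurable borel"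
proof (rule borel_measurable_LIMSEQ_metric)
  show "(\<lambda>z. \<Sum>n<N. c n * z ^ n) \<in> borel_measurable borel" for N by measurable
  show "(\<lambda>N. \<Sum>n<N. c n * z ^ n) \<longlonglongrightarrow> f z" for z using f by (simp only: sums_def)
qed

text \<open>On a disc the partial sums are dominated by the constant \<open>\<Sum> |c\<^sub>n| R\<^sup>n\<close>, so orthogonality passes to the
whole power series without any integrability of \<open>f\<close> on the plane.\<close>

lemma disc_parseval:
  "(\<lambda>n. (cmod (c n))\<^sup>2 * (\<integral>z. indicator (cball 0 R) z *\<^sub>R (W z * cmod z ^ (2 * n)) \<partial>lborel))
    sums (\<integral>z. indicator (cball 0 R) z *\<^sub>R (W z * (cmod (f z))\<^sup>2) \<partial>lborel)"
  "integrable lborel (\<lambda>z. indicator (cball 0 R) z *\<^sub>R (W z * (cmod (f z))\<^sup>2))"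
proof -
  let ?D = "cball (0::complex) R"
  let ?R = "max R 0"
  note [measurable] = radial_weight_measurable power_series_measurable
  have [measurable]: "?D \<in> sets borel" by simp
  have "summable (\<lambda>n. c n * of_real (?R + 1) ^ n)" using f by (auto simp: sums_iff)
  then have "summable (\<lambda>n. norm (c n * of_real ?R ^ n))"
    by (rule powser_insidea) auto
  then have K: "summable (\<lambda>n. cmod (c n) * ?R ^ n)"
    by (simp add: norm_mult norm_power)
  define K where "K = (\<Sum>n. cmod (c n) * ?R ^ n)"
  have bnd: "cmod (\<Sum>n<N. c n * z ^ n) \<le> K" if "z \<in> ?D" for N z
  proof -
    have "cmod z \<le> ?R" using that by auto
    then have "cmod (\<Sum>n<N. c n * z ^ n) \<le> (\<Sum>n<N. cmod (c n) * ?R ^ n)"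
      by (intro sum_norm_le) (auto simp: norm_mult norm_power intro!: mult_left_mono power_mono)
    also have "\<dots> \<le> K" unfolding K_def using K by (intro sum_le_suminf) auto
    finally show ?thesis .
  qed
  have int: "integrable lborel (\<lambda>z. indicator ?D z *\<^sub>R (W z * K\<^sup>2))"
    by (intro disc_integrable continuous_intros W_cont)
  have lim: "AE z in lborel. (\<lambda>N. indicator ?D z *\<^sub>R (W z * (cmod (\<Sum>n<N. c n * z ^ n))\<^sup>2))
        \<longlonglongrightarrow> indicator ?D z *\<^sub>R (W z * (cmod (f z))\<^sup>2)"
    using f by (intro AE_I2 tendsto_intros) (auto simp: sums_def)
  have dom: "AE z in lborel. norm (indicator ?D z *\<^sub>R (W z * (cmod (\<Sum>n<N. c n * z ^ n))\<^sup>2)) \<le> indicator ?D z *\<^sub>R (W z * K\<^sup>2)" for N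
    using bnd W_nonneg by (intro AE_I2) (auto simp: indicator_def abs_mult intro!: mult_left_mono power_mono)
  have m1: "(\<lambda>z. indicator ?D z *\<^sub>R (W z * (cmod (\<Sum>n<N. c n * z ^ n))\<^sup>2)) \<in> borel_measurable lborel" for N
    by measurable
  have m2: "(\<lambda>z. indicator ?D z *\<^sub>R (W z * (cmod (f z))\<^sup>2)) \<in> borel_measurable lborel" by measurable
  show "(\<lambda>n. (cmod (c n))\<^sup>2 * (\<integral>z. indicator (cball 0 R) z *\<^sub>R (W z * cmod z ^ (2 * n)) \<partial>lborel))
    sums (\<integral>z. indicator (cball 0 R) z *\<^sub>R (W z * (cmod (f z))\<^sup>2) \<partial>lborel)"
    unfolding sums_def disc_partial_sum[symmetric]
    by (rule integral_dominated_convergence[OF m2 m1 int lim dom])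
  show "integrable lborel (\<lambda>z. indicator (cball 0 R) z *\<^sub>R (W z * (cmod (f z))\<^sup>2))"
    by (rule integrable_dominated_convergence[OF m2 m1 int lim dom])
qed

text \<open>The identity holds in the extended sense: both sides may be infinite. For the weight of the Fock space
this makes square integrability of \<open>f\<close> equivalent to a summability condition on its coefficients.\<close>

theorem radial_parseval:
  "(\<integral>\<^sup>+ z. ennreal (W z * (cmod (f z))\<^sup>2) \<partial>lborel)
   = (\<Sum>n. ennreal ((cmod (c n))\<^sup>2) * (\<integral>\<^sup>+ z. ennreal (W z * cmod z ^ (2 * n)) \<partial>lborel))"
proof -
  note [measurable] = radial_weight_measurable power_series_measurable
  have [measurable]: "cball (0::complex) (real R) \<in> sets borel" for R by simp
  have "(\<integral>\<^sup>+ z. ennreal (W z * (cmod (f z))\<^sup>2) \<partial>lborel)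
    = (\<integral>\<^sup>+ z. (\<Sum>n. ennreal ((cmod (c n))\<^sup>2) * ennreal (W z * cmod z ^ (2 * n))) \<partial>lborel)"
  proof (rule nn_integral_eq_if_eq_on_discs)
    fix R :: nat
    let ?D = "cball (0::complex) (real R)"
    have "(\<integral>\<^sup>+ z. indicator ?D z * ennreal (W z * (cmod (f z))\<^sup>2) \<partial>lborel)
      = (\<integral>\<^sup>+ z. ennreal (indicator ?D z *\<^sub>R (W z * (cmod (f z))\<^sup>2)) \<partial>lborel)"
      by (intro nn_integral_cong) (auto simp: indicator_def)
    also have "\<dots> = ennreal (\<integral>z. indicator ?D z *\<^sub>R (W z * (cmod (f z))\<^sup>2) \<partial>lborel)"
      by (rule nn_integral_eq_integral[OF disc_parseval(2)]) (auto simp: W_nonneg)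
    also have "\<dots> = (\<Sum>n. ennreal ((cmod (c n))\<^sup>2 * (\<integral>z. indicator ?D z *\<^sub>R (W z * cmod z ^ (2 * n)) \<partial>lborel)))"
      by (rule sums_ennreal[symmetric, OF disc_parseval(1)]) (auto simp: W_nonneg intro!: mult_nonneg_nonneg integral_nonneg_AE)
    also have "\<dots> = (\<Sum>n. \<integral>\<^sup>+ z. indicator ?D z * (ennreal ((cmod (c n))\<^sup>2) * ennreal (W z * cmod z ^ (2 * n))) \<partial>lborel)"
    proof (rule suminf_cong)
      fix n
      have "ennreal ((cmod (c n))\<^sup>2 * (\<integral>z. indicator ?D z *\<^sub>R (W z * cmod z ^ (2 * n)) \<partial>lborel))
        = ennreal ((cmod (c n))\<^sup>2) * (\<integral>\<^sup>+ z. ennreal (indicator ?D z *\<^sub>R (W z * cmod z ^ (2 * n))) \<partial>lborel)"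
      proof (subst nn_integral_eq_integral)
        show "integrable lborel (\<lambda>z. indicator ?D z *\<^sub>R (W z * cmod z ^ (2 * n)))"
          by (intro disc_integrable continuous_intros W_cont)
      qed (auto simp: W_nonneg ennreal_mult integral_nonneg_AE)
      also have "\<dots> = (\<integral>\<^sup>+ z. ennreal ((cmod (c n))\<^sup>2) * ennreal (indicator ?D z *\<^sub>R (W z * cmod z ^ (2 * n))) \<partial>lborel)"
        by (rule nn_integral_cmult[symmetric]) measurable
      also have "\<dots> = (\<integral>\<^sup>+ z. indicator ?D z * (ennreal ((cmod (c n))\<^sup>2) * ennreal (W z * cmod z ^ (2 * n))) \<partial>lborel)"
        by (intro nn_integral_cong) (auto simp: indicator_def)
      finally show "ennreal ((cmod (c n))\<^sup>2 * (\<integral>z. indicator ?D z *\<^sub>R (W z * cmod z ^ (2 * n)) \<partial>lborel))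
        = (\<integral>\<^sup>+ z. indicator ?D z * (ennreal ((cmod (c n))\<^sup>2) * ennreal (W z * cmod z ^ (2 * n))) \<partial>lborel)" .
    qed
    also have "\<dots> = (\<integral>\<^sup>+ z. (\<Sum>n. indicator ?D z * (ennreal ((cmod (c n))\<^sup>2) * ennreal (W z * cmod z ^ (2 * n)))) \<partial>lborel)"
      by (rule nn_integral_suminf[symmetric]) measurable
    finally show "(\<integral>\<^sup>+ z. indicator ?D z * ennreal (W z * (cmod (f z))\<^sup>2) \<partial>lborel)
      = (\<integral>\<^sup>+ z. indicator ?D z * (\<Sum>n. ennreal ((cmod (c n))\<^sup>2) * ennreal (W z * cmod z ^ (2 * n))) \<partial>lborel)"
      by simp
  qed measurable
  also have "\<dots> = (\<Sum>n. \<integral>\<^sup>+ z. ennreal ((cmod (c n))\<^sup>2) * ennreal (W z * cmod z ^ (2 * n)) \<partial>lborel)"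
    by (rule nn_integral_suminf) measurable
  also have "\<dots> = (\<Sum>n. ennreal ((cmod (c n))\<^sup>2) * (\<integral>\<^sup>+ z. ennreal (W z * cmod z ^ (2 * n)) \<partial>lborel))"
    by (simp add: nn_integral_cmult)
  finally show ?thesis .
qed

end

section \<open>The Hilbert space of square-summable sequences\<close>

abbreviation square_summable :: "(nat \<Rightarrow> complex) \<Rightarrow> bool" where
  "square_summable a \<equiv> summable (\<lambda>n. (cmod (a n))\<^sup>2)"

abbreviation square_sum :: "(nat \<Rightarrow> complex) \<Rightarrow> real" where
  "square_sum a \<equiv> (\<Sum>n. (cmod (a n))\<^sup>2)"

abbreviation weighted_summable :: "(nat \<Rightarrow> real) \<Rightarrow> (nat \<Rightarrow> complex) \<Rightarrow> bool" where
  "weighted_summable q a \<equiv> summable (\<lambda>n. q n * (cmod (a n))\<^sup>2)"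

abbreviation weighted_sum :: "(nat \<Rightarrow> real) \<Rightarrow> (nat \<Rightarrow> complex) \<Rightarrow> real" where
  "weighted_sum q a \<equiv> (\<Sum>n. q n * (cmod (a n))\<^sup>2)"

typedef ell2 = "{x :: nat \<Rightarrow> complex. square_summable x}"
  morphisms coord Ell2
  by (rule exI[of _ "\<lambda>_. 0"]) simp

setup_lifting type_definition_ell2

lemma norm_sum_square_le: "(norm (x + y))\<^sup>2 \<le> 2 * (norm x)\<^sup>2 + 2 * (norm y)\<^sup>2"
  for x y :: "'a::real_normed_vector"
proof -
  have "(norm (x + y))\<^sup>2 \<le> (norm x + norm y)\<^sup>2"
    by (intro power_mono norm_triangle_ineq) simp
  also have "\<dots> \<le> 2 * (norm x)\<^sup>2 + 2 * (norm y)\<^sup>2"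
    using zero_le_power2[of "norm x - norm y"] by (simp add: power2_eq_square algebra_simps)
  finally show ?thesis .
qed

lemma square_summable_add:
  fixes x y :: "nat \<Rightarrow> complex"
  assumes "square_summable x" "square_summable y"
  shows "summable (\<lambda>n. (cmod (x n + y n))\<^sup>2)"
  by (rule summable_comparison_test'[where N = 0, OF summable_add[OF summable_mult[OF assms(1), of 2] summable_mult[OF assms(2), of 2]]])
     (use norm_sum_square_le in auto)

lemma square_summable_scale:
  fixes x :: "nat \<Rightarrow> complex"
  assumes "square_summable x"
  shows "summable (\<lambda>n. (cmod (c *\<^sub>R x n))\<^sup>2)"
  using summable_mult[OF assms, of "c\<^sup>2"] by (simp add: power_mult_distrib norm_mult)

lemma square_summable_inner:
  fixes x y :: "nat \<Rightarrow> complex"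
  assumes "square_summable x" "square_summable y"
  shows "summable (\<lambda>n. cmod (x n) * cmod (y n))" "summable (\<lambda>n. x n \<bullet> y n)"
proof -
  have "cmod (x n) * cmod (y n) \<le> (cmod (x n))\<^sup>2 + (cmod (y n))\<^sup>2" for n
  proof -
    have "2 * (cmod (x n) * cmod (y n)) \<le> (cmod (x n))\<^sup>2 + (cmod (y n))\<^sup>2"
      using zero_le_power2[of "cmod (x n) - cmod (y n)"] by (simp add: power2_eq_square algebra_simps)
    moreover have "0 \<le> cmod (x n) * cmod (y n)" by simp
    ultimately show ?thesis by linarith
  qed
  then show 1: "summable (\<lambda>n. cmod (x n) * cmod (y n))"
    by (intro summable_comparison_test'[where N = 0, OF summable_add[OF assms]]) auto
  show "summable (\<lambda>n. x n \<bullet> y n)"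
    by (rule summable_comparison_test'[where N = 0, OF 1]) (simp add: Cauchy_Schwarz_ineq2)
qed

instantiation ell2 :: real_inner
begin

lift_definition zero_ell2 :: ell2 is "\<lambda>_. 0" by simp
lift_definition plus_ell2 :: "ell2 \<Rightarrow> ell2 \<Rightarrow> ell2" is "\<lambda>x y n. x n + y n"
  by (rule square_summable_add)
lift_definition uminus_ell2 :: "ell2 \<Rightarrow> ell2" is "\<lambda>x n. - x n" by simp
lift_definition minus_ell2 :: "ell2 \<Rightarrow> ell2 \<Rightarrow> ell2" is "\<lambda>x y n. x n - y n"
  using square_summable_add[of _ "\<lambda>n. - _ n"] by simp
lift_definition scaleR_ell2 :: "real \<Rightarrow> ell2 \<Rightarrow> ell2" is "\<lambda>c x n. c *\<^sub>R x n"
  by (rule square_summable_scale)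
lift_definition inner_ell2 :: "ell2 \<Rightarrow> ell2 \<Rightarrow> real" is "\<lambda>x y. \<Sum>n. x n \<bullet> y n" .
definition norm_ell2 :: "ell2 \<Rightarrow> real" where "norm_ell2 x = sqrt (inner x x)"
definition dist_ell2 :: "ell2 \<Rightarrow> ell2 \<Rightarrow> real" where "dist_ell2 x y = norm (x - y)"
definition sgn_ell2 :: "ell2 \<Rightarrow> ell2" where "sgn_ell2 x = inverse (norm x) *\<^sub>R x"
definition uniformity_ell2 :: "(ell2 \<times> ell2) filter" where
  "uniformity_ell2 = (INF e\<in>{0<..}. principal {(x, y). dist x y < e})"
definition open_ell2 :: "ell2 set \<Rightarrow> bool" where
  "open_ell2 U \<longleftrightarrow> (\<forall>x\<in>U. \<forall>\<^sub>F (x', y) in uniformity. x' = x \<longrightarrow> y \<in> U)"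

instance
proof
  fix x y z :: ell2 and a b :: real
  show "x + y + z = x + (y + z)" by transfer (simp add: add.assoc)
  show "x + y = y + x" by transfer (simp add: add.commute)
  show "0 + x = x" by transfer simp
  show "- x + x = 0" by transfer simp
  show "x - y = x + - y" by transfer simp
  show "a *\<^sub>R (x + y) = a *\<^sub>R x + a *\<^sub>R y" by transfer (simp add: scaleR_add_right)
  show "(a + b) *\<^sub>R x = a *\<^sub>R x + b *\<^sub>R x" by transfer (simp add: scaleR_add_left)
  show "a *\<^sub>R b *\<^sub>R x = (a * b) *\<^sub>R x" by transfer simp
  show "1 *\<^sub>R x = x" by transfer simp
  show "inner x y = inner y x" by transfer (simp add: inner_commute)
  show "inner (x + y) z = inner x z + inner y z"
    by transfer (simp add: inner_add_left suminf_add[symmetric] square_summable_inner(2))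
  show "inner (a *\<^sub>R x) y = a * inner x y"
    by transfer (simp add: suminf_mult square_summable_inner(2) del: scaleR_complex.simps)
  show "0 \<le> inner x x"
    by transfer (auto intro!: suminf_nonneg square_summable_inner(2))
  show "inner x x = 0 \<longleftrightarrow> x = 0"
  proof (transfer, safe)
    fix x :: "nat \<Rightarrow> complex" assume *: "square_summable x" "(\<Sum>n. x n \<bullet> x n) = 0"
    then have "\<forall>n. x n \<bullet> x n = 0"
      using suminf_eq_zero_iff[OF square_summable_inner(2)[OF *(1) *(1)]] by simp
    then show "x = (\<lambda>_. 0)" by auto
  qed simp
  show "norm x = sqrt (inner x x)" by (rule norm_ell2_def)
  show "dist x y = norm (x - y)" by (rule dist_ell2_def)
  show "sgn x = inverse (norm x) *\<^sub>R x" by (rule sgn_ell2_def)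
qed (simp_all add: uniformity_ell2_def open_ell2_def)

end

lemma coord_simps [simp]:
  "coord 0 n = 0" "coord (x + y) n = coord x n + coord y n" "coord (x - y) n = coord x n - coord y n"
  "coord (- x) n = - coord x n" "coord (c *\<^sub>R x) n = c *\<^sub>R coord x n"
  by (transfer, simp)+

lemma coord_square_summable: "square_summable (coord x)"
  using coord[of x] by simp

lemma ell2_norm_square: "(norm x)\<^sup>2 = (\<Sum>n. (cmod (coord x n))\<^sup>2)"
  unfolding power2_norm_eq_inner by transfer (simp add: power2_norm_eq_inner)

lemma cmod_coord_le_norm: "cmod (coord x n) \<le> norm x"
proof (rule power2_le_imp_le)
  show "(cmod (coord x n))\<^sup>2 \<le> (norm x)\<^sup>2"
    unfolding ell2_norm_square
    using sum_le_suminf[OF coord_square_summable, of "{n}" x] by simp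
qed simp

lemma coord_Ell2: "square_summable f \<Longrightarrow> coord (Ell2 f) = f"
  by (simp add: Ell2_inverse)

lemma ell2_eqI: "(\<And>n. coord x n = coord y n) \<Longrightarrow> x = y"
  by transfer auto

text \<open>Cauchy sequences converge coordinatewise; the tail estimate passes to the coordinatewise limit through
finite partial sums.\<close>

instance ell2 :: complete_space
proof
  fix X :: "nat \<Rightarrow> ell2" assume X: "Cauchy X"
  have "Cauchy (\<lambda>i. coord (X i) n)" for n
  proof (rule metric_CauchyI)
    fix e :: real assume "e > 0"
    then obtain N where N: "\<And>i j. i \<ge> N \<Longrightarrow> j \<ge> N \<Longrightarrow> dist (X i) (X j) < e"
      using metric_CauchyD[OF X] by blast
    have "dist (coord (X i) n) (coord (X j) n) \<le> dist (X i) (X j)" for i j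
      using cmod_coord_le_norm[of "X i - X j" n] by (simp add: dist_norm)
    then show "\<exists>N. \<forall>i\<ge>N. \<forall>j\<ge>N. dist (coord (X i) n) (coord (X j) n) < e"
      using N le_less_trans by blast
  qed
  then have "\<exists>l. (\<lambda>i. coord (X i) n) \<longlonglongrightarrow> l" for n
    by (simp add: Cauchy_convergent_iff convergent_def)
  then obtain l where l: "\<And>n. (\<lambda>i. coord (X i) n) \<longlonglongrightarrow> l n" by metis
  have tail: "\<exists>N. \<forall>i\<ge>N. summable (\<lambda>n. (cmod (coord (X i) n - l n))\<^sup>2) \<and> (\<Sum>n. (cmod (coord (X i) n - l n))\<^sup>2) \<le> e\<^sup>2"
    if e: "e > 0" for e
  proof -
    obtain N where N: "\<And>i j. i \<ge> N \<Longrightarrow> j \<ge> N \<Longrightarrow> dist (X i) (X j) < e"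
      using metric_CauchyD[OF X e] by blast
    have part: "(\<Sum>n<K. (cmod (coord (X i) n - l n))\<^sup>2) \<le> e\<^sup>2" if i: "i \<ge> N" for i K
    proof (rule tendsto_upperbound)
      show "(\<lambda>j. \<Sum>n<K. (cmod (coord (X i) n - coord (X j) n))\<^sup>2) \<longlonglongrightarrow> (\<Sum>n<K. (cmod (coord (X i) n - l n))\<^sup>2)"
        by (intro tendsto_intros l)
      have "(\<Sum>n<K. (cmod (coord (X i) n - coord (X j) n))\<^sup>2) \<le> e\<^sup>2" if "j \<ge> N" for j
      proof -
        have "(\<Sum>n<K. (cmod (coord (X i - X j) n))\<^sup>2) \<le> (norm (X i - X j))\<^sup>2"
          unfolding ell2_norm_square by (rule sum_le_suminf[OF coord_square_summable]) auto
        also have "\<dots> \<le> e\<^sup>2"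
          using N[OF i that] by (intro power_mono) (auto simp: dist_norm)
        finally show ?thesis by simp
      qed
      then show "\<forall>\<^sub>F j in sequentially. (\<Sum>n<K. (cmod (coord (X i) n - coord (X j) n))\<^sup>2) \<le> e\<^sup>2"
        by (auto simp: eventually_sequentially)
    qed simp
    have "summable (\<lambda>n. (cmod (coord (X i) n - l n))\<^sup>2) \<and> (\<Sum>n. (cmod (coord (X i) n - l n))\<^sup>2) \<le> e\<^sup>2"
      if i: "i \<ge> N" for i
    proof
      show *: "summable (\<lambda>n. (cmod (coord (X i) n - l n))\<^sup>2)"
        by (rule summableI_nonneg_bounded[where x = "e\<^sup>2"]) (use part[OF i] in auto)
      show "(\<Sum>n. (cmod (coord (X i) n - l n))\<^sup>2) \<le> e\<^sup>2"
        by (rule suminf_le_const[OF *]) (rule part[OF i])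
    qed
    then show ?thesis by blast
  qed
  have ls: "square_summable l"
  proof -
    obtain i where i: "summable (\<lambda>n. (cmod (coord (X i) n - l n))\<^sup>2)"
      using tail[of 1] by auto
    then have "summable (\<lambda>n. (cmod (l n - coord (X i) n))\<^sup>2)" by (simp add: norm_minus_commute)
    from square_summable_add[OF this coord_square_summable[of "X i"]] show ?thesis by simp
  qed
  have "X \<longlonglongrightarrow> Ell2 l"
  proof (rule metric_LIMSEQ_I)
    fix e :: real assume e: "e > 0"
    obtain N where N: "\<And>i. i \<ge> N \<Longrightarrow> (\<Sum>n. (cmod (coord (X i) n - l n))\<^sup>2) \<le> (e / 2)\<^sup>2"
      using tail[of "e / 2"] e by auto
    have "dist (X i) (Ell2 l) < e" if "i \<ge> N" for i
    proof -
      have "(norm (X i - Ell2 l))\<^sup>2 \<le> (e / 2)\<^sup>2"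
        unfolding ell2_norm_square using N[OF that] by (simp add: coord_Ell2 ls)
      then have "norm (X i - Ell2 l) \<le> e / 2" using e by (simp add: power2_le_iff_abs_le)
      then show ?thesis using e by (simp add: dist_norm)
    qed
    then show "\<exists>N. \<forall>i\<ge>N. dist (X i) (Ell2 l) < e" by blast
  qed
  then show "convergent X" by (auto simp: convergent_def)
qed

instance ell2 :: banach ..

section \<open>Ordinary differential equations in Hilbert spaces\<close>

text \<open>The antiderivative that vanishes at \<open>0\<close>, on both sides of \<open>0\<close>.\<close>

definition signed_integral :: "(real \<Rightarrow> 'a::banach) \<Rightarrow> real \<Rightarrow> 'a" where
  "signed_integral f t = (if 0 \<le> t then integral {0..t} f else - integral {t..0} f)"

lemma signed_integral_zero [simp]: "signed_integral f 0 = 0"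
  by (simp add: signed_integral_def)

lemma signed_integral_has_vector_derivative:
  fixes f :: "real \<Rightarrow> 'a::banach"
  assumes f: "continuous_on UNIV f"
  shows "(signed_integral f has_vector_derivative f t) (at t)"
proof -
  define T where "T = \<bar>t\<bar> + 1"
  have int: "f integrable_on {a..b}" for a b
    by (intro integrable_continuous_interval continuous_on_subset[OF f]) auto
  have eq: "signed_integral f s = integral {-T..s} f - integral {-T..0} f" if "s \<in> {-T<..<T}" for s
  proof (cases "0 \<le> s")
    case True
    have "integral {-T..0} f + integral {0..s} f = integral {-T..s} f"
      by (rule Henstock_Kurzweil_Integration.integral_combine) (use True that int in auto)
    then show ?thesis using True by (simp add: signed_integral_def algebra_simps)
  next
    case False
    have "integral {-T..s} f + integral {s..0} f = integral {-T..0} f"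
      by (rule Henstock_Kurzweil_Integration.integral_combine) (use False that int in auto)
    then show ?thesis using False by (simp add: signed_integral_def algebra_simps)
  qed
  have t: "t \<in> {-T<..<T}" by (auto simp: T_def)
  have "((\<lambda>u. integral {-T..u} f) has_vector_derivative f t) (at t within {-T..T})"
    using t by (intro integral_has_vector_derivative continuous_on_subset[OF f]) auto
  then have "((\<lambda>u. integral {-T..u} f) has_vector_derivative f t) (at t)"
    using t by (simp add: at_within_Icc_at)
  then have "((\<lambda>u. integral {-T..u} f - integral {-T..0} f) has_vector_derivative f t - 0) (at t)"
    by (intro has_vector_derivative_diff has_vector_derivative_const)
  then have "((\<lambda>u. integral {-T..u} f - integral {-T..0} f) has_vector_derivative f t) (at t)" by simp
  then show ?thesis
    by (rule has_vector_derivative_transform_within_open[where S = "{-T<..<T}"]) (use t eq in auto)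
qed

lemma signed_integral_diff:
  fixes f g :: "real \<Rightarrow> 'a::banach"
  assumes f: "continuous_on UNIV f" and g: "continuous_on UNIV g"
  shows "signed_integral f t - signed_integral g t = signed_integral (\<lambda>s. f s - g s) t"
proof -
  have int: "f integrable_on {a..b}" "g integrable_on {a..b}" for a b
    by (intro integrable_continuous_interval continuous_on_subset[OF f] continuous_on_subset[OF g]; auto)+
  show ?thesis by (simp add: signed_integral_def int Henstock_Kurzweil_Integration.integral_diff)
qed

lemma integral_exp_bound:
  fixes f :: "real \<Rightarrow> 'a::banach"
  assumes f: "continuous_on UNIV f" and ab: "a \<le> b" and \<mu>: "\<mu> \<noteq> 0"
    and bound: "\<And>s. s \<in> {a..b} \<Longrightarrow> norm (f s) \<le> K * exp (\<mu> * s)"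
  shows "norm (integral {a..b} f) \<le> K / \<mu> * (exp (\<mu> * b) - exp (\<mu> * a))"
proof -
  have "((\<lambda>s. K * exp (\<mu> * s)) has_integral (K / \<mu> * exp (\<mu> * b) - K / \<mu> * exp (\<mu> * a))) {a..b}"
    using ab \<mu> by (intro fundamental_theorem_of_calculus)
      (auto intro!: derivative_eq_intros simp flip: has_real_derivative_iff_has_vector_derivative)
  then have g: "(\<lambda>s. K * exp (\<mu> * s)) integrable_on {a..b}"
    "integral {a..b} (\<lambda>s. K * exp (\<mu> * s)) = K / \<mu> * (exp (\<mu> * b) - exp (\<mu> * a))"
    by (auto simp: has_integral_iff right_diff_distrib)
  have "f integrable_on {a..b}"
    by (intro integrable_continuous_interval continuous_on_subset[OF f]) auto
  from integral_norm_bound_integral[OF this g(1) bound] show ?thesis unfolding g(2) .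
qed

lemma signed_integral_exp_bound:
  fixes f :: "real \<Rightarrow> 'a::banach"
  assumes f: "continuous_on UNIV f" and \<mu>: "\<mu> > 0"
    and bound: "\<And>s. norm (f s) \<le> K * exp (\<mu> * \<bar>s\<bar>)"
  shows "norm (signed_integral f t) \<le> K / \<mu> * exp (\<mu> * \<bar>t\<bar>)"
proof -
  have K: "0 \<le> K / \<mu>" using order_trans[OF norm_ge_zero bound[of 0]] \<mu> by simp
  have "norm (signed_integral f t) \<le> K / \<mu> * (exp (\<mu> * \<bar>t\<bar>) - 1)"
  proof (cases "0 \<le> t")
    case True
    have "norm (f s) \<le> K * exp (\<mu> * s)" if "s \<in> {0..t}" for s using bound[of s] that by simp
    from integral_exp_bound[OF f True _ this] show ?thesis using True \<mu> by (simp add: signed_integral_def)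
  next
    case False
    have "norm (f s) \<le> K * exp (- \<mu> * s)" if "s \<in> {t..0}" for s using bound[of s] that by simp
    moreover have "t \<le> 0" "- \<mu> \<noteq> 0" using False \<mu> by auto
    ultimately have "norm (integral {t..0} f) \<le> K / - \<mu> * (exp (- \<mu> * 0) - exp (- \<mu> * t))"
      by (intro integral_exp_bound f)
    then show ?thesis using False by (simp add: signed_integral_def right_diff_distrib)
  qed
  also have "\<dots> \<le> K / \<mu> * exp (\<mu> * \<bar>t\<bar>)" using K by (intro mult_left_mono) auto
  finally show ?thesis .
qed

text \<open>Picard iteration as one contraction on the whole line: in the norm with weight \<open>exp (-\<mu> |t|)\<close>, where
\<open>\<mu> = 2 L + 1\<close>, integration gains the factor \<open>L / \<mu> \<le> 1/2\<close>. Boundedness of \<open>F\<close> keeps the iterates in the weighted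
space.\<close>

lemma global_lipschitz_solution:
  fixes F :: "'a::banach \<Rightarrow> 'a"
  assumes lip: "L-lipschitz_on UNIV F" and bnd: "\<And>x. norm (F x) \<le> M"
  shows "\<exists>x. x 0 = x0 \<and> (\<forall>t. (x has_vector_derivative F (x t)) (at t))"
proof -
  have L0: "L \<ge> 0" using lip by (rule lipschitz_on_nonneg)
  define \<mu> where "\<mu> = 2 * L + 1"
  have \<mu>: "\<mu> > 0" using L0 by (simp add: \<mu>_def)
  have F_cont: "continuous_on UNIV F" using lip by (rule lipschitz_on_continuous_on)
  define G where "G y s = F (exp (\<mu> * \<bar>s\<bar>) *\<^sub>R apply_bcontfun y s)" for y :: "real \<Rightarrow>\<^sub>C 'a" and s
  have y_cont: "continuous_on UNIV (apply_bcontfun y)" for y :: "real \<Rightarrow>\<^sub>C 'a"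
    using apply_bcontfun[of y] by (simp add: bcontfun_def)
  have G_cont: "continuous_on UNIV (G y)" for y
    unfolding G_def by (intro continuous_on_compose2[OF F_cont] continuous_intros y_cont) auto
  have P_cont: "continuous_on UNIV (signed_integral (G y))" for y
    using signed_integral_has_vector_derivative[OF G_cont]
    by (auto simp: continuous_on_eq_continuous_at intro: has_vector_derivative_continuous)
  define \<phi> where "\<phi> y t = exp (- \<mu> * \<bar>t\<bar>) *\<^sub>R (x0 + signed_integral (G y) t)" for y t
  have \<phi>: "\<phi> y \<in> bcontfun" for y
  proof -
    have "continuous_on UNIV (\<phi> y)" unfolding \<phi>_def by (intro continuous_intros P_cont)
    moreover have "norm (\<phi> y t) \<le> norm x0 + M / \<mu>" for t
    proof -
      have "M \<ge> 0" using bnd[of 0] norm_ge_zero order_trans by blast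
      have "norm (G y s) \<le> M * exp (\<mu> * \<bar>s\<bar>)" for s
      proof -
        have "norm (G y s) \<le> M * 1" using bnd by (simp add: G_def)
        also have "\<dots> \<le> M * exp (\<mu> * \<bar>s\<bar>)" using \<mu> \<open>M \<ge> 0\<close> by (intro mult_left_mono) auto
        finally show ?thesis .
      qed
      then have 1: "norm (signed_integral (G y) t) \<le> M / \<mu> * exp (\<mu> * \<bar>t\<bar>)"
        by (intro signed_integral_exp_bound G_cont \<mu>)
      have "norm (\<phi> y t) \<le> exp (- \<mu> * \<bar>t\<bar>) * (norm x0 + M / \<mu> * exp (\<mu> * \<bar>t\<bar>))"
        unfolding \<phi>_def norm_scaleR using norm_triangle_le[OF add_left_mono[OF 1, of "norm x0"]] by simp
      also have "\<dots> = exp (- \<mu> * \<bar>t\<bar>) * norm x0 + M / \<mu>"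
        by (simp add: algebra_simps exp_minus)
      also have "\<dots> \<le> norm x0 + M / \<mu>"
        using \<mu> by (simp add: mult_left_le_one_le)
      finally show ?thesis .
    qed
    ultimately show ?thesis
      by (auto simp: bcontfun_def bounded_iff)
  qed
  define \<Phi> where "\<Phi> y = Bcontfun (\<phi> y)" for y
  have \<Phi>: "apply_bcontfun (\<Phi> y) = \<phi> y" for y
    unfolding \<Phi>_def by (rule Bcontfun_inverse) (rule \<phi>)
  have "dist (\<Phi> y) (\<Phi> z) \<le> 1/2 * dist y z" for y z
  proof (rule dist_bound)
    fix t
    have "norm (G y s - G z s) \<le> (L * dist y z) * exp (\<mu> * \<bar>s\<bar>)" for s
    proof -
      have "norm (G y s - G z s) \<le> L * dist (exp (\<mu> * \<bar>s\<bar>) *\<^sub>R apply_bcontfun y s) (exp (\<mu> * \<bar>s\<bar>) *\<^sub>R apply_bcontfun z s)"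
        unfolding G_def dist_norm[symmetric] using lip by (rule lipschitz_onD) auto
      also have "\<dots> = L * (exp (\<mu> * \<bar>s\<bar>) * dist (apply_bcontfun y s) (apply_bcontfun z s))"
        by (simp add: dist_norm scaleR_diff_right[symmetric])
      also have "\<dots> \<le> L * (exp (\<mu> * \<bar>s\<bar>) * dist y z)"
        using L0 by (intro mult_left_mono dist_bounded) auto
      finally show ?thesis by (simp add: mult_ac)
    qed
    then have "norm (signed_integral (\<lambda>s. G y s - G z s) t) \<le> (L * dist y z) / \<mu> * exp (\<mu> * \<bar>t\<bar>)"
      by (intro signed_integral_exp_bound continuous_on_diff G_cont \<mu>)
    then have 2: "norm (signed_integral (G y) t - signed_integral (G z) t) \<le> (L * dist y z) / \<mu> * exp (\<mu> * \<bar>t\<bar>)"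
      by (simp add: signed_integral_diff G_cont)
    have "dist (apply_bcontfun (\<Phi> y) t) (apply_bcontfun (\<Phi> z) t)
        = exp (- \<mu> * \<bar>t\<bar>) * norm (signed_integral (G y) t - signed_integral (G z) t)"
      unfolding \<Phi> \<phi>_def dist_norm scaleR_diff_right[symmetric] by simp
    also have "\<dots> \<le> exp (- \<mu> * \<bar>t\<bar>) * ((L * dist y z) / \<mu> * exp (\<mu> * \<bar>t\<bar>))"
      using 2 by (intro mult_left_mono) auto
    also have "\<dots> = (L / \<mu>) * dist y z" by (simp add: exp_minus)
    also have "\<dots> \<le> 1/2 * dist y z"
      using L0 by (intro mult_right_mono) (auto simp: \<mu>_def field_simps)
    finally show "dist (apply_bcontfun (\<Phi> y) t) (apply_bcontfun (\<Phi> z) t) \<le> 1/2 * dist y z" .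
  qed
  then obtain y where y: "\<Phi> y = y"
    using banach_fix_type[of "1/2" \<Phi>] by auto
  define x where "x t = exp (\<mu> * \<bar>t\<bar>) *\<^sub>R apply_bcontfun y t" for t
  have x_eq: "x t = x0 + signed_integral (\<lambda>s. F (x s)) t" for t
  proof -
    have "apply_bcontfun y t = \<phi> y t" using \<Phi>[of y] y by simp
    then have "x t = (exp (\<mu> * \<bar>t\<bar>) * exp (- \<mu> * \<bar>t\<bar>)) *\<^sub>R (x0 + signed_integral (G y) t)"
      by (simp add: x_def \<phi>_def)
    also have "exp (\<mu> * \<bar>t\<bar>) * exp (- \<mu> * \<bar>t\<bar>) = 1" by (simp add: exp_minus)
    finally show ?thesis by (simp add: G_def[abs_def] x_def)
  qed
  have F_x: "continuous_on UNIV (\<lambda>s. F (x s))"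
    using G_cont[of y] by (simp add: G_def[abs_def] x_def)
  have "(x has_vector_derivative F (x t)) (at t)" for t
  proof -
    have "((\<lambda>t. x0 + signed_integral (\<lambda>s. F (x s)) t) has_vector_derivative 0 + F (x t)) (at t)"
      by (intro has_vector_derivative_add has_vector_derivative_const signed_integral_has_vector_derivative F_x)
    moreover have "(\<lambda>t. x0 + signed_integral (\<lambda>s. F (x s)) t) = x" by (rule ext) (rule x_eq[symmetric])
    ultimately show ?thesis by (simp only: add_0)
  qed
  moreover have "x 0 = x0" using x_eq[of 0] by simp
  ultimately show ?thesis by blast
qed

text \<open>Forwards in time \<open>g(t) exp (-K t)\<close> is nonincreasing, backwards \<open>g(t) exp (K t)\<close> is nondecreasing.\<close>

lemma gronwall_zero:
  fixes g g' :: "real \<Rightarrow> real"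
  assumes deriv: "\<And>t. \<bar>t\<bar> < T \<Longrightarrow> (g has_real_derivative g' t) (at t)"
    and bound: "\<And>t. \<bar>t\<bar> < T \<Longrightarrow> \<bar>g' t\<bar> \<le> K * g t"
    and zero: "g 0 = 0" and t: "\<bar>t\<bar> < T"
  shows "g t \<le> 0"
proof (cases "0 \<le> t")
  case True
  have "g t * exp (- K * t) \<le> g 0 * exp (- K * 0)"
  proof (rule DERIV_nonpos_imp_nonincreasing[OF True, of "\<lambda>s. g s * exp (- K * s)"], rule exI, rule conjI)
    fix s assume "0 \<le> s" "s \<le> t"
    then have s: "\<bar>s\<bar> < T" using t by simp
    show "((\<lambda>s. g s * exp (- K * s)) has_real_derivative (g' s - K * g s) * exp (- K * s)) (at s)"
      by (auto intro!: derivative_eq_intros deriv[OF s] simp: algebra_simps)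
    show "(g' s - K * g s) * exp (- K * s) \<le> 0"
      using bound[OF s] by (intro mult_nonpos_nonneg) auto
  qed
  then show ?thesis by (simp add: zero mult_le_0_iff)
next
  case False
  have "g t * exp (K * t) \<le> g 0 * exp (K * 0)"
  proof (rule DERIV_nonneg_imp_nondecreasing[of t 0 "\<lambda>s. g s * exp (K * s)"], use False in simp, rule exI, rule conjI)
    fix s assume "t \<le> s" "s \<le> 0"
    then have s: "\<bar>s\<bar> < T" using t by simp
    show "((\<lambda>s. g s * exp (K * s)) has_real_derivative (g' s + K * g s) * exp (K * s)) (at s)"
      by (auto intro!: derivative_eq_intros deriv[OF s] simp: algebra_simps)
    show "0 \<le> (g' s + K * g s) * exp (K * s)"
      using bound[OF s] by (intro mult_nonneg_nonneg) auto
  qed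
  then show ?thesis by (simp add: zero mult_le_0_iff)
qed

text \<open>Two solutions stay in a common ball on a compact time interval, where \<open>F\<close> is Lipschitz, and Gronwall
applies to the squared distance.\<close>

lemma ode_solution_unique:
  fixes F :: "'a::{real_inner,banach} \<Rightarrow> 'a"
  assumes lip: "\<And>R. \<exists>L. L-lipschitz_on (cball 0 R) F"
    and x: "\<And>t. \<bar>t\<bar> < T \<Longrightarrow> (x has_vector_derivative F (x t)) (at t)"
    and y: "\<And>t. \<bar>t\<bar> < T \<Longrightarrow> (y has_vector_derivative F (y t)) (at t)"
    and init: "x 0 = y 0" and t: "\<bar>t\<bar> < T"
  shows "x t = y t"
proof -
  obtain S where S: "\<bar>t\<bar> < S" "S < T" using dense[OF t] by blast
  have cont: "continuous_on {-S..S} z" if "\<And>t. \<bar>t\<bar> < T \<Longrightarrow> (z has_vector_derivative F (z t)) (at t)" for z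
  proof (intro continuous_at_imp_continuous_on ballI)
    fix s assume "s \<in> {-S..S}"
    then have "\<bar>s\<bar> < T" using S by auto
    from has_vector_derivative_continuous[OF that[OF this]] show "isCont z s" .
  qed
  have "bounded (x ` {-S..S} \<union> y ` {-S..S})"
    using cont[OF x] cont[OF y] by (auto intro!: compact_imp_bounded compact_continuous_image)
  then obtain R where R: "\<And>z. z \<in> x ` {-S..S} \<union> y ` {-S..S} \<Longrightarrow> norm z \<le> R"
    by (auto simp: bounded_iff)
  obtain L where L: "L-lipschitz_on (cball 0 R) F" using lip by blast
  define g where "g t = (x t - y t) \<bullet> (x t - y t)" for t
  have "g t \<le> 0"
  proof (rule gronwall_zero[where K = "2 * L" and T = S and g = g and t = t
        and g' = "\<lambda>s. 2 * ((x s - y s) \<bullet> (F (x s) - F (y s)))"])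
    fix s assume s: "\<bar>s\<bar> < S"
    then have sT: "\<bar>s\<bar> < T" using S by simp
    show "(g has_real_derivative 2 * ((x s - y s) \<bullet> (F (x s) - F (y s)))) (at s)"
    proof -
      have "((\<lambda>s. x s - y s) has_vector_derivative F (x s) - F (y s)) (at s)"
        by (intro has_vector_derivative_diff x y sT)
      from bounded_bilinear.has_vector_derivative[OF bounded_bilinear_inner this this]
      show ?thesis unfolding g_def[abs_def] has_real_derivative_iff_has_vector_derivative
        by (simp add: inner_commute)
    qed
    have "norm (F (x s) - F (y s)) \<le> L * norm (x s - y s)"
    proof -
      have "s \<in> {-S..S}" using s by auto
      then have "norm (x s) \<le> R" "norm (y s) \<le> R" using R by blast+
      then show ?thesis using lipschitz_onD[OF L, of "x s" "y s"] by (simp add: dist_norm)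
    qed
    then have "\<bar>(x s - y s) \<bullet> (F (x s) - F (y s))\<bar> \<le> norm (x s - y s) * (L * norm (x s - y s))"
      by (intro order_trans[OF Cauchy_Schwarz_ineq2] mult_left_mono) auto
    then show "\<bar>2 * ((x s - y s) \<bullet> (F (x s) - F (y s)))\<bar> \<le> 2 * L * g s"
      unfolding g_def power2_norm_eq_inner[symmetric] by (simp add: power2_eq_square algebra_simps abs_mult)
  qed (use init S in \<open>auto simp: g_def\<close>)
  then have "norm (x t - y t) ^ 2 \<le> 0" by (simp only: g_def power2_norm_eq_inner)
  then show ?thesis by simp
qed

text \<open>The a priori bound is required for all equations \<open>x' = \<theta>(t) F(x)\<close> with \<open>0 \<le> \<theta> \<le> 1\<close>, because the proof
solves \<open>x' = c(x) F(x)\<close> with a Lipschitz cut-off \<open>c\<close> that is \<open>1\<close> on the ball of radius \<open>R\<close> and \<open>0\<close> outside the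
ball of radius \<open>2 R\<close>. The bound then confines the solution to the region where \<open>c = 1\<close> during \<open>[-T, T]\<close>, and the
solutions for different \<open>T\<close> agree by uniqueness.\<close>

lemma global_solution_of_apriori_bound:
  fixes F :: "'a::{real_inner,banach} \<Rightarrow> 'a"
  assumes lip: "\<And>R. \<exists>L. L-lipschitz_on (cball 0 R) F"
    and apriori: "\<And>T. \<exists>R. \<forall>\<theta> x. (\<forall>t. 0 \<le> \<theta> t \<and> \<theta> t \<le> 1) \<longrightarrow> x 0 = x0 \<longrightarrow>
      (\<forall>t. (x has_vector_derivative \<theta> t *\<^sub>R F (x t)) (at t)) \<longrightarrow> (\<forall>t. \<bar>t\<bar> \<le> T \<longrightarrow> norm (x t) \<le> R)"
  shows "\<exists>x. x 0 = x0 \<and> (\<forall>t. (x has_vector_derivative F (x t)) (at t))"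
proof -
  have "\<exists>x. x 0 = x0 \<and> (\<forall>t. \<bar>t\<bar> < T \<longrightarrow> (x has_vector_derivative F (x t)) (at t))" for T :: real
  proof -
    obtain R0 where R0: "\<And>\<theta> x t. (\<And>t. 0 \<le> \<theta> t \<and> \<theta> t \<le> 1) \<Longrightarrow> x 0 = x0 \<Longrightarrow>
      (\<And>t. (x has_vector_derivative \<theta> t *\<^sub>R F (x t)) (at t)) \<Longrightarrow> \<bar>t\<bar> \<le> T \<Longrightarrow> norm (x t) \<le> R0"
      using apriori[of T] by blast
    define R where "R = max R0 1"
    have R: "R > 0" by (simp add: R_def)
    obtain L where L: "L-lipschitz_on (cball 0 (2 * R)) F" using lip by blast
    have L0: "L \<ge> 0" using L by (rule lipschitz_on_nonneg)
    define M where "M = norm (F 0) + L * (2 * R)"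
    have M0: "M \<ge> 0" using L0 R by (simp add: M_def)
    have FM: "norm (F x) \<le> M" if "norm x \<le> 2 * R" for x
    proof -
      have "norm (F x - F 0) \<le> L * norm (x - 0)"
        using lipschitz_onD[OF L, of x 0] that R by (simp add: dist_norm)
      also have "\<dots> \<le> L * (2 * R)" using that L0 by (intro mult_left_mono) auto
      finally show ?thesis using norm_triangle_sub[of "F x" "F 0"] by (simp add: M_def)
    qed
    define c where "c x = max 0 (min 1 (2 - norm x / R))" for x :: 'a
    have c01: "0 \<le> c x" "c x \<le> 1" for x by (auto simp: c_def)
    have c_lip: "\<bar>c x - c y\<bar> \<le> norm (x - y) / R" for x y
    proof -
      have "\<bar>c x - c y\<bar> \<le> \<bar>norm x / R - norm y / R\<bar>" by (auto simp: c_def)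
      also have "\<dots> = \<bar>norm x - norm y\<bar> / R" using R by (simp add: diff_divide_distrib[symmetric])
      also have "\<dots> \<le> norm (x - y) / R" using R by (intro divide_right_mono norm_triangle_ineq3) auto
      finally show ?thesis .
    qed
    have c_out: "c x = 0" if "\<not> norm x \<le> 2 * R" for x
    proof -
      have "norm x / R > 2" using that R by (simp add: field_simps)
      then show ?thesis by (simp add: c_def)
    qed
    define G where "G x = c x *\<^sub>R F x" for x
    have G_bnd: "norm (G x) \<le> M" for x
    proof (cases "norm x \<le> 2 * R")
      case True
      then have "norm (G x) \<le> 1 * M"
        unfolding G_def norm_scaleR using c01[of x] FM by (intro mult_mono) auto
      then show ?thesis by simp
    qed (use M0 in \<open>simp add: G_def c_out\<close>)
    have half: "norm (G x - G y) \<le> (L + M / R) * norm (x - y)" if y: "norm y \<le> 2 * R" for x y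
    proof (cases "norm x \<le> 2 * R")
      case True
      have "G x - G y = c x *\<^sub>R (F x - F y) + (c x - c y) *\<^sub>R F y"
        by (simp add: G_def algebra_simps)
      also have "norm \<dots> \<le> norm (c x *\<^sub>R (F x - F y)) + norm ((c x - c y) *\<^sub>R F y)"
        by (rule norm_triangle_ineq)
      also have "\<dots> \<le> 1 * (L * norm (x - y)) + (norm (x - y) / R) * M"
      proof (rule add_mono)
        have "norm (F x - F y) \<le> L * norm (x - y)"
          using lipschitz_onD[OF L, of x y] True y by (simp add: dist_norm)
        then show "norm (c x *\<^sub>R (F x - F y)) \<le> 1 * (L * norm (x - y))"
          unfolding norm_scaleR using c01[of x] by (intro mult_mono) auto
        show "norm ((c x - c y) *\<^sub>R F y) \<le> (norm (x - y) / R) * M"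
          unfolding norm_scaleR using c_lip[of x y] FM[OF y] R by (intro mult_mono) auto
      qed
      finally show ?thesis by (simp add: algebra_simps)
    next
      case False
      then have "norm (G x - G y) = \<bar>c x - c y\<bar> * norm (F y)"
        by (simp add: G_def c_out)
      also have "\<dots> \<le> (norm (x - y) / R) * M"
        using c_lip[of x y] FM[OF y] R by (intro mult_mono) auto
      also have "\<dots> \<le> (L + M / R) * norm (x - y)" using L0 by (simp add: algebra_simps)
      finally show ?thesis .
    qed
    have "(L + M / R)-lipschitz_on UNIV G"
    proof (rule lipschitz_onI)
      fix x y
      show "dist (G x) (G y) \<le> (L + M / R) * dist x y"
      proof (cases "norm y \<le> 2 * R")
        case True then show ?thesis using half by (simp add: dist_norm)
      next
        case y: False
        show ?thesis
        proof (cases "norm x \<le> 2 * R")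
          case True then show ?thesis using half[of x y] by (simp add: dist_norm norm_minus_commute)
        next
          case False then show ?thesis using y L0 M0 R by (simp add: G_def c_out)
        qed
      qed
    qed (use L0 M0 R in simp)
    from global_lipschitz_solution[OF this G_bnd, of x0]
    obtain x where x: "x 0 = x0" "\<And>t. (x has_vector_derivative G (x t)) (at t)" by blast
    have "norm (x t) \<le> R" if "\<bar>t\<bar> < T" for t
      using R0[of "\<lambda>t. c (x t)" x t] x c01 that by (auto simp: G_def R_def)
    then have "c (x t) = 1" if "\<bar>t\<bar> < T" for t
      using that R by (auto simp: c_def field_simps min_def max_def)
    then have "G (x t) = F (x t)" if "\<bar>t\<bar> < T" for t using that by (simp add: G_def)
    then have "\<forall>t. \<bar>t\<bar> < T \<longrightarrow> (x has_vector_derivative F (x t)) (at t)" using x(2) by metis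
    then show ?thesis using x(1) by blast
  qed
  then obtain xs :: "real \<Rightarrow> real \<Rightarrow> 'a" where xs: "\<And>T. xs T 0 = x0"
    "\<And>T t. \<bar>t\<bar> < T \<Longrightarrow> (xs T has_vector_derivative F (xs T t)) (at t)"
    by metis
  \<comment> \<open>Near \<open>t\<close> this agrees with the single solution \<open>xs (|t| + 1)\<close>, by uniqueness.\<close>
  define x where "x t = xs (\<bar>t\<bar> + 1) t" for t
  have x: "x t = xs T t" if "\<bar>t\<bar> < T" for t T
    unfolding x_def
    by (rule ode_solution_unique[where F = F and T = "min (\<bar>t\<bar> + 1) T"]) (use that xs lip in auto)
  have "(x has_vector_derivative F (x t)) (at t)" for t
  proof -
    have "(xs (\<bar>t\<bar> + 1) has_vector_derivative F (x t)) (at t)"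
      using xs(2)[of t "\<bar>t\<bar> + 1"] by (simp add: x_def)
    then show ?thesis
      by (rule has_vector_derivative_transform_within_open[where S = "ball 0 (\<bar>t\<bar> + 1)"])
         (auto simp: dist_norm x)
  qed
  moreover have "x 0 = x0" by (simp add: x_def xs)
  ultimately show ?thesis by blast
qed

text \<open>Having \<open>n\<close> derivatives on the whole line, set up for induction on \<open>n\<close>; continuity is not recorded
for \<open>n = 0\<close>.\<close>

primrec times_differentiable :: "nat \<Rightarrow> (real \<Rightarrow> 'a::real_normed_vector) \<Rightarrow> bool" where
  "times_differentiable 0 x = True"
| "times_differentiable (Suc n) x = (\<exists>x'. (\<forall>t. (x has_vector_derivative x' t) (at t)) \<and> times_differentiable n x')"

lemma times_differentiable_SucI:
  "(\<And>t. (x has_vector_derivative x' t) (at t)) \<Longrightarrow> times_differentiable n x' \<Longrightarrow> times_differentiable (Suc n) x"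
  unfolding times_differentiable.simps by blast

lemma times_differentiable_SucE:
  assumes "times_differentiable (Suc n) x"
  obtains x' where "\<And>t. (x has_vector_derivative x' t) (at t)" "times_differentiable n x'"
  using assms unfolding times_differentiable.simps by blast

lemma times_differentiable_SucD: "times_differentiable (Suc n) x \<Longrightarrow> times_differentiable n x"
proof (induction n arbitrary: x)
  case (Suc n)
  from Suc.prems obtain x' where "\<And>t. (x has_vector_derivative x' t) (at t)" "times_differentiable (Suc n) x'"
    by (rule times_differentiable_SucE) blast
  then show ?case by (intro times_differentiable_SucI[of x x'] Suc.IH)
qed simp

lemma times_differentiable_add:
  "times_differentiable n x \<Longrightarrow> times_differentiable n y \<Longrightarrow> times_differentiable n (\<lambda>t. x t + y t)"
proof (induction n arbitrary: x y)
  case (Suc n)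
  obtain x' where x': "\<And>t. (x has_vector_derivative x' t) (at t)" "times_differentiable n x'"
    using Suc.prems(1) by (rule times_differentiable_SucE) blast
  obtain y' where y': "\<And>t. (y has_vector_derivative y' t) (at t)" "times_differentiable n y'"
    using Suc.prems(2) by (rule times_differentiable_SucE) blast
  show ?case
    by (rule times_differentiable_SucI[of _ "\<lambda>t. x' t + y' t"])
       (intro has_vector_derivative_add Suc.IH x' y')+
qed simp

lemma times_differentiable_linear:
  assumes h: "bounded_linear h"
  shows "times_differentiable n x \<Longrightarrow> times_differentiable n (\<lambda>t. h (x t))"
proof (induction n arbitrary: x)
  case (Suc n)
  obtain x' where x': "\<And>t. (x has_vector_derivative x' t) (at t)" "times_differentiable n x'"
    using Suc.prems(1) by (rule times_differentiable_SucE) blast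
  show ?case
    by (rule times_differentiable_SucI[of _ "\<lambda>t. h (x' t)"])
       (intro bounded_linear.has_vector_derivative[OF h] Suc.IH x')+
qed simp

lemma times_differentiable_bilinear:
  assumes p: "bounded_bilinear p"
  shows "times_differentiable n x \<Longrightarrow> times_differentiable n y \<Longrightarrow> times_differentiable n (\<lambda>t. p (x t) (y t))"
proof (induction n arbitrary: x y)
  case (Suc n)
  obtain x' where x': "\<And>t. (x has_vector_derivative x' t) (at t)" "times_differentiable n x'"
    using Suc.prems(1) by (rule times_differentiable_SucE) blast
  obtain y' where y': "\<And>t. (y has_vector_derivative y' t) (at t)" "times_differentiable n y'"
    using Suc.prems(2) by (rule times_differentiable_SucE) blast
  show ?case
  proof (rule times_differentiable_SucI)
    show "((\<lambda>t. p (x t) (y t)) has_vector_derivative p (x t) (y' t) + p (x' t) (y t)) (at t)" for t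
      by (intro bounded_bilinear.has_vector_derivative[OF p] x' y')
    show "times_differentiable n (\<lambda>t. p (x t) (y' t) + p (x' t) (y t))"
      by (intro times_differentiable_add Suc.IH x' y' times_differentiable_SucD[OF Suc.prems(1)] times_differentiable_SucD[OF Suc.prems(2)])
  qed
qed simp

lemma times_differentiable_Pair:
  "times_differentiable n x \<Longrightarrow> times_differentiable n y \<Longrightarrow> times_differentiable n (\<lambda>t. (x t, y t))"
proof (induction n arbitrary: x y)
  case (Suc n)
  obtain x' where x': "\<And>t. (x has_vector_derivative x' t) (at t)" "times_differentiable n x'"
    using Suc.prems(1) by (rule times_differentiable_SucE) blast
  obtain y' where y': "\<And>t. (y has_vector_derivative y' t) (at t)" "times_differentiable n y'"
    using Suc.prems(2) by (rule times_differentiable_SucE) blast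
  show ?case
    by (rule times_differentiable_SucI[of _ "\<lambda>t. (x' t, y' t)"])
       (intro has_vector_derivative_Pair Suc.IH x' y')+
qed simp

text \<open>If \<open>x\<close> has \<open>n\<close> derivatives, so has \<open>x' = F(x)\<close>, and hence \<open>x\<close> has \<open>n + 1\<close>.\<close>

lemma autonomous_solution_smooth:
  assumes F: "\<And>n x. times_differentiable n x \<Longrightarrow> times_differentiable n (\<lambda>t. F (x t))"
    and x: "\<And>t. (x has_vector_derivative F (x t)) (at t)"
  shows "times_differentiable n x"
proof (induction n)
  case (Suc n)
  show ?case by (rule times_differentiable_SucI[OF x F[OF Suc.IH]])
qed simp

lemma smooth_derivative_sequence:
  fixes x :: "real \<Rightarrow> 'a::real_normed_vector"
  assumes "\<And>n. times_differentiable n x"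
  shows "\<exists>D. D 0 = x \<and> (\<forall>n t. (D n has_vector_derivative D (Suc n) t) (at t))"
proof -
  define D where "D n = ((\<lambda>y t. vector_derivative y (at t)) ^^ n) x" for n
  have step: "(y has_vector_derivative vector_derivative y (at t)) (at t)"
      "times_differentiable n (\<lambda>t. vector_derivative y (at t))"
    if y: "\<And>n. times_differentiable n y" for y :: "real \<Rightarrow> 'a" and n t
  proof -
    obtain y' where y': "\<And>t. (y has_vector_derivative y' t) (at t)" "times_differentiable n y'"
      using y[of "Suc n"] by (rule times_differentiable_SucE) blast
    have "y' = (\<lambda>t. vector_derivative y (at t))"
      by (intro ext vector_derivative_at[symmetric] y'(1))
    then show "(y has_vector_derivative vector_derivative y (at t)) (at t)"
      "times_differentiable n (\<lambda>t. vector_derivative y (at t))" using y' by simp_all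
  qed
  have D: "times_differentiable m (D n)" for n m
  proof (induction n arbitrary: m)
    case 0 then show ?case by (simp add: D_def assms)
  next
    case (Suc n)
    have "times_differentiable m (\<lambda>t. vector_derivative (D n) (at t))" by (rule step(2)) (rule Suc.IH)
    then show ?case by (simp add: D_def)
  qed
  have "(D n has_vector_derivative D (Suc n) t) (at t)" for n t
    using step(1)[of "D n" t] D by (simp add: D_def)
  then show ?thesis by (intro exI[of _ D]) (simp add: D_def)
qed

section \<open>The cubic nonlinearity in coefficients\<close>

text \<open>Rearrangement of an absolutely convergent double series from antidiagonals to rows. All exchanges of
summation below go through this lemma.\<close>

lemma antidiagonal_sums:
  fixes g :: "nat \<Rightarrow> nat \<Rightarrow> 'b::banach"
  assumes g: "summable (\<lambda>S. \<Sum>n\<le>S. norm (g n (S - n)))"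
  shows "summable (\<lambda>m. norm (g n m))"
    and "(\<lambda>n. \<Sum>m. g n m) sums (\<Sum>S. \<Sum>n\<le>S. g n (S - n))"
proof -
  let ?G = "\<lambda>(n, m). g n m" and ?h = "\<lambda>(S, n). g n (S - n)" and ?A = "Sigma UNIV (\<lambda>S::nat. {..S})"
  have bij: "bij_betw (\<lambda>(S, n). (n, S - n)) ?A (UNIV \<times> UNIV)"
    by (rule bij_betwI[where g = "\<lambda>(n, m). (n + m, n)"]) auto
  have "(\<lambda>p. norm (?h p)) summable_on ?A"
  proof (rule Infinite_Sum.abs_summable_on_Sigma_iff[THEN iffD2], intro conjI ballI)
    show "(\<lambda>n. norm (?h (S, n))) summable_on {..S}" for S by simp
    show "(\<lambda>S. norm (\<Sum>\<^sub>\<infinity>n\<in>{..S}. norm (?h (S, n)))) summable_on UNIV"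
      using g by (auto intro!: norm_summable_imp_summable_on simp: abs_of_nonneg sum_nonneg)
  qed
  moreover have hG: "?h = (\<lambda>p. ?G ((\<lambda>(S, n). (n, S - n)) p))" by auto
  ultimately have G: "(\<lambda>p. norm (?G p)) summable_on UNIV \<times> UNIV"
    using summable_on_reindex_bij_betw[OF bij, of "\<lambda>p. norm (?G p)"] by simp
  have h: "?h summable_on ?A" by (rule abs_summable_summable) fact
  have rows: "(\<lambda>m. norm (g n m)) summable_on UNIV" for n
    using Infinite_Sum.abs_summable_on_Sigma_iff[THEN iffD1, OF G] by auto
  then show *: "summable (\<lambda>m. norm (g n m))" for n
    by (rule summable_on_imp_summable)
  have inf_row: "(\<Sum>\<^sub>\<infinity>m. g n m) = (\<Sum>m. g n m)" for n
    using has_sum_imp_sums[OF has_sum_infsum[OF abs_summable_summable[OF rows]], of n] by (simp add: sums_iff)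
  have "?G summable_on UNIV \<times> UNIV" by (rule abs_summable_summable[OF G])
  then have out: "(\<lambda>n. \<Sum>\<^sub>\<infinity>m. g n m) summable_on UNIV" "(\<Sum>\<^sub>\<infinity>n. \<Sum>\<^sub>\<infinity>m. g n m) = infsum ?G (UNIV \<times> UNIV)"
    using summable_on_Sigma_banach[of g UNIV "\<lambda>_. UNIV"] infsum_Sigma_banach[of ?G UNIV "\<lambda>_. UNIV"] by auto
  have diag: "infsum ?h ?A = (\<Sum>\<^sub>\<infinity>S. \<Sum>n\<le>S. g n (S - n))" "(\<lambda>S. \<Sum>n\<le>S. g n (S - n)) summable_on UNIV"
    using infsum_Sigma_banach[OF h] summable_on_Sigma_banach[of "\<lambda>S n. g n (S - n)" UNIV "\<lambda>S. {..S}"] h by auto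
  have "infsum ?h ?A = infsum ?G (UNIV \<times> UNIV)"
    unfolding hG by (rule infsum_reindex_bij_betw[OF bij])
  moreover have "(\<Sum>\<^sub>\<infinity>S. \<Sum>n\<le>S. g n (S - n)) = (\<Sum>S. \<Sum>n\<le>S. g n (S - n))"
    using has_sum_imp_sums[OF has_sum_infsum[OF diag(2)]] by (simp add: sums_iff)
  ultimately show "(\<lambda>n. \<Sum>m. g n m) sums (\<Sum>S. \<Sum>n\<le>S. g n (S - n))"
    using has_sum_imp_sums[OF has_sum_infsum[OF out(1)]] out(2) diag(1) by (simp add: inf_row)
qed

lemma Cauchy_product_nonneg:
  fixes a b :: "nat \<Rightarrow> real"
  assumes "summable a" "summable b" "\<And>n. 0 \<le> a n" "\<And>n. 0 \<le> b n"
  shows "(\<lambda>S. \<Sum>n\<le>S. a n * b (S - n)) sums ((\<Sum>n. a n) * (\<Sum>n. b n))"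
  using assms by (intro Cauchy_product_sums) (auto simp: abs_of_nonneg)

text \<open>The squares of \<open>binom_weight S n\<close>, \<open>n \<le> S\<close>, form the symmetric binomial distribution on \<open>{0..S}\<close>.\<close>

definition binom_weight :: "nat \<Rightarrow> nat \<Rightarrow> real" where
  "binom_weight S n = sqrt (real (S choose n) / 2 ^ S)"

text \<open>Up to a constant, the product of two entire functions, in coefficients normalised for the weight \<open>exp (-|z|\<^sup>2)\<close> in the factors
and \<open>exp (-2 |z|\<^sup>2)\<close> in the product.\<close>

definition fock_mult :: "(nat \<Rightarrow> complex) \<Rightarrow> (nat \<Rightarrow> complex) \<Rightarrow> nat \<Rightarrow> complex" where
  "fock_mult a b S = (\<Sum>n\<le>S. of_real (binom_weight S n) * (a n * b (S - n)))"

text \<open>The adjoint of \<open>fock_mult (-) b\<close>, see \<open>fock_comult_pairing\<close>.\<close>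

definition fock_comult :: "(nat \<Rightarrow> complex) \<Rightarrow> (nat \<Rightarrow> complex) \<Rightarrow> nat \<Rightarrow> complex" where
  "fock_comult b \<alpha> n = (\<Sum>m. of_real (binom_weight (n + m) n) * (cnj (b m) * \<alpha> (n + m)))"

lemma binom_weight_nonneg [simp]: "0 \<le> binom_weight S n"
  by (simp add: binom_weight_def)

lemma binom_weight_square: "(binom_weight S n)\<^sup>2 = real (S choose n) / 2 ^ S"
  by (simp add: binom_weight_def)

lemma sum_binom_weight_square: "(\<Sum>n\<le>S. (binom_weight S n)\<^sup>2) = 1"
proof -
  have "(\<Sum>n\<le>S. real (S choose n)) = 2 ^ S"
    using choose_row_sum[of S] by (metis of_nat_numeral of_nat_power of_nat_sum)
  then show ?thesis unfolding binom_weight_square by (simp flip: sum_divide_distrib)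
qed

lemma binom_weight_le_1: "n \<le> S \<Longrightarrow> binom_weight S n \<le> 1"
  using member_le_sum[of n "{..S}" "\<lambda>n. (binom_weight S n)\<^sup>2"] sum_binom_weight_square[of S]
  by (simp add: abs_square_le_1)

lemma binom_weight_sym: "n \<le> S \<Longrightarrow> binom_weight S (S - n) = binom_weight S n"
  by (simp add: binom_weight_def binomial_symmetric[of n S])

text \<open>The product with an extra factor \<open>c n\<close> on the antidiagonal, as it arises when a weighted sum is
differentiated along the flow.\<close>

abbreviation twisted_mult :: "(nat \<Rightarrow> real) \<Rightarrow> (nat \<Rightarrow> complex) \<Rightarrow> (nat \<Rightarrow> complex) \<Rightarrow> nat \<Rightarrow> complex" where
  "twisted_mult c a b S \<equiv> (\<Sum>n\<le>S. of_real (binom_weight S n * c n) * (a n * b (S - n)))"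

lemma fock_mult_commute: "fock_mult a b = fock_mult b a"
proof
  fix S
  have "fock_mult a b S = (\<Sum>n\<le>S. of_real (binom_weight S (S - n)) * (a (S - n) * b n))"
    unfolding fock_mult_def
    by (rule sum.reindex_bij_witness[of _ "\<lambda>n. S - n" "\<lambda>n. S - n"]) auto
  then show "fock_mult a b S = fock_mult b a S"
    by (simp add: fock_mult_def binom_weight_sym mult.commute)
qed

lemma weighted_Cauchy_Schwarz:
  fixes u v :: "nat \<Rightarrow> real"
  assumes "\<And>n. n \<in> A \<Longrightarrow> norm (x n) \<le> u n * v n"
  shows "(norm (\<Sum>n\<in>A. x n :: 'a::real_normed_vector))\<^sup>2 \<le> (\<Sum>n\<in>A. (u n)\<^sup>2) * (\<Sum>n\<in>A. (v n)\<^sup>2)"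
proof -
  have "norm (\<Sum>n\<in>A. x n) \<le> (\<Sum>n\<in>A. u n * v n)"
    using assms by (intro sum_norm_le)
  then have "(norm (\<Sum>n\<in>A. x n))\<^sup>2 \<le> (\<Sum>n\<in>A. u n * v n)\<^sup>2"
    by (intro power_mono) auto
  also have "\<dots> \<le> (\<Sum>n\<in>A. (u n)\<^sup>2) * (\<Sum>n\<in>A. (v n)\<^sup>2)"
    by (rule Cauchy_Schwarz_ineq_sum)
  finally show ?thesis .
qed

text \<open>Cauchy-Schwarz with the probability weights \<open>(binom_weight S n)\<^sup>2\<close>.\<close>

lemma fock_mult_le: "(cmod (fock_mult a b S))\<^sup>2 \<le> (\<Sum>n\<le>S. (cmod (a n))\<^sup>2 * (cmod (b (S - n)))\<^sup>2)"
  unfolding fock_mult_def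
  using weighted_Cauchy_Schwarz[of "{..S}" "\<lambda>n. of_real (binom_weight S n) * (a n * b (S - n))" "binom_weight S" "\<lambda>n. cmod (a n) * cmod (b (S - n))"]
  by (simp add: norm_mult sum_binom_weight_square power_mult_distrib)

lemma fock_mult_weighted:
  fixes q :: "nat \<Rightarrow> real"
  assumes q: "\<And>n. 0 \<le> q n" "\<And>j l. q (j + l) \<le> C * (q j * q l)"
    and a: "weighted_summable q a" and b: "weighted_summable q b"
  shows "weighted_summable q (fock_mult a b)"
    and "weighted_sum q (fock_mult a b) \<le> C * ((weighted_sum q a) * weighted_sum q b)"
proof -
  let ?A = "\<lambda>n. q n * (cmod (a n))\<^sup>2" and ?B = "\<lambda>n. q n * (cmod (b n))\<^sup>2"
  have le: "q S * (cmod (fock_mult a b S))\<^sup>2 \<le> C * (\<Sum>n\<le>S. ?A n * ?B (S - n))" for S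
  proof -
    have "q S * (cmod (fock_mult a b S))\<^sup>2 \<le> (\<Sum>n\<le>S. q S * ((cmod (a n))\<^sup>2 * (cmod (b (S - n)))\<^sup>2))"
      using mult_left_mono[OF fock_mult_le q(1)] by (simp add: sum_distrib_left)
    also have "\<dots> \<le> (\<Sum>n\<le>S. C * (?A n * ?B (S - n)))"
    proof (rule sum_mono)
      fix n assume "n \<in> {..S}"
      then have "q S \<le> C * (q n * q (S - n))" using q(2)[of n "S - n"] by simp
      from mult_right_mono[OF this, of "(cmod (a n))\<^sup>2 * (cmod (b (S - n)))\<^sup>2"]
      show "q S * ((cmod (a n))\<^sup>2 * (cmod (b (S - n)))\<^sup>2) \<le> C * (?A n * ?B (S - n))"
        by (simp add: mult_ac)
    qed
    finally show ?thesis by (simp add: sum_distrib_left)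
  qed
  have s: "(\<lambda>S. C * (\<Sum>n\<le>S. ?A n * ?B (S - n))) sums (C * (suminf ?A * suminf ?B))"
    by (intro sums_mult Cauchy_product_nonneg a b mult_nonneg_nonneg q) auto
  show 1: "weighted_summable q (fock_mult a b)"
    by (rule summable_comparison_test'[where N = 0, OF sums_summable[OF s]]) (use le q in \<open>auto simp: abs_mult\<close>)
  show "weighted_sum q (fock_mult a b) \<le> C * (suminf ?A * suminf ?B)"
    using suminf_le[OF le 1 sums_summable[OF s]] s by (simp add: sums_iff)
qed

lemma fock_comult_terms_summable:
  assumes b: "square_summable b" and \<alpha>: "square_summable \<alpha>"
  shows "summable (\<lambda>m. cmod (of_real (binom_weight (n + m) n) * (cnj (b m) * \<alpha> (n + m))))"
proof (rule summable_comparison_test'[where N = 0])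
  have "summable (\<lambda>m. (cmod (\<alpha> (n + m)))\<^sup>2)"
    using summable_ignore_initial_segment[OF \<alpha>, of n] by (simp add: add.commute)
  then show "summable (\<lambda>m. (cmod (b m))\<^sup>2 + (cmod (\<alpha> (n + m)))\<^sup>2)"
    by (rule summable_add[OF b])
  fix m
  have "cmod (of_real (binom_weight (n + m) n) * (cnj (b m) * \<alpha> (n + m))) \<le> 1 * (cmod (b m) * cmod (\<alpha> (n + m)))"
    unfolding norm_mult by (intro mult_mono) (auto simp: binom_weight_le_1)
  also have "\<dots> \<le> (cmod (b m))\<^sup>2 + (cmod (\<alpha> (n + m)))\<^sup>2"
    using zero_le_power2[of "cmod (b m) - cmod (\<alpha> (n + m))"] zero_le_mult_iff[of "cmod (b m)" "cmod (\<alpha> (n + m))"]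
      norm_ge_zero[of "b m"] norm_ge_zero[of "\<alpha> (n + m)"]
    unfolding power2_diff by linarith
  finally show "norm (cmod (of_real (binom_weight (n + m) n) * (cnj (b m) * \<alpha> (n + m)))) \<le> (cmod (b m))\<^sup>2 + (cmod (\<alpha> (n + m)))\<^sup>2"
    by simp
qed

text \<open>Row sums of \<open>p n (binom_weight (n+m) n)\<^sup>2 |\<alpha>\<^sub>n\<^sub>+\<^sub>m|\<^sup>2\<close> are controlled after passing to antidiagonals: there the
weight satisfies \<open>p n \<le> p S\<close> and the binomial weights sum to one.\<close>

lemma transposed_weight_summable:
  fixes p :: "nat \<Rightarrow> real"
  assumes p: "\<And>n. 0 \<le> p n" "\<And>m n. m \<le> n \<Longrightarrow> p m \<le> p n"
    and \<alpha>: "weighted_summable p \<alpha>"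
  shows "summable (\<lambda>S. \<Sum>n\<le>S. norm (p n * ((binom_weight (n + (S - n)) n)\<^sup>2 * (cmod (\<alpha> (n + (S - n))))\<^sup>2)))"
    and "(\<Sum>S. \<Sum>n\<le>S. p n * ((binom_weight (n + (S - n)) n)\<^sup>2 * (cmod (\<alpha> (n + (S - n))))\<^sup>2)) \<le> weighted_sum p \<alpha>"
proof -
  let ?t = "\<lambda>S. \<Sum>n\<le>S. p n * ((binom_weight (n + (S - n)) n)\<^sup>2 * (cmod (\<alpha> (n + (S - n))))\<^sup>2)"
  have le: "?t S \<le> p S * (cmod (\<alpha> S))\<^sup>2" for S
  proof -
    have "?t S \<le> (\<Sum>n\<le>S. (binom_weight S n)\<^sup>2 * (p S * (cmod (\<alpha> S))\<^sup>2))"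
    proof (rule sum_mono)
      fix n assume n: "n \<in> {..S}"
      then have "p n * ((binom_weight S n)\<^sup>2 * (cmod (\<alpha> S))\<^sup>2) \<le> p S * ((binom_weight S n)\<^sup>2 * (cmod (\<alpha> S))\<^sup>2)"
        by (intro mult_right_mono p) auto
      then show "p n * ((binom_weight (n + (S - n)) n)\<^sup>2 * (cmod (\<alpha> (n + (S - n))))\<^sup>2) \<le> (binom_weight S n)\<^sup>2 * (p S * (cmod (\<alpha> S))\<^sup>2)"
        using n by (simp add: mult_ac)
    qed
    also have "\<dots> = p S * (cmod (\<alpha> S))\<^sup>2"
      by (simp only: sum_distrib_right[symmetric] sum_binom_weight_square mult_1)
    finally show ?thesis .
  qed
  have nn: "0 \<le> ?t S" for S by (intro sum_nonneg mult_nonneg_nonneg p) auto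
  have 1: "summable ?t"
    by (rule summable_comparison_test'[where N = 0, OF \<alpha>]) (use le nn in auto)
  have eq: "(\<Sum>n\<le>S. norm (p n * ((binom_weight (n + (S - n)) n)\<^sup>2 * (cmod (\<alpha> (n + (S - n))))\<^sup>2))) = ?t S" for S
    using p by (intro sum.cong refl) (auto simp: abs_mult)
  show "summable (\<lambda>S. \<Sum>n\<le>S. norm (p n * ((binom_weight (n + (S - n)) n)\<^sup>2 * (cmod (\<alpha> (n + (S - n))))\<^sup>2)))"
    unfolding eq by (rule 1)
  show "suminf ?t \<le> weighted_sum p \<alpha>"
    by (rule suminf_le[OF le 1 \<alpha>])
qed

text \<open>The weight falls entirely on \<open>\<alpha>\<close>, since \<open>q n \<le> q (n+m)\<close>; for \<open>b\<close> the unweighted norm is enough.\<close>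

lemma fock_comult_weighted:
  fixes q :: "nat \<Rightarrow> real"
  assumes q: "\<And>n. 1 \<le> q n" "\<And>m n. m \<le> n \<Longrightarrow> q m \<le> q n"
    and b: "square_summable b" and \<alpha>: "weighted_summable q \<alpha>"
  shows "weighted_summable q (fock_comult b \<alpha>)"
    and "weighted_sum q (fock_comult b \<alpha>) \<le> square_sum b * weighted_sum q \<alpha>"
proof -
  have q0: "0 \<le> q n" for n using q(1)[of n] by simp
  have \<alpha>1: "square_summable \<alpha>"
  proof (rule summable_comparison_test'[where N = 0, OF \<alpha>])
    show "norm ((cmod (\<alpha> n))\<^sup>2) \<le> q n * (cmod (\<alpha> n))\<^sup>2" for n
      using mult_right_mono[OF q(1)[of n], of "(cmod (\<alpha> n))\<^sup>2"] by simp
  qed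
  let ?g = "\<lambda>n m. q n * ((binom_weight (n + m) n)\<^sup>2 * (cmod (\<alpha> (n + m)))\<^sup>2)"
  note tw = transposed_weight_summable[of q, OF q0 q(2) \<alpha>]
  have rows: "summable (\<lambda>m. ?g n m)" for n
    using antidiagonal_sums(1)[of ?g n] tw(1) q0 by (simp add: abs_mult)
  have tot: "(\<lambda>n. \<Sum>m. ?g n m) sums (\<Sum>S. \<Sum>n\<le>S. ?g n (S - n))"
    by (rule antidiagonal_sums(2)) (rule tw(1))
  define B where "B = square_sum b"
  have B0: "0 \<le> B" unfolding B_def by (intro suminf_nonneg b) auto
  have le: "q n * (cmod (fock_comult b \<alpha> n))\<^sup>2 \<le> B * (\<Sum>m. ?g n m)" for n
  proof -
    let ?x = "\<lambda>m. of_real (binom_weight (n + m) n) * (cnj (b m) * \<alpha> (n + m))"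
    have sx: "summable ?x"
      by (rule summable_norm_cancel) (rule fock_comult_terms_summable[OF b \<alpha>1])
    have "(\<lambda>M. q n * (cmod (\<Sum>m<M. ?x m))\<^sup>2) \<longlonglongrightarrow> q n * (cmod (fock_comult b \<alpha> n))\<^sup>2"
      unfolding fock_comult_def by (intro tendsto_intros summable_LIMSEQ sx)
    moreover have "q n * (cmod (\<Sum>m<M. ?x m))\<^sup>2 \<le> B * (\<Sum>m. ?g n m)" for M
    proof -
      have "(cmod (\<Sum>m<M. ?x m))\<^sup>2 \<le> (\<Sum>m<M. (cmod (b m))\<^sup>2) * (\<Sum>m<M. (binom_weight (n + m) n * cmod (\<alpha> (n + m)))\<^sup>2)"
        by (rule weighted_Cauchy_Schwarz) (simp add: norm_mult)
      then have "q n * (cmod (\<Sum>m<M. ?x m))\<^sup>2 \<le> q n * ((\<Sum>m<M. (cmod (b m))\<^sup>2) * (\<Sum>m<M. (binom_weight (n + m) n * cmod (\<alpha> (n + m)))\<^sup>2))"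
        by (rule mult_left_mono[OF _ q0])
      also have "\<dots> = (\<Sum>m<M. (cmod (b m))\<^sup>2) * (\<Sum>m<M. ?g n m)"
        by (simp add: power_mult_distrib sum_distrib_left mult_ac)
      also have "\<dots> \<le> B * (\<Sum>m. ?g n m)"
        unfolding B_def by (intro mult_mono sum_le_suminf b rows sum_nonneg suminf_nonneg mult_nonneg_nonneg q0) auto
      finally show ?thesis .
    qed
    ultimately show ?thesis by (intro LIMSEQ_le_const2) auto
  qed
  have s: "summable (\<lambda>n. B * (\<Sum>m. ?g n m))" by (intro summable_mult sums_summable[OF tot])
  show 1: "weighted_summable q (fock_comult b \<alpha>)"
    by (rule summable_comparison_test'[where N = 0, OF s]) (use le q0 in \<open>auto simp: abs_mult\<close>)
  have "weighted_sum q (fock_comult b \<alpha>) \<le> B * (\<Sum>S. \<Sum>n\<le>S. ?g n (S - n))"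
    using suminf_le[OF le 1 s] sums_mult[OF tot, of B] by (simp add: sums_iff)
  also have "\<dots> \<le> B * weighted_sum q \<alpha>"
    by (intro mult_left_mono tw(2) B0)
  finally show "weighted_sum q (fock_comult b \<alpha>) \<le> B * weighted_sum q \<alpha>" .
qed

text \<open>Adjointness in the presence of a weight \<open>p\<close>. The double series converges absolutely because its terms are
at most \<open>p n |a\<^sub>n|\<^sup>2 |b\<^sub>m|\<^sup>2 + p n (binom_weight (n+m) n)\<^sup>2 |\<alpha>\<^sub>n\<^sub>+\<^sub>m|\<^sup>2\<close>.\<close>

lemma fock_comult_pairing:
  fixes p :: "nat \<Rightarrow> real"
  assumes p: "\<And>n. 0 \<le> p n" "\<And>m n. m \<le> n \<Longrightarrow> p m \<le> p n"
    and a: "weighted_summable p a" and b: "square_summable b"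
    and \<alpha>: "weighted_summable p \<alpha>" "square_summable \<alpha>"
  shows "(\<lambda>n. of_real (p n) * (cnj (a n) * fock_comult b \<alpha> n)) sums
    (\<Sum>S. \<alpha> S * cnj (twisted_mult p a b S))"
    and "summable (\<lambda>S. \<alpha> S * cnj (twisted_mult p a b S))"
proof -
  let ?g = "\<lambda>n m. of_real (p n) * (cnj (a n) * (of_real (binom_weight (n + m) n) * (cnj (b m) * \<alpha> (n + m))))"
  let ?t = "\<lambda>S. \<Sum>n\<le>S. norm (p n * ((binom_weight (n + (S - n)) n)\<^sup>2 * (cmod (\<alpha> (n + (S - n))))\<^sup>2))"
  let ?u = "\<lambda>S. \<Sum>n\<le>S. (p n * (cmod (a n))\<^sup>2) * (cmod (b (S - n)))\<^sup>2"
  have g: "summable (\<lambda>S. \<Sum>n\<le>S. norm (?g n (S - n)))"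
  proof (rule summable_comparison_test'[where N = 0])
    have "summable ?u"
      using Cauchy_product_nonneg[OF a b] p by (auto simp: sums_iff)
    then show "summable (\<lambda>S. ?u S + ?t S)"
      by (rule summable_add) (rule transposed_weight_summable(1)[OF p \<alpha>(1)])
    fix S
    have le: "norm (?g n (S - n)) \<le> (p n * (cmod (a n))\<^sup>2) * (cmod (b (S - n)))\<^sup>2 + norm (p n * ((binom_weight (n + (S - n)) n)\<^sup>2 * (cmod (\<alpha> (n + (S - n))))\<^sup>2))" for n
    proof -
      define x where "x = cmod (a n) * cmod (b (S - n))"
      define y where "y = binom_weight (n + (S - n)) n * cmod (\<alpha> (n + (S - n)))"
      have xy: "0 \<le> x" "0 \<le> y" by (auto simp: x_def y_def)
      have "x * y \<le> x\<^sup>2 + y\<^sup>2"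
        using zero_le_power2[of "x - y"] mult_nonneg_nonneg[OF xy] unfolding power2_diff by linarith
      then have "p n * (x * y) \<le> p n * (x\<^sup>2 + y\<^sup>2)" by (rule mult_left_mono[OF _ p(1)])
      then show ?thesis
        using p by (simp add: x_def y_def norm_mult abs_mult power_mult_distrib algebra_simps)
    qed
    have "norm (\<Sum>n\<le>S. norm (?g n (S - n))) = (\<Sum>n\<le>S. norm (?g n (S - n)))"
      by (simp only: real_norm_def abs_of_nonneg sum_nonneg norm_ge_zero)
    also have "\<dots> \<le> ?u S + ?t S"
      unfolding sum.distrib[symmetric] by (rule sum_mono) (rule le)
    finally show "norm (\<Sum>n\<le>S. norm (?g n (S - n))) \<le> ?u S + ?t S" .
  qed
  have col: "(\<Sum>n\<le>S. ?g n (S - n)) = \<alpha> S * cnj (twisted_mult p a b S)" for S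
    by (simp add: sum_distrib_left mult_ac)
  have "(\<Sum>m. ?g n m) = of_real (p n) * (cnj (a n) * fock_comult b \<alpha> n)" for n
    unfolding fock_comult_def
    using summable_norm_cancel[OF fock_comult_terms_summable[OF b \<alpha>(2)]]
    by (simp add: suminf_mult summable_mult)
  then show "(\<lambda>n. of_real (p n) * (cnj (a n) * fock_comult b \<alpha> n)) sums
    (\<Sum>S. \<alpha> S * cnj (twisted_mult p a b S))"
    using antidiagonal_sums(2)[OF g] unfolding col by simp
  have "summable (\<lambda>S. norm (\<Sum>n\<le>S. ?g n (S - n)))"
    by (rule summable_comparison_test'[where N = 0, OF g]) (simp add: norm_sum)
  then show "summable (\<lambda>S. \<alpha> S * cnj (twisted_mult p a b S))"
    unfolding col by (rule summable_norm_cancel)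
qed

section \<open>Binomial concentration and the energy flux\<close>

text \<open>A random walk with \<open>N + 1\<close> fair \<open>\<plusminus>1\<close> steps is one with \<open>N\<close> steps followed by one more step; \<open>2 n - N\<close> is its
position.\<close>

lemma binomial_step:
  fixes f :: "real \<Rightarrow> real"
  shows "(\<Sum>n\<le>Suc N. real (Suc N choose n) * f (2 * real n - real (Suc N)))
    = (\<Sum>n\<le>N. real (N choose n) * (f (2 * real n - real N + 1) + f (2 * real n - real N - 1)))"
proof -
  define g where "g n = f (2 * real n - real (Suc N))" for n
  have "(\<Sum>n\<le>Suc N. real (Suc N choose n) * g n) = g 0 + (\<Sum>n\<le>N. real (Suc N choose Suc n) * g (Suc n))"
    by (simp add: sum.atMost_Suc_shift del: sum.atMost_Suc binomial_Suc_Suc)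
  also have "\<dots> = (\<Sum>n\<le>N. real (N choose n) * g (Suc n)) + (g 0 + (\<Sum>n\<le>N. real (N choose Suc n) * g (Suc n)))"
    by (simp add: algebra_simps sum.distrib)
  also have "g 0 + (\<Sum>n\<le>N. real (N choose Suc n) * g (Suc n)) = (\<Sum>n\<le>Suc N. real (N choose n) * g n)"
    by (simp add: sum.atMost_Suc_shift del: sum.atMost_Suc)
  also have "\<dots> = (\<Sum>n\<le>N. real (N choose n) * g n)" by (simp add: binomial_eq_0)
  finally show ?thesis
    by (simp add: g_def sum.distrib[symmetric] algebra_simps)
qed

lemma binomial_second_moment:
  "(\<Sum>n\<le>N. real (N choose n) * (2 * real n - real N)\<^sup>2) = 2 ^ N * real N"
proof (induction N)
  case (Suc N)
  have row: "(\<Sum>n\<le>N. real (N choose n)) = 2 ^ N"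
    using choose_row_sum[of N] by (metis of_nat_numeral of_nat_power of_nat_sum)
  have "(\<Sum>n\<le>Suc N. real (Suc N choose n) * (2 * real n - real (Suc N))\<^sup>2)
    = (\<Sum>n\<le>N. 2 * (real (N choose n) * (2 * real n - real N)\<^sup>2) + 2 * real (N choose n))"
    unfolding binomial_step[of N "\<lambda>x. x\<^sup>2"]
    by (intro sum.cong refl) (simp add: power2_eq_square algebra_simps)
  also have "\<dots> = 2 * (2 ^ N * real N) + 2 * 2 ^ N"
    unfolding sum.distrib sum_distrib_left[symmetric] Suc row ..
  finally show ?case by (simp add: algebra_simps)
qed simp

lemma binomial_fourth_moment:
  "(\<Sum>n\<le>N. real (N choose n) * (2 * real n - real N) ^ 4) = 2 ^ N * (3 * (real N)\<^sup>2 - 2 * real N)"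
proof (induction N)
  case (Suc N)
  have row: "(\<Sum>n\<le>N. real (N choose n)) = 2 ^ N"
    using choose_row_sum[of N] by (metis of_nat_numeral of_nat_power of_nat_sum)
  have "(\<Sum>n\<le>Suc N. real (Suc N choose n) * (2 * real n - real (Suc N)) ^ 4)
    = (\<Sum>n\<le>N. 2 * (real (N choose n) * (2 * real n - real N) ^ 4) + 12 * (real (N choose n) * (2 * real n - real N)\<^sup>2) + 2 * real (N choose n))"
    unfolding binomial_step[of N "\<lambda>x. x ^ 4"]
  proof (intro sum.cong refl)
    fix n
    have "(x + 1) ^ 4 + (x - 1) ^ 4 = 2 * x ^ 4 + 12 * x\<^sup>2 + 2" for x :: real by algebra
    then show "real (N choose n) * ((2 * real n - real N + 1) ^ 4 + (2 * real n - real N - 1) ^ 4)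
      = 2 * (real (N choose n) * (2 * real n - real N) ^ 4) + 12 * (real (N choose n) * (2 * real n - real N)\<^sup>2) + 2 * real (N choose n)"
      by (simp only:) (simp add: algebra_simps)
  qed
  also have "\<dots> = 2 * (2 ^ N * (3 * (real N)\<^sup>2 - 2 * real N)) + 12 * (2 ^ N * real N) + 2 * 2 ^ N"
    unfolding sum.distrib sum_distrib_left[symmetric] Suc row binomial_second_moment ..
  finally show ?case by (simp add: power2_eq_square algebra_simps)
qed simp

text \<open>Dividing by \<open>(n+1)(S-n+1)\<close> turns the distribution on \<open>{0..S}\<close> into the interior part of the one on
\<open>{0..S+2}\<close>. Negative moments thereby become probabilities.\<close>

lemma binom_weight_shift:
  assumes "n \<le> S"
  shows "(binom_weight S n)\<^sup>2 / ((real n + 1) * (real (S - n) + 1))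
    = 4 / ((real S + 1) * (real S + 2)) * (real (Suc (Suc S) choose Suc n) / 2 ^ Suc (Suc S))"
proof -
  have f: "fact (Suc S - n) = (real (S - n) + 1) * fact (S - n)"
    using assms by (simp add: Suc_diff_le algebra_simps)
  have 1: "real (Suc (Suc S) choose Suc n) = fact (Suc (Suc S)) / (fact (Suc n) * fact (Suc S - n))"
    using assms binomial_fact[of "Suc n" "Suc (Suc S)", where 'a = real] by simp
  have 2: "real (S choose n) = fact S / (fact n * fact (S - n))"
    using assms binomial_fact[of n S, where 'a = real] by simp
  have alg: "P / (u * v) / T / (x * y) = 4 / (s1 * s2) * ((s2 * (s1 * P)) / ((x * u) * (y * v)) / (2 * (2 * T)))"
    if "u > 0" "v > 0" "T > 0" "x > 0" "y > 0" "s1 > 0" "s2 > 0" for P u v T x y s1 s2 :: real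
    using that by (simp add: divide_simps)
  have S2: "fact (Suc (Suc S)) = (real S + 2) * ((real S + 1) * fact S)"
    by (simp add: algebra_simps)
  have n1: "fact (Suc n) = (real n + 1) * fact n" by (simp add: algebra_simps)
  show ?thesis
    unfolding binom_weight_square 1 2 f S2 n1 power_Suc by (rule alg) auto
qed

text \<open>Under the binomial distribution \<open>1/((n+1)(m+1))\<close>, with \<open>n + m = S\<close>, has mean of order \<open>1/S\<^sup>2\<close>: both indices are
typically close to \<open>S/2\<close>.\<close>

lemma binom_weight_decay:
  "(\<Sum>n\<le>S. (binom_weight S n)\<^sup>2 / ((real n + 1) * (real (S - n) + 1))) \<le> (2 / (real S + 1))\<^sup>2"
proof -
  have "(\<Sum>n\<le>S. (binom_weight S n)\<^sup>2 / ((real n + 1) * (real (S - n) + 1)))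
    = 4 / ((real S + 1) * (real S + 2)) * ((\<Sum>n\<le>S. real (Suc (Suc S) choose Suc n)) / 2 ^ Suc (Suc S))"
    unfolding sum_distrib_left sum_divide_distrib
    by (intro sum.cong refl binom_weight_shift) simp
  also have "\<dots> \<le> 4 / ((real S + 1) * (real S + 2)) * 1"
  proof (intro mult_left_mono)
    have "(\<Sum>n\<le>Suc (Suc S). real (Suc (Suc S) choose n)) = 2 ^ Suc (Suc S)"
      using choose_row_sum[of "Suc (Suc S)"] by (metis of_nat_numeral of_nat_power of_nat_sum)
    moreover have "(\<Sum>n\<le>S. real (Suc (Suc S) choose Suc n)) \<le> (\<Sum>n\<le>Suc (Suc S). real (Suc (Suc S) choose n))"
      unfolding sum.atMost_Suc_shift[of _ "Suc S"] by (simp del: binomial_Suc_Suc)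
    ultimately show "(\<Sum>n\<le>S. real (Suc (Suc S) choose Suc n)) / 2 ^ Suc (Suc S) \<le> 1"
      by (simp del: binomial_Suc_Suc power_Suc)
  qed auto
  also have "\<dots> \<le> 4 / ((real S + 1) * (real S + 1))"
    by (auto intro!: divide_left_mono mult_left_mono mult_pos_pos)
  finally show ?thesis by (simp add: power2_eq_square)
qed

text \<open>The fourth moment of \<open>n - m\<close> is of order \<open>S\<^sup>2\<close>, which compensates exactly the decay of \<open>1/((n+1)(m+1))\<close>.\<close>

lemma binom_weight_concentration:
  "(\<Sum>n\<le>S. (binom_weight S n)\<^sup>2 * (2 * real n - real S) ^ 4 / ((real n + 1) * (real (S - n) + 1))) \<le> 5\<^sup>2"
proof -
  let ?N = "Suc (Suc S)"
  have "(\<Sum>n\<le>S. (binom_weight S n)\<^sup>2 * (2 * real n - real S) ^ 4 / ((real n + 1) * (real (S - n) + 1)))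
    = (\<Sum>n\<le>S. 4 / ((real S + 1) * (real S + 2)) / 2 ^ ?N * (real (?N choose Suc n) * (2 * real (Suc n) - real ?N) ^ 4))"
  proof (intro sum.cong refl)
    fix n assume "n \<in> {..S}"
    then have n: "n \<le> S" by simp
    have d: "2 * real (Suc n) - real ?N = 2 * real n - real S" by simp
    have "(binom_weight S n)\<^sup>2 * y / ((real n + 1) * (real (S - n) + 1))
      = (binom_weight S n)\<^sup>2 / ((real n + 1) * (real (S - n) + 1)) * y" for y by simp
    then have "(binom_weight S n)\<^sup>2 * y / ((real n + 1) * (real (S - n) + 1))
      = 4 / ((real S + 1) * (real S + 2)) * (real (?N choose Suc n) / 2 ^ ?N) * y" for y
      unfolding binom_weight_shift[OF n] .
    from this[of "(2 * real n - real S) ^ 4"]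
    show "(binom_weight S n)\<^sup>2 * (2 * real n - real S) ^ 4 / ((real n + 1) * (real (S - n) + 1))
      = 4 / ((real S + 1) * (real S + 2)) / 2 ^ ?N * (real (?N choose Suc n) * (2 * real (Suc n) - real ?N) ^ 4)"
      unfolding d by (simp only: times_divide_eq_left times_divide_eq_right divide_divide_eq_left mult_ac)
  qed
  also have "\<dots> = 4 / ((real S + 1) * (real S + 2)) / 2 ^ ?N * (\<Sum>n\<le>S. real (?N choose Suc n) * (2 * real (Suc n) - real ?N) ^ 4)"
    by (simp only: sum_distrib_left)
  also have "\<dots> \<le> 4 / ((real S + 1) * (real S + 2)) / 2 ^ ?N * (2 ^ ?N * (3 * (real ?N)\<^sup>2))"
  proof (rule mult_left_mono)
    have "(\<Sum>n\<le>S. real (?N choose Suc n) * (2 * real (Suc n) - real ?N) ^ 4)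
       \<le> (\<Sum>n\<le>?N. real (?N choose n) * (2 * real n - real ?N) ^ 4)"
      unfolding sum.atMost_Suc_shift[of _ "Suc S"] sum.atMost_Suc[of _ S]
      by (simp del: binomial_Suc_Suc of_nat_Suc)
    also have "\<dots> = 2 ^ ?N * (3 * (real ?N)\<^sup>2 - 2 * real ?N)" by (rule binomial_fourth_moment)
    also have "\<dots> \<le> 2 ^ ?N * (3 * (real ?N)\<^sup>2)" by (intro mult_left_mono) auto
    finally show "(\<Sum>n\<le>S. real (?N choose Suc n) * (2 * real (Suc n) - real ?N) ^ 4) \<le> 2 ^ ?N * (3 * (real ?N)\<^sup>2)" .
  qed auto
  also have "\<dots> = 12 * (real S + 2) / (real S + 1)"
  proof -
    have alg: "4 / (x * y) / T * (T * (3 * y\<^sup>2)) = 12 * y / x" if "x > 0" "y > 0" "T > 0" for x y T :: real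
      using that by (simp add: divide_simps power2_eq_square)
    have N: "real ?N = real S + 2" by simp
    show ?thesis unfolding N by (rule alg) auto
  qed
  also have "\<dots> \<le> 5\<^sup>2" by (simp add: field_simps)
  finally show ?thesis .
qed

text \<open>The odd powers of \<open>d\<close> cancel, so the remainder is quadratic in \<open>d\<close>. The induction carries along the difference
of the two powers, which is linear in \<open>d\<close>, because each of the two recursions involves the other quantity.\<close>

lemma even_power_remainder:
  "\<exists>A\<ge>0. \<forall>s d :: real. \<bar>d\<bar> \<le> s \<longrightarrow> \<bar>(s + d) ^ (k + 2) + (s - d) ^ (k + 2) - 2 * s ^ (k + 2)\<bar> \<le> A * s ^ k * d\<^sup>2"
proof -
  have "\<exists>A\<ge>0. \<exists>B\<ge>0. \<forall>s d :: real. \<bar>d\<bar> \<le> s \<longrightarrow>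
      \<bar>(s + d) ^ (k + 2) + (s - d) ^ (k + 2) - 2 * s ^ (k + 2)\<bar> \<le> A * s ^ k * d\<^sup>2 \<and>
      \<bar>(s + d) ^ (k + 2) - (s - d) ^ (k + 2)\<bar> \<le> B * s ^ (k + 1) * \<bar>d\<bar>" for k
  proof (induction k)
    case 0
    have "\<bar>(s + d)\<^sup>2 + (s - d)\<^sup>2 - 2 * s\<^sup>2\<bar> \<le> 2 * s ^ 0 * d\<^sup>2" for s d :: real
      by (simp add: power2_eq_square algebra_simps abs_if)
    moreover have "\<bar>(s + d)\<^sup>2 - (s - d)\<^sup>2\<bar> \<le> 4 * s ^ 1 * \<bar>d\<bar>" if "\<bar>d\<bar> \<le> s" for s d :: real
    proof -
      have "(s + d)\<^sup>2 - (s - d)\<^sup>2 = 4 * s * d" by (simp add: power2_eq_square algebra_simps)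
      then show ?thesis using that by (simp add: abs_mult)
    qed
    ultimately show ?case by (intro exI[of _ 2] conjI exI[of _ 4]) (auto simp: numeral_2_eq_2)
  next
    case (Suc k)
    then obtain A B where AB: "A \<ge> 0" "B \<ge> 0" and
      r: "\<And>s d :: real. \<bar>d\<bar> \<le> s \<Longrightarrow> \<bar>(s + d) ^ (k + 2) + (s - d) ^ (k + 2) - 2 * s ^ (k + 2)\<bar> \<le> A * s ^ k * d\<^sup>2" and
      t: "\<And>s d :: real. \<bar>d\<bar> \<le> s \<Longrightarrow> \<bar>(s + d) ^ (k + 2) - (s - d) ^ (k + 2)\<bar> \<le> B * s ^ (k + 1) * \<bar>d\<bar>"
      by blast
    have "\<bar>(s + d) ^ (Suc k + 2) + (s - d) ^ (Suc k + 2) - 2 * s ^ (Suc k + 2)\<bar> \<le> (A + B) * s ^ Suc k * d\<^sup>2 \<and>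
      \<bar>(s + d) ^ (Suc k + 2) - (s - d) ^ (Suc k + 2)\<bar> \<le> (A + B + 2) * s ^ (Suc k + 1) * \<bar>d\<bar>" if d: "\<bar>d\<bar> \<le> s" for s d :: real
    proof -
      define R where "R = (s + d) ^ (k + 2) + (s - d) ^ (k + 2) - 2 * s ^ (k + 2)"
      define T where "T = (s + d) ^ (k + 2) - (s - d) ^ (k + 2)"
      have s: "0 \<le> s" using d by simp
      have R: "\<bar>R\<bar> \<le> A * s ^ k * d\<^sup>2" and T: "\<bar>T\<bar> \<le> B * s ^ (k + 1) * \<bar>d\<bar>"
        unfolding R_def T_def by (rule r[OF d], rule t[OF d])
      have "(s + d) ^ (Suc k + 2) + (s - d) ^ (Suc k + 2) - 2 * s ^ (Suc k + 2) = s * R + d * T"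
        by (simp add: R_def T_def algebra_simps)
      moreover have "\<bar>s * R\<bar> \<le> A * s ^ Suc k * d\<^sup>2"
        using mult_left_mono[OF R s] s by (simp add: abs_mult mult_ac)
      moreover have "\<bar>d * T\<bar> \<le> B * s ^ Suc k * d\<^sup>2"
      proof -
        have "d\<^sup>2 = \<bar>d\<bar> * \<bar>d\<bar>" by (simp add: power2_eq_square)
        then show ?thesis
          using mult_left_mono[OF T abs_ge_zero[of d]] by (simp add: abs_mult mult_ac del: abs_mult_self_eq)
      qed
      ultimately have 1: "\<bar>(s + d) ^ (Suc k + 2) + (s - d) ^ (Suc k + 2) - 2 * s ^ (Suc k + 2)\<bar> \<le> (A + B) * s ^ Suc k * d\<^sup>2"
        unfolding distrib_right by linarith
      have "(s + d) ^ (Suc k + 2) - (s - d) ^ (Suc k + 2) = s * T + d * R + 2 * s ^ (k + 2) * d"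
        by (simp add: R_def T_def algebra_simps)
      moreover have "\<bar>s * T\<bar> \<le> B * s ^ (Suc k + 1) * \<bar>d\<bar>"
        using mult_left_mono[OF T s] s by (simp add: abs_mult mult_ac)
      moreover have "\<bar>d * R\<bar> \<le> A * s ^ (Suc k + 1) * \<bar>d\<bar>"
      proof -
        have "\<bar>d * R\<bar> \<le> \<bar>d\<bar> * (A * s ^ k * d\<^sup>2)" using mult_left_mono[OF R abs_ge_zero[of d]] by (simp add: abs_mult)
        also have "\<dots> \<le> \<bar>d\<bar> * (A * s ^ k * s\<^sup>2)"
          using d AB s by (intro mult_left_mono mult_nonneg_nonneg) (auto simp: abs_le_square_iff[symmetric])
        finally show ?thesis by (simp add: power2_eq_square mult_ac)
      qed
      moreover have "\<bar>2 * s ^ (k + 2) * d\<bar> = 2 * s ^ (Suc k + 1) * \<bar>d\<bar>" using s by (simp add: abs_mult)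
      ultimately have "\<bar>(s + d) ^ (Suc k + 2) - (s - d) ^ (Suc k + 2)\<bar> \<le> (A + B + 2) * s ^ (Suc k + 1) * \<bar>d\<bar>"
        unfolding distrib_right by linarith
      with 1 show ?thesis by blast
    qed
    then show ?case using AB by (intro exI[of _ "A + B"] conjI exI[of _ "A + B + 2"]) auto
  qed
  then show ?thesis by blast
qed

text \<open>The base \<open>2 n + 1\<close> is chosen because \<open>2 n + 1 = (S+1) + (n-m)\<close> and \<open>2 m + 1 = (S+1) - (n-m)\<close> when \<open>n + m = S\<close>.\<close>

definition energy_weight :: "nat \<Rightarrow> nat \<Rightarrow> real" where
  "energy_weight j n = (2 * real n + 1) ^ j"

definition seq_energy :: "nat \<Rightarrow> (nat \<Rightarrow> complex) \<Rightarrow> real" where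
  "seq_energy j a = weighted_sum (energy_weight j) a"

lemma energy_weight_pos: "0 < energy_weight j n"
  and energy_weight_mono: "m \<le> n \<Longrightarrow> energy_weight j m \<le> energy_weight j n"
  and energy_weight_exponent_mono: "i \<le> j \<Longrightarrow> energy_weight i n \<le> energy_weight j n"
  by (auto simp: energy_weight_def intro!: power_mono power_increasing)

text \<open>Along the flow, \<open>\<pi>\<close> times the time derivative of the energy with weight \<open>energy_weight j\<close>, see
\<open>energy_has_derivative\<close>.\<close>

definition flux :: "nat \<Rightarrow> (nat \<Rightarrow> complex) \<Rightarrow> (nat \<Rightarrow> complex) \<Rightarrow> real" where
  "flux j a b = (\<Sum>S. Im (fock_mult a b S *
     cnj (twisted_mult (\<lambda>n. energy_weight j n + energy_weight j (S - n)) a b S)))"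

text \<open>A real multiple of \<open>fock_mult a b S\<close> may be removed from the second factor without changing the imaginary
part.\<close>

lemma flux_column:
  "Im (fock_mult a b S * cnj (twisted_mult (\<lambda>n. energy_weight j n + energy_weight j (S - n)) a b S))
   = Im (fock_mult a b S * cnj (twisted_mult (\<lambda>n. energy_weight j n + energy_weight j (S - n) - 2 * (real S + 1) ^ j) a b S))"
proof -
  have "twisted_mult (\<lambda>n. energy_weight j n + energy_weight j (S - n)) a b S
    = twisted_mult (\<lambda>n. energy_weight j n + energy_weight j (S - n) - 2 * (real S + 1) ^ j) a b S
      + of_real (2 * (real S + 1) ^ j) * fock_mult a b S"
    unfolding fock_mult_def sum_distrib_left sum.distrib[symmetric]
    by (intro sum.cong refl) (simp add: algebra_simps)
  moreover have "Im (z * cnj (w + of_real r * z)) = Im (z * cnj w)" for z w r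
    by (simp add: algebra_simps)
  ultimately show ?thesis by (simp only:)
qed

text \<open>For \<open>j = 0\<close> and \<open>j = 1\<close> the sum \<open>(2n+1)\<^sup>j + (2m+1)\<^sup>j\<close> depends on \<open>n + m\<close> alone. This is the conservation of mass
and of angular momentum.\<close>

lemma flux_low: "j \<le> 1 \<Longrightarrow> flux j a b = 0"
proof -
  assume "j \<le> 1"
  then have "energy_weight j n + energy_weight j (S - n) - 2 * (real S + 1) ^ j = 0" if "n \<le> S" for n S
    using that by (cases "j = 0") (auto simp: energy_weight_def le_Suc_eq of_nat_diff)
  then show ?thesis unfolding flux_def flux_column by simp
qed

text \<open>Both factors are estimated by Cauchy-Schwarz with the weight \<open>(n+1)(m+1)\<close> put on \<open>|a\<^sub>n|\<^sup>2 |b\<^sub>m|\<^sup>2\<close>. The first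
factor is then at most \<open>2/(S+1)\<close> and the second \<open>5 A (S+1)\<^sup>j\<close> times the same square root, so that two powers of \<open>S\<close> are
moved to the weights and a third one is gained. For \<open>j = 0\<close> the truncated exponent \<open>j - 1 = 0\<close> gives a weaker but
sufficient bound.\<close>

lemma flux_column_bound:
  obtains K where "K \<ge> 0" and "\<And>a b S. \<bar>Im (fock_mult a b S *
     cnj (twisted_mult (\<lambda>n. energy_weight (j + 2) n + energy_weight (j + 2) (S - n)) a b S))\<bar>
     \<le> K * ((real S + 1) ^ (j - 1) * (\<Sum>n\<le>S. (energy_weight 1 n * (cmod (a n))\<^sup>2) * (energy_weight 1 (S - n) * (cmod (b (S - n)))\<^sup>2)))"
proof -
  obtain A where A: "A \<ge> 0" "\<And>s d :: real. \<bar>d\<bar> \<le> s \<Longrightarrow> \<bar>(s + d) ^ (j + 2) + (s - d) ^ (j + 2) - 2 * s ^ (j + 2)\<bar> \<le> A * s ^ j * d\<^sup>2"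
    using even_power_remainder[of j] by blast
  show ?thesis
  proof (rule that[of "10 * A"])
    fix a b :: "nat \<Rightarrow> complex" and S
    define s where "s = real S + 1"
    have s: "s \<ge> 1" by (simp add: s_def)
    define X where "X = (\<Sum>n\<le>S. (sqrt ((real n + 1) * (real (S - n) + 1)) * (cmod (a n) * cmod (b (S - n))))\<^sup>2)"
    define Y where "Y = (\<Sum>n\<le>S. (energy_weight 1 n * (cmod (a n))\<^sup>2) * (energy_weight 1 (S - n) * (cmod (b (S - n)))\<^sup>2))"
    have X0: "0 \<le> X" unfolding X_def by (intro sum_nonneg) auto
    have XY: "X \<le> Y" unfolding X_def Y_def
    proof (intro sum_mono)
      fix n
      have "(real n + 1) * (real (S - n) + 1) \<le> energy_weight 1 n * energy_weight 1 (S - n)"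
        unfolding energy_weight_def by (intro mult_mono) auto
      from mult_right_mono[OF this, of "(cmod (a n))\<^sup>2 * (cmod (b (S - n)))\<^sup>2"]
      show "(sqrt ((real n + 1) * (real (S - n) + 1)) * (cmod (a n) * cmod (b (S - n))))\<^sup>2
        \<le> (energy_weight 1 n * (cmod (a n))\<^sup>2) * (energy_weight 1 (S - n) * (cmod (b (S - n)))\<^sup>2)"
        by (simp add: power_mult_distrib mult_ac)
    qed
    let ?c = "\<lambda>n. (real n + 1) * (real (S - n) + 1)"
    have c0: "0 < ?c n" for n by (intro mult_pos_pos) auto
    have "(cmod (fock_mult a b S))\<^sup>2 \<le> (\<Sum>n\<le>S. (binom_weight S n / sqrt (?c n))\<^sup>2) * X"
      unfolding fock_mult_def X_def
    proof (rule weighted_Cauchy_Schwarz)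
      fix n
      show "cmod (of_real (binom_weight S n) * (a n * b (S - n))) \<le> binom_weight S n / sqrt (?c n) * (sqrt (?c n) * (cmod (a n) * cmod (b (S - n))))"
        using c0[of n] by (simp add: norm_mult)
    qed
    also have "(\<Sum>n\<le>S. (binom_weight S n / sqrt (?c n))\<^sup>2) = (\<Sum>n\<le>S. (binom_weight S n)\<^sup>2 / ?c n)"
      using c0 by (intro sum.cong refl) (simp add: power_divide)
    also have "\<dots> * X \<le> (2 / s)\<^sup>2 * X"
      unfolding s_def by (intro mult_right_mono binom_weight_decay X0)
    finally have "(cmod (fock_mult a b S))\<^sup>2 \<le> (2 / s * sqrt X)\<^sup>2"
      using X0 by (simp only: power_mult_distrib real_sqrt_pow2)
    then have 1: "cmod (fock_mult a b S) \<le> 2 / s * sqrt X"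
      by (rule power2_le_imp_le) (use s X0 in auto)
    define \<rho> where "\<rho> = twisted_mult (\<lambda>n. energy_weight (j + 2) n + energy_weight (j + 2) (S - n) - 2 * (real S + 1) ^ (j + 2)) a b S"
    have "(cmod \<rho>)\<^sup>2 \<le> (\<Sum>n\<le>S. (A * s ^ j * (binom_weight S n * (2 * real n - real S)\<^sup>2 / sqrt (?c n)))\<^sup>2) * X"
      unfolding \<rho>_def X_def
    proof (rule weighted_Cauchy_Schwarz)
      fix n assume "n \<in> {..S}"
      then have n: "n \<le> S" by simp
      have "\<bar>energy_weight (j + 2) n + energy_weight (j + 2) (S - n) - 2 * (real S + 1) ^ (j + 2)\<bar> \<le> A * s ^ j * (2 * real n - real S)\<^sup>2"
        using A(2)[of "2 * real n - real S" s] n unfolding energy_weight_def s_def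
        by (simp add: of_nat_diff algebra_simps abs_le_iff)
      from mult_left_mono[OF this, of "binom_weight S n * (cmod (a n) * cmod (b (S - n)))"]
      show "cmod (of_real (binom_weight S n * (energy_weight (j + 2) n + energy_weight (j + 2) (S - n) - 2 * (real S + 1) ^ (j + 2))) * (a n * b (S - n)))
        \<le> A * s ^ j * (binom_weight S n * (2 * real n - real S)\<^sup>2 / sqrt (?c n)) * (sqrt (?c n) * (cmod (a n) * cmod (b (S - n))))"
        using c0[of n] by (simp add: norm_mult abs_mult mult_ac del: of_real_mult of_real_diff of_real_add)
    qed
    also have "(\<Sum>n\<le>S. (A * s ^ j * (binom_weight S n * (2 * real n - real S)\<^sup>2 / sqrt (?c n)))\<^sup>2)
      = (A * s ^ j)\<^sup>2 * (\<Sum>n\<le>S. (binom_weight S n)\<^sup>2 * (2 * real n - real S) ^ 4 / ?c n)"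
      unfolding sum_distrib_left using c0
      by (intro sum.cong refl) (simp add: power_divide power_mult_distrib flip: power_mult)
    also have "\<dots> * X \<le> (A * s ^ j)\<^sup>2 * 5\<^sup>2 * X"
      by (intro mult_right_mono mult_left_mono binom_weight_concentration X0) auto
    finally have "(cmod \<rho>)\<^sup>2 \<le> (5 * A * s ^ j * sqrt X)\<^sup>2"
      using X0 by (simp add: power_mult_distrib mult_ac)
    then have 2: "cmod \<rho> \<le> 5 * A * s ^ j * sqrt X"
      by (rule power2_le_imp_le) (use s X0 A in auto)
    have "\<bar>Im (fock_mult a b S * cnj \<rho>)\<bar> \<le> cmod (fock_mult a b S) * cmod \<rho>"
      using abs_Im_le_cmod[of "fock_mult a b S * cnj \<rho>"] by (simp add: norm_mult)
    also have "\<dots> \<le> (2 / s * sqrt X) * (5 * A * s ^ j * sqrt X)"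
      by (intro mult_mono 1 2) (use s X0 in auto)
    also have "\<dots> = 10 * A * (s ^ j / s * X)" using X0 by simp
    also have "\<dots> \<le> 10 * A * (s ^ (j - 1) * Y)"
    proof (intro mult_left_mono mult_mono XY)
      show "s ^ j / s \<le> s ^ (j - 1)" using s by (cases j) (auto simp: field_simps)
    qed (use A s X0 in auto)
    finally show "\<bar>Im (fock_mult a b S *
     cnj (twisted_mult (\<lambda>n. energy_weight (j + 2) n + energy_weight (j + 2) (S - n)) a b S))\<bar>
     \<le> 10 * A * ((real S + 1) ^ (j - 1) * (\<Sum>n\<le>S. (energy_weight 1 n * (cmod (a n))\<^sup>2) * (energy_weight 1 (S - n) * (cmod (b (S - n)))\<^sup>2)))"
      unfolding flux_column \<rho>_def s_def Y_def .
  qed (use A in simp)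
qed

text \<open>Here \<open>(S+1)\<^sup>j\<^sup>-\<^sup>1\<close> is absorbed by whichever of \<open>n\<close>, \<open>m\<close> is at least \<open>S/2\<close>, and the antidiagonal sums become
products of energies. The maximum with \<open>1\<close> covers the energy of order two, where both factors are \<open>E\<^sub>1\<close>.\<close>

lemma flux_bound:
  obtains K where "K \<ge> 0" and "\<And>a b. weighted_summable (energy_weight (max 1 j)) a \<Longrightarrow>
     weighted_summable (energy_weight (max 1 j)) b \<Longrightarrow>
     \<bar>flux (j + 2) a b\<bar> \<le> K * (seq_energy (max 1 j) a * seq_energy 1 b + seq_energy 1 a * seq_energy (max 1 j) b)"
proof -
  obtain K where K: "K \<ge> 0" and col: "\<And>a b S. \<bar>Im (fock_mult a b S *
     cnj (twisted_mult (\<lambda>n. energy_weight (j + 2) n + energy_weight (j + 2) (S - n)) a b S))\<bar>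
     \<le> K * ((real S + 1) ^ (j - 1) * (\<Sum>n\<le>S. (energy_weight 1 n * (cmod (a n))\<^sup>2) * (energy_weight 1 (S - n) * (cmod (b (S - n)))\<^sup>2)))"
    by (rule flux_column_bound[of j]) blast
  show ?thesis
  proof (rule that[OF K])
    fix a b :: "nat \<Rightarrow> complex"
    let ?J = "max 1 j"
    let ?e = "\<lambda>i a n. energy_weight i n * (cmod (a n :: complex))\<^sup>2"
    assume a: "summable (?e ?J a)" and b: "summable (?e ?J b)"
    have low: "summable (?e 1 a)" if "summable (?e ?J a)" for a
    proof (rule summable_comparison_test'[where N = 0, OF that])
      fix n show "norm (?e 1 a n) \<le> ?e ?J a n"
        using mult_right_mono[OF energy_weight_exponent_mono[of 1 ?J n], of "(cmod (a n))\<^sup>2"] energy_weight_pos[of 1 n]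
        by (simp add: abs_mult)
    qed
    let ?U = "\<lambda>S. \<Sum>n\<le>S. ?e ?J a n * ?e 1 b (S - n)" and ?V = "\<lambda>S. \<Sum>n\<le>S. ?e 1 a n * ?e ?J b (S - n)"
    have nn: "0 \<le> ?e i a n" for i a n using energy_weight_pos[of i n] by simp
    have U: "?U sums (seq_energy ?J a * seq_energy 1 b)" and V: "?V sums (seq_energy 1 a * seq_energy ?J b)"
      unfolding seq_energy_def by (intro Cauchy_product_nonneg a b low nn)+
    have pw: "(real S + 1) ^ (j - 1) * (\<Sum>n\<le>S. ?e 1 a n * ?e 1 b (S - n)) \<le> ?U S + ?V S" for S
      unfolding sum_distrib_left sum.distrib[symmetric]
    proof (rule sum_mono)
      fix n assume "n \<in> {..S}"
      then have n: "n \<le> S" by simp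
      have ex: "energy_weight ?J m = energy_weight (j - 1) m * energy_weight 1 m" for m
        by (cases j) (auto simp: energy_weight_def)
      have "(real S + 1) ^ (j - 1) \<le> energy_weight (j - 1) n + energy_weight (j - 1) (S - n)"
      proof (cases "S \<le> 2 * n")
        case True
        then have "(real S + 1) ^ (j - 1) \<le> energy_weight (j - 1) n"
          unfolding energy_weight_def by (intro power_mono) auto
        then show ?thesis using energy_weight_pos[of "j - 1" "S - n"] by simp
      next
        case False
        then have "(real S + 1) ^ (j - 1) \<le> energy_weight (j - 1) (S - n)"
          unfolding energy_weight_def using n by (intro power_mono) (auto simp: of_nat_diff)
        then show ?thesis using energy_weight_pos[of "j - 1" n] by simp
      qed
      from mult_right_mono[OF this mult_nonneg_nonneg[OF nn[where i = 1 and a = a and n = n] nn[where i = 1 and a = b and n = "S - n"]]]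
      show "(real S + 1) ^ (j - 1) * (?e 1 a n * ?e 1 b (S - n)) \<le> ?e ?J a n * ?e 1 b (S - n) + ?e 1 a n * ?e ?J b (S - n)"
        unfolding ex by (simp add: algebra_simps)
    qed
    let ?x = "\<lambda>S. Im (fock_mult a b S * cnj (twisted_mult (\<lambda>n. energy_weight (j + 2) n + energy_weight (j + 2) (S - n)) a b S))"
    have x: "norm (?x S) \<le> K * (?U S + ?V S)" for S
      using order_trans[OF col mult_left_mono[OF pw K]] by simp
    have UV: "(\<lambda>S. K * (?U S + ?V S)) sums (K * (seq_energy ?J a * seq_energy 1 b + seq_energy 1 a * seq_energy ?J b))"
      by (intro sums_mult sums_add U V)
    have "norm (suminf ?x) \<le> (\<Sum>S. K * (?U S + ?V S))"
      by (rule norm_suminf_le[OF x sums_summable[OF UV]])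
    then show "\<bar>flux (j + 2) a b\<bar> \<le> K * (seq_energy ?J a * seq_energy 1 b + seq_energy 1 a * seq_energy ?J b)"
      unfolding flux_def using UV by (simp add: sums_iff)
  qed
qed

section \<open>The system as a vector field on sequence space\<close>

text \<open>The weight for which \<open>weighted_sum (fock_weight k) a\<close> is exactly the squared norm of \<open>L2E k\<close>: it is
\<open>1/n!\<close> times the integral of \<open>r\<^sup>n (1+r)\<^sup>k exp (-r)\<close> over the half-line.\<close>

definition fock_weight :: "nat \<Rightarrow> nat \<Rightarrow> real" where
  "fock_weight k n = (\<Sum>j\<le>k. real (k choose j) * pochhammer (real n + 1) j)"

lemma fock_weight_lower: "(real n + 1) ^ k \<le> fock_weight k n"
proof -
  have "(real n + 1) ^ k \<le> ((real n + 1) + 1) ^ k" by (intro power_mono) auto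
  also have "\<dots> = (\<Sum>j\<le>k. real (k choose j) * (real n + 1) ^ j)"
    by (subst binomial_ring) simp
  also have "\<dots> \<le> fock_weight k n"
    unfolding fock_weight_def
  proof (intro sum_mono mult_left_mono)
    fix j
    have "(real n + 1) ^ j = (\<Prod>i\<in>{0..<j}. real n + 1)" by simp
    also have "\<dots> \<le> pochhammer (real n + 1) j"
      unfolding pochhammer_prod by (intro prod_mono) auto
    finally show "(real n + 1) ^ j \<le> pochhammer (real n + 1) j" .
  qed auto
  finally show ?thesis .
qed

lemma fock_weight_upper: "fock_weight k n \<le> (real k + 2) ^ k * (real n + 1) ^ k"
proof -
  have "fock_weight k n \<le> (\<Sum>j\<le>k. real (k choose j) * ((real k + 1) * (real n + 1)) ^ j)"
    unfolding fock_weight_def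
  proof (intro sum_mono mult_left_mono)
    fix j assume j: "j \<in> {..k}"
    have "pochhammer (real n + 1) j \<le> (\<Prod>i\<in>{0..<j}. (real k + 1) * (real n + 1))"
      unfolding pochhammer_prod
    proof (intro prod_mono conjI)
      fix i assume "i \<in> {0..<j}"
      then have "real i \<le> real k * (real n + 1)" using j mult_mono[of "real i" "real k" 1 "real n + 1"] by simp
      then show "real n + 1 + real i \<le> (real k + 1) * (real n + 1)" by (simp add: algebra_simps)
    qed auto
    then show "pochhammer (real n + 1) j \<le> ((real k + 1) * (real n + 1)) ^ j" by simp
  qed auto
  also have "\<dots> = ((real k + 1) * (real n + 1) + 1) ^ k"
    by (simp add: binomial_ring)
  also have "\<dots> \<le> ((real k + 2) * (real n + 1)) ^ k"
    by (intro power_mono) (auto simp: algebra_simps)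
  finally show ?thesis by (simp add: power_mult_distrib)
qed

lemma fock_weight_ge_1: "1 \<le> fock_weight k n"
  by (rule order_trans[OF _ fock_weight_lower]) (simp add: one_le_power)

lemma fock_weight_pos: "0 < fock_weight k n"
  using fock_weight_ge_1[of k n] by simp

lemma fock_weight_mono: "m \<le> n \<Longrightarrow> fock_weight k m \<le> fock_weight k n"
  unfolding fock_weight_def pochhammer_prod
  by (intro sum_mono mult_left_mono prod_mono) auto

lemma fock_weight_submult: "fock_weight k (j + l) \<le> (real k + 2) ^ k * (fock_weight k j * fock_weight k l)"
proof -
  have "fock_weight k (j + l) \<le> (real k + 2) ^ k * (real (j + l) + 1) ^ k" by (rule fock_weight_upper)
  also have "\<dots> \<le> (real k + 2) ^ k * ((real j + 1) * (real l + 1)) ^ k"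
    by (intro mult_left_mono power_mono) (auto simp: algebra_simps)
  also have "\<dots> \<le> (real k + 2) ^ k * (fock_weight k j * fock_weight k l)"
    unfolding power_mult_distrib by (intro mult_left_mono mult_mono fock_weight_lower) (auto intro: less_imp_le[OF fock_weight_pos])
  finally show ?thesis .
qed

text \<open>An element of \<open>ell2\<close> represents a function in \<open>L2E k\<close> isometrically, for each \<open>k\<close>, once its coordinates are divided by
the square root of the weight. In this way one Hilbert space serves for all \<open>k\<close>.\<close>

definition coef :: "nat \<Rightarrow> ell2 \<Rightarrow> nat \<Rightarrow> complex" where
  "coef k x n = coord x n / of_real (sqrt (fock_weight k n))"

definition of_coef :: "nat \<Rightarrow> (nat \<Rightarrow> complex) \<Rightarrow> ell2" where
  "of_coef k a = Ell2 (\<lambda>n. of_real (sqrt (fock_weight k n)) * a n)"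

lemma coef_simps [simp]:
  "coef k 0 n = 0" "coef k (x + y) n = coef k x n + coef k y n" "coef k (x - y) n = coef k x n - coef k y n"
  "coef k (c *\<^sub>R x) n = c *\<^sub>R coef k x n"
  by (simp_all add: coef_def add_divide_distrib diff_divide_distrib scaleR_conv_of_real)

lemma weight_coef_square: "fock_weight k n * (cmod (coef k x n))\<^sup>2 = (cmod (coord x n))\<^sup>2"
  using fock_weight_pos[of k n] by (simp add: coef_def norm_divide power_divide)

lemma coef_summable: "weighted_summable (fock_weight k) (coef k x)"
  unfolding weight_coef_square by (rule coord_square_summable)

lemma norm_eq_coef: "(norm x)\<^sup>2 = weighted_sum (fock_weight k) (coef k x)"
  unfolding weight_coef_square by (rule ell2_norm_square)

lemma coef_of_coef:
  assumes "weighted_summable (fock_weight k) a"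
  shows "coef k (of_coef k a) = a"
proof
  fix n
  have "summable (\<lambda>n. (cmod (of_real (sqrt (fock_weight k n)) * a n))\<^sup>2)"
    using assms less_imp_le[OF fock_weight_pos[of k]] by (simp add: norm_mult power_mult_distrib)
  from coord_Ell2[OF this] show "coef k (of_coef k a) n = a n"
    using fock_weight_pos[of k n] by (simp add: coef_def of_coef_def)
qed

lemma coef_inject: "coef k x = coef k y \<Longrightarrow> x = y"
proof (rule ell2_eqI)
  fix n assume "coef k x = coef k y"
  then have "coef k x n = coef k y n" by simp
  then show "coord x n = coord y n" using fock_weight_pos[of k n] by (simp add: coef_def)
qed

lemma weighted_summable_mono:
  fixes p q :: "nat \<Rightarrow> real"
  assumes "weighted_summable q a" "\<And>n. 0 \<le> p n" "\<And>n. p n \<le> C * q n"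
  shows "weighted_summable p a"
proof (rule summable_comparison_test'[where N = 0, OF summable_mult[OF assms(1), of C]])
  show "norm (p n * (cmod (a n))\<^sup>2) \<le> C * (q n * (cmod (a n))\<^sup>2)" for n
    using mult_right_mono[OF assms(3)[of n], of "(cmod (a n))\<^sup>2"] assms(2)[of n] by (simp add: abs_mult mult.assoc)
qed

lemma weighted_sum_mono:
  fixes p q :: "nat \<Rightarrow> real"
  assumes "weighted_summable q a" "\<And>n. 0 \<le> p n" "\<And>n. p n \<le> C * q n"
  shows "weighted_sum p a \<le> C * weighted_sum q a"
proof -
  have "p n * (cmod (a n))\<^sup>2 \<le> C * (q n * (cmod (a n))\<^sup>2)" for n
    using mult_right_mono[OF assms(3)[of n], of "(cmod (a n))\<^sup>2"] by (simp add: mult.assoc)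
  from suminf_le[OF this weighted_summable_mono[OF assms] summable_mult[OF assms(1)]]
  show ?thesis by (simp add: suminf_mult[OF assms(1)])
qed

lemma coef_square_summable: "square_summable (coef k x)"
  using weighted_summable_mono[OF coef_summable, of "\<lambda>_. 1" 1 k x] fock_weight_ge_1[of k] by simp

lemma coef_square_le: "square_sum (coef k x) \<le> (norm x)\<^sup>2"
  using weighted_sum_mono[OF coef_summable, of "\<lambda>_. 1" 1 k x] fock_weight_ge_1[of k]
  by (simp add: norm_eq_coef[of x k])

definition mult_op :: "nat \<Rightarrow> ell2 \<Rightarrow> ell2 \<Rightarrow> ell2" where
  "mult_op k x y = of_coef k (fock_mult (coef k x) (coef k y))"

definition comult_op :: "nat \<Rightarrow> ell2 \<Rightarrow> ell2 \<Rightarrow> ell2" where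
  "comult_op k y w = of_coef k (fock_comult (coef k y) (coef k w))"

lemmas weighted_mult = fock_mult_weighted[of "fock_weight k" for k,
  OF less_imp_le[OF fock_weight_pos] fock_weight_submult coef_summable coef_summable]
lemmas weighted_comult = fock_comult_weighted[of "fock_weight k" for k,
  OF fock_weight_ge_1 fock_weight_mono coef_square_summable coef_summable]

lemma coef_mult_op: "coef k (mult_op k x y) = fock_mult (coef k x) (coef k y)"
  unfolding mult_op_def by (rule coef_of_coef) (rule weighted_mult)

lemma coef_comult_op: "coef k (comult_op k y w) = fock_comult (coef k y) (coef k w)"
  unfolding comult_op_def by (rule coef_of_coef) (rule weighted_comult)

lemma mult_op_commute: "mult_op k x y = mult_op k y x"
  unfolding mult_op_def by (simp add: fock_mult_commute)

lemma mult_op_bilinear: "bounded_bilinear (mult_op k)"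
proof (rule bounded_bilinear.intro)
  show "\<exists>K. \<forall>a b. norm (mult_op k a b) \<le> norm a * norm b * K"
  proof (intro exI allI)
    fix a b
    have "(norm (mult_op k a b))\<^sup>2 \<le> (real k + 2) ^ k * ((norm a)\<^sup>2 * (norm b)\<^sup>2)"
      unfolding norm_eq_coef[of _ k] coef_mult_op by (rule weighted_mult)
    then have "(norm (mult_op k a b))\<^sup>2 \<le> (norm a * norm b * sqrt ((real k + 2) ^ k))\<^sup>2"
      by (simp add: power_mult_distrib mult_ac)
    then show "norm (mult_op k a b) \<le> norm a * norm b * sqrt ((real k + 2) ^ k)"
      by (rule power2_le_imp_le) auto
  qed
qed (rule coef_inject[of k]; rule ext; simp add: coef_mult_op fock_mult_def algebra_simps sum.distrib scaleR_right.sum)+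

lemma comult_terms: "summable (\<lambda>m. of_real (binom_weight (n + m) n) * (cnj (coef k y m) * coef k w (n + m)))"
  by (rule summable_norm_cancel)
     (rule fock_comult_terms_summable[OF coef_square_summable coef_square_summable])

lemma comult_op_bilinear: "bounded_bilinear (comult_op k)"
proof (rule bounded_bilinear.intro)
  show "\<exists>K. \<forall>a b. norm (comult_op k a b) \<le> norm a * norm b * K"
  proof (intro exI allI)
    fix a b
    have "(norm (comult_op k a b))\<^sup>2 \<le> (\<Sum>n. (cmod (coef k a n))\<^sup>2) * (norm b)\<^sup>2"
      unfolding norm_eq_coef[of "comult_op k a b" k] norm_eq_coef[of b k] coef_comult_op by (rule weighted_comult)
    also have "\<dots> \<le> (norm a)\<^sup>2 * (norm b)\<^sup>2"
      by (intro mult_right_mono coef_square_le) auto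
    finally have "(norm (comult_op k a b))\<^sup>2 \<le> (norm a * norm b * 1)\<^sup>2"
      by (simp add: power_mult_distrib)
    then show "norm (comult_op k a b) \<le> norm a * norm b * 1"
      by (rule power2_le_imp_le) auto
  qed
next
  fix a a' b b' :: ell2 and r :: real
  show "comult_op k (a + a') b = comult_op k a b + comult_op k a' b"
    by (rule coef_inject[of k], rule ext)
       (simp only: coef_comult_op fock_comult_def coef_simps complex_cnj_add distrib_left distrib_right
          suminf_add[symmetric] comult_terms)
  show "comult_op k a (b + b') = comult_op k a b + comult_op k a b'"
    by (rule coef_inject[of k], rule ext)
       (simp only: coef_comult_op fock_comult_def coef_simps complex_cnj_add distrib_left distrib_right
          suminf_add[symmetric] comult_terms)
  show "comult_op k (r *\<^sub>R a) b = r *\<^sub>R comult_op k a b"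
    by (rule coef_inject[of k], rule ext)
       (simp add: coef_comult_op fock_comult_def suminf_scaleR_right comult_terms del: scaleR_complex.simps)
  show "comult_op k a (r *\<^sub>R b) = r *\<^sub>R comult_op k a b"
    by (rule coef_inject[of k], rule ext)
       (simp add: coef_comult_op fock_comult_def suminf_scaleR_right comult_terms del: scaleR_complex.simps)
qed

text \<open>The factor in \<open>a' = coupling C(b, M(a,b))\<close>.\<close>

definition coupling :: complex where "coupling = - \<i> / of_real (2 * pi)"

lift_definition phase_op :: "ell2 \<Rightarrow> ell2" is "\<lambda>x n. coupling * x n"
proof -
  fix x :: "nat \<Rightarrow> complex" assume "square_summable x"
  from summable_mult[OF this, of "(cmod coupling)\<^sup>2"]
  show "summable (\<lambda>n. (cmod (coupling * x n))\<^sup>2)"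
    unfolding norm_mult power_mult_distrib .
qed

lemma coord_phase_op: "coord (phase_op x) n = coupling * coord x n"
  by transfer simp

lemma coef_phase_op: "coef k (phase_op x) n = coupling * coef k x n"
  unfolding coef_def coord_phase_op by simp

lemma phase_op_linear: "bounded_linear phase_op"
proof (rule bounded_linear_intro[where K = 1])
  fix x y :: ell2 and r :: real
  show "phase_op (x + y) = phase_op x + phase_op y"
    by (rule ell2_eqI) (simp add: coord_phase_op distrib_left)
  show "phase_op (r *\<^sub>R x) = r *\<^sub>R phase_op x"
    by (rule ell2_eqI) (simp add: coord_phase_op scaleR_conv_of_real)
  have "(norm (phase_op x))\<^sup>2 \<le> (norm x)\<^sup>2"
    unfolding ell2_norm_square
  proof (rule suminf_le[OF _ coord_square_summable coord_square_summable])
    fix n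
    have "cmod coupling \<le> 1" using pi_gt3 by (simp add: coupling_def norm_divide norm_mult)
    then have "cmod (coord (phase_op x) n) \<le> 1 * cmod (coord x n)"
      unfolding coord_phase_op norm_mult by (rule mult_right_mono) simp
    then show "(cmod (coord (phase_op x) n))\<^sup>2 \<le> (cmod (coord x n))\<^sup>2"
      by (simp add: power_mono)
  qed
  from power2_le_imp_le[OF this] show "norm (phase_op x) \<le> norm x * 1" by simp
qed

definition fock_field :: "nat \<Rightarrow> ell2 \<times> ell2 \<Rightarrow> ell2 \<times> ell2" where
  "fock_field k z = (phase_op (comult_op k (snd z) (mult_op k (fst z) (snd z))),
                phase_op (comult_op k (fst z) (mult_op k (fst z) (snd z))))"

text \<open>A product of functions that are Lipschitz, hence bounded, on balls is Lipschitz on balls.\<close>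

lemma locally_lipschitz_bilinear:
  fixes f :: "'a::real_normed_vector \<Rightarrow> 'b::real_normed_vector" and g :: "'a \<Rightarrow> 'c::real_normed_vector"
    and p :: "'b \<Rightarrow> 'c \<Rightarrow> 'd::real_normed_vector"
  assumes p: "bounded_bilinear p"
    and f: "\<And>R. \<exists>L. L-lipschitz_on (cball 0 R) f" and g: "\<And>R. \<exists>L. L-lipschitz_on (cball 0 R) g"
  shows "\<exists>L. L-lipschitz_on (cball 0 R) (\<lambda>z. p (f z) (g z))"
proof -
  interpret p: bounded_bilinear p by (rule p)
  obtain K where K: "K \<ge> 0" "\<And>a b. norm (p a b) \<le> norm a * norm b * K" using p.nonneg_bounded by blast
  define r where "r = max R 0"
  have r: "r \<ge> 0" by (simp add: r_def)
  obtain A where A: "A-lipschitz_on (cball 0 r) f" using f by blast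
  obtain B where B: "B-lipschitz_on (cball 0 r) g" using g by blast
  have AB: "A \<ge> 0" "B \<ge> 0" using A B lipschitz_on_nonneg by blast+
  have bound: "norm (h z) \<le> norm (h 0) + L * r" if L: "L-lipschitz_on (cball 0 r) h" "L \<ge> 0" and z: "norm z \<le> r"
    for h :: "'a \<Rightarrow> 'e::real_normed_vector" and L z
  proof -
    have "norm (h z - h 0) \<le> L * norm (z - 0)"
      using lipschitz_onD[OF L(1), of z 0] z r by (simp add: dist_norm)
    also have "\<dots> \<le> L * r" using z L(2) by (intro mult_left_mono) auto
    finally show ?thesis using norm_triangle_sub[of "h z" "h 0"] by simp
  qed
  define M where "M = norm (f 0) + A * r"
  define N where "N = norm (g 0) + B * r"
  have MN: "M \<ge> 0" "N \<ge> 0" using AB r by (auto simp: M_def N_def)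
  have "((A * N + M * B) * K)-lipschitz_on (cball 0 r) (\<lambda>z. p (f z) (g z))"
  proof (rule lipschitz_onI)
    fix z w :: 'a assume "z \<in> cball 0 r" "w \<in> cball 0 r"
    then have zw: "norm z \<le> r" "norm w \<le> r" by auto
    have fd: "norm (f z - f w) \<le> A * norm (z - w)" and gd: "norm (g z - g w) \<le> B * norm (z - w)"
      using lipschitz_onD[OF A, of z w] lipschitz_onD[OF B, of z w] zw by (auto simp: dist_norm)
    have "p (f z) (g z) - p (f w) (g w) = p (f z - f w) (g z) + p (f w) (g z - g w)"
      by (simp add: p.diff_left p.diff_right)
    also have "norm \<dots> \<le> norm (f z - f w) * norm (g z) * K + norm (f w) * norm (g z - g w) * K"
      by (rule norm_triangle_le[OF add_mono[OF K(2) K(2)]])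
    also have "\<dots> \<le> (A * norm (z - w)) * N * K + M * (B * norm (z - w)) * K"
      unfolding M_def N_def
      by (intro add_mono mult_right_mono mult_mono fd gd K bound[OF A AB(1) zw(2)] bound[OF B AB(2) zw(1)])
         (use AB r K in auto)
    also have "\<dots> = ((A * N + M * B) * K) * norm (z - w)" by (simp add: algebra_simps)
    finally show "dist (p (f z) (g z)) (p (f w) (g w)) \<le> ((A * N + M * B) * K) * dist z w"
      by (simp add: dist_norm)
  qed (use AB MN K in simp)
  then show ?thesis
    by (intro exI[of _ "(A * N + M * B) * K"]) (erule lipschitz_on_subset, auto simp: r_def)
qed

lemma locally_lipschitz_linear:
  assumes h: "bounded_linear h"
  shows "\<exists>L. L-lipschitz_on (cball 0 R) h"
proof -
  obtain K where "K \<ge> 0" "\<And>x. norm (h x) \<le> norm x * K" using bounded_linear.nonneg_bounded[OF h] by blast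
  then have "K-lipschitz_on (cball 0 R) h"
    by (intro lipschitz_onI) (auto simp: dist_norm mult.commute linear_diff[OF bounded_linear.linear[OF h], symmetric])
  then show ?thesis by blast
qed

lemma locally_lipschitz_linear_comp:
  fixes f :: "'a::real_normed_vector \<Rightarrow> 'b::real_normed_vector"
  assumes h: "bounded_linear h" and f: "\<And>R. \<exists>L. L-lipschitz_on (cball 0 R) f"
  shows "\<exists>L. L-lipschitz_on (cball 0 R) (\<lambda>z. h (f z))"
proof -
  obtain K where K: "K \<ge> 0" "\<And>x. norm (h x) \<le> norm x * K" using bounded_linear.nonneg_bounded[OF h] by blast
  obtain L where L: "L-lipschitz_on (cball 0 R) f" using f by blast
  have "(L * K)-lipschitz_on (cball 0 R) (\<lambda>z. h (f z))"
  proof (rule lipschitz_onI)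
    fix x y :: 'a assume xy: "x \<in> cball 0 R" "y \<in> cball 0 R"
    have "dist (h (f x)) (h (f y)) \<le> dist (f x) (f y) * K"
      using K(2)[of "f x - f y"] by (simp add: dist_norm linear_diff[OF bounded_linear.linear[OF h]])
    also have "\<dots> \<le> (L * dist x y) * K"
      using lipschitz_onD[OF L xy] K by (intro mult_right_mono) auto
    finally show "dist (h (f x)) (h (f y)) \<le> L * K * dist x y" by (simp add: mult_ac)
  qed (use lipschitz_on_nonneg[OF L] K in simp)
  then show ?thesis by blast
qed

lemma fock_field_locally_lipschitz: "\<exists>L. L-lipschitz_on (cball 0 R) (fock_field k)"
proof -
  note fs = locally_lipschitz_linear[OF bounded_linear_fst] locally_lipschitz_linear[OF bounded_linear_snd]
  have "\<exists>L. L-lipschitz_on (cball 0 R) (\<lambda>z. phase_op (comult_op k (snd z) (mult_op k (fst z) (snd z))))"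
    by (intro locally_lipschitz_linear_comp[OF phase_op_linear] locally_lipschitz_bilinear[OF comult_op_bilinear]
        locally_lipschitz_bilinear[OF mult_op_bilinear] fs)
  moreover have "\<exists>L. L-lipschitz_on (cball 0 R) (\<lambda>z. phase_op (comult_op k (fst z) (mult_op k (fst z) (snd z))))"
    by (intro locally_lipschitz_linear_comp[OF phase_op_linear] locally_lipschitz_bilinear[OF comult_op_bilinear]
        locally_lipschitz_bilinear[OF mult_op_bilinear] fs)
  ultimately obtain L M where
    L: "L-lipschitz_on (cball 0 R) (\<lambda>z. phase_op (comult_op k (snd z) (mult_op k (fst z) (snd z))))" and
    M: "M-lipschitz_on (cball 0 R) (\<lambda>z. phase_op (comult_op k (fst z) (mult_op k (fst z) (snd z))))" by blast
  from lipschitz_on_Pair[OF L M] show ?thesis unfolding fock_field_def[abs_def] by blast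
qed

lemma fock_field_times_differentiable:
  "times_differentiable n z \<Longrightarrow> times_differentiable n (\<lambda>t. fock_field k (z t))"
  unfolding fock_field_def
  by (intro times_differentiable_Pair times_differentiable_linear[OF phase_op_linear]
      times_differentiable_bilinear[OF comult_op_bilinear] times_differentiable_bilinear[OF mult_op_bilinear]
      times_differentiable_linear[OF bounded_linear_fst] times_differentiable_linear[OF bounded_linear_snd])

section \<open>Growth of the energies\<close>

lemma energy_weight_submult: "energy_weight j (m + n) \<le> 1 * (energy_weight j m * energy_weight j n)"
  unfolding energy_weight_def mult_1 power_mult_distrib[symmetric]
  by (intro power_mono) (auto simp: algebra_simps)

lemma energy_weight_le_fock_weight:
  assumes "j \<le> k"
  shows "energy_weight j n \<le> 2 ^ k * fock_weight k n"
proof -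
  have "energy_weight j n \<le> energy_weight k n" by (rule energy_weight_exponent_mono[OF assms])
  also have "\<dots> \<le> (2 * (real n + 1)) ^ k" unfolding energy_weight_def by (intro power_mono) auto
  also have "\<dots> \<le> 2 ^ k * fock_weight k n"
    unfolding power_mult_distrib by (intro mult_left_mono fock_weight_lower) auto
  finally show ?thesis .
qed

lemma energy_summable:
  assumes "j \<le> k"
  shows "weighted_summable (energy_weight j) (coef k x)"
  by (rule weighted_summable_mono[OF coef_summable[of k x], where C = "2 ^ k"])
     (use energy_weight_le_fock_weight[OF assms] energy_weight_pos in \<open>auto intro: less_imp_le\<close>)

text \<open>The two equations contribute the twisted products with factors \<open>p n\<close> and \<open>p (S - n)\<close>, the second one after
reversal of the antidiagonal.\<close>

lemma flux_eq_pairings: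
  assumes a: "weighted_summable (energy_weight j) a" "square_summable a"
    and b: "weighted_summable (energy_weight j) b" "square_summable b"
  shows "(\<lambda>n. energy_weight j n * (Im (cnj (a n) * fock_comult b (fock_mult a b) n) + Im (cnj (b n) * fock_comult a (fock_mult a b) n))) sums flux j a b"
proof -
  let ?p = "energy_weight j" and ?\<alpha> = "fock_mult a b"
  note w = less_imp_le[OF energy_weight_pos]
  have \<alpha>: "weighted_summable ?p ?\<alpha>"
    by (rule fock_mult_weighted(1)[OF w energy_weight_submult a(1) b(1)])
  have \<alpha>1: "square_summable ?\<alpha>"
    using fock_mult_weighted(1)[of "\<lambda>_. 1" 1 a b] a b by simp
  note P = fock_comult_pairing[of ?p a b ?\<alpha>, OF w energy_weight_mono a(1) b(2) \<alpha> \<alpha>1]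
  note Q = fock_comult_pairing[of ?p b a ?\<alpha>, OF w energy_weight_mono b(1) a(2) \<alpha> \<alpha>1]
  let ?A = "\<lambda>S. \<Sum>n\<le>S. of_real (binom_weight S n * ?p n) * (a n * b (S - n))"
  let ?B = "\<lambda>S. \<Sum>n\<le>S. of_real (binom_weight S n * ?p n) * (b n * a (S - n))"
  have AB: "?\<alpha> S * cnj (?A S) + ?\<alpha> S * cnj (?B S)
     = ?\<alpha> S * cnj (\<Sum>n\<le>S. of_real (binom_weight S n * (?p n + ?p (S - n))) * (a n * b (S - n)))" for S
  proof -
    have "?B S = (\<Sum>n\<le>S. of_real (binom_weight S (S - n) * ?p (S - n)) * (b (S - n) * a n))"
      by (rule sum.reindex_bij_witness[of _ "\<lambda>n. S - n" "\<lambda>n. S - n"]) auto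
    also have "\<dots> = (\<Sum>n\<le>S. of_real (binom_weight S n * ?p (S - n)) * (a n * b (S - n)))"
      by (intro sum.cong refl) (simp add: binom_weight_sym mult.commute)
    finally have "?A S + ?B S = (\<Sum>n\<le>S. of_real (binom_weight S n * (?p n + ?p (S - n))) * (a n * b (S - n)))"
      by (simp add: sum.distrib[symmetric] algebra_simps)
    then show ?thesis by (simp only: distrib_left[symmetric] complex_cnj_add[symmetric])
  qed
  have "(\<lambda>n. of_real (?p n) * (cnj (a n) * fock_comult b ?\<alpha> n) + of_real (?p n) * (cnj (b n) * fock_comult a ?\<alpha> n))
    sums (\<Sum>S. ?\<alpha> S * cnj (?A S) + ?\<alpha> S * cnj (?B S))"
    using sums_add[OF P(1) Q(1)] by (simp only: suminf_add[OF P(2) Q(2)])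
  then have "(\<lambda>n. Im (of_real (?p n) * (cnj (a n) * fock_comult b ?\<alpha> n) + of_real (?p n) * (cnj (b n) * fock_comult a ?\<alpha> n)))
    sums Im (\<Sum>S. ?\<alpha> S * cnj (?A S) + ?\<alpha> S * cnj (?B S))"
    by (rule bounded_linear.sums[OF bounded_linear_Im])
  moreover have "Im (\<Sum>S. ?\<alpha> S * cnj (?A S) + ?\<alpha> S * cnj (?B S)) = flux j a b"
    unfolding flux_def AB[symmetric]
    by (rule bounded_linear.suminf[OF bounded_linear_Im]) (intro summable_add P(2) Q(2))
  moreover have "Im (of_real r * z + of_real r * w) = r * (Im z + Im w)" for r z w
    by (simp add: distrib_left)
  ultimately show ?thesis by (simp only:)
qed

definition energy :: "nat \<Rightarrow> nat \<Rightarrow> ell2 \<times> ell2 \<Rightarrow> real" where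
  "energy k j z = seq_energy j (coef k (fst z)) + seq_energy j (coef k (snd z))"

text \<open>The energy of order \<open>j\<close> is the quadratic form of this operator (\<open>inner_diag_op_self\<close>), so its derivative along a
curve is a matter of bounded bilinear maps.\<close>

definition diag_op :: "nat \<Rightarrow> nat \<Rightarrow> ell2 \<Rightarrow> ell2" where
  "diag_op k j x = Ell2 (\<lambda>n. (energy_weight j n / fock_weight k n) *\<^sub>R coord x n)"

lemma weight_ratio_bound:
  assumes "j \<le> k"
  shows "0 \<le> energy_weight j n / fock_weight k n" "energy_weight j n / fock_weight k n \<le> 2 ^ k"
  using energy_weight_le_fock_weight[OF assms, of n] fock_weight_pos[of k n] energy_weight_pos[of j n]
  by (auto simp: divide_le_eq)

lemma coord_diag_op:
  assumes "j \<le> k"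
  shows "coord (diag_op k j x) n = (energy_weight j n / fock_weight k n) *\<^sub>R coord x n"
proof -
  have "summable (\<lambda>n. (cmod ((energy_weight j n / fock_weight k n) *\<^sub>R coord x n))\<^sup>2)"
  proof (rule summable_comparison_test'[where N = 0, OF summable_mult[OF coord_square_summable, of "(2 ^ k)\<^sup>2" x]])
    fix n
    show "norm ((cmod ((energy_weight j n / fock_weight k n) *\<^sub>R coord x n))\<^sup>2) \<le> (2 ^ k)\<^sup>2 * (cmod (coord x n))\<^sup>2"
      unfolding norm_scaleR power_mult_distrib using weight_ratio_bound[OF assms, of n]
      by (simp add: abs_mult) (intro mult_right_mono power_mono; simp)
  qed
  from coord_Ell2[OF this] show ?thesis by (simp add: diag_op_def)
qed

lemma diag_op_linear:
  assumes "j \<le> k"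
  shows "bounded_linear (diag_op k j)"
proof (rule bounded_linear_intro[where K = "2 ^ k"])
  fix x y :: ell2 and r :: real
  show "diag_op k j (x + y) = diag_op k j x + diag_op k j y"
    by (rule ell2_eqI) (simp add: coord_diag_op[OF assms] scaleR_add_right)
  show "diag_op k j (r *\<^sub>R x) = r *\<^sub>R diag_op k j x"
    by (rule ell2_eqI) (simp add: coord_diag_op[OF assms])
  have "(norm (diag_op k j x))\<^sup>2 \<le> (2 ^ k)\<^sup>2 * (norm x)\<^sup>2"
    unfolding ell2_norm_square suminf_mult[OF coord_square_summable, symmetric]
  proof (rule suminf_le[OF _ coord_square_summable summable_mult[OF coord_square_summable]])
    show "(cmod (coord (diag_op k j x) n))\<^sup>2 \<le> (2 ^ k)\<^sup>2 * (cmod (coord x n))\<^sup>2" for n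
      unfolding coord_diag_op[OF assms] norm_scaleR power_mult_distrib using weight_ratio_bound[OF assms, of n]
      by (intro mult_right_mono power_mono) auto
  qed
  then have "(norm (diag_op k j x))\<^sup>2 \<le> (norm x * 2 ^ k)\<^sup>2" by (simp add: power_mult_distrib mult.commute)
  from power2_le_imp_le[OF this] show "norm (diag_op k j x) \<le> norm x * 2 ^ k" by simp
qed

lemma inner_ell2_coord: "inner x y = (\<Sum>n. coord x n \<bullet> coord y n)"
  by (rule inner_ell2.rep_eq)

lemma coord_diag_op_inner:
  assumes "j \<le> k"
  shows "coord (diag_op k j x) n \<bullet> coord y n = energy_weight j n * (coef k x n \<bullet> coef k y n)"
proof -
  let ?r = "sqrt (fock_weight k n)"
  have r: "?r * ?r = fock_weight k n" "?r \<noteq> 0" using fock_weight_pos[of k n] by auto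
  have "coord z n = ?r *\<^sub>R coef k z n" for z
    using r by (simp add: coef_def scaleR_conv_of_real)
  then have "coord x n \<bullet> coord y n = fock_weight k n * (coef k x n \<bullet> coef k y n)"
    using r by (simp add: mult.assoc[symmetric])
  then show ?thesis using fock_weight_pos[of k n] by (simp add: coord_diag_op[OF assms])
qed

lemma inner_diag_op:
  assumes "j \<le> k"
  shows "inner (diag_op k j x) y = (\<Sum>n. energy_weight j n * (coef k x n \<bullet> coef k y n))"
  unfolding inner_ell2_coord coord_diag_op_inner[OF assms] ..

lemma inner_diag_op_self: "j \<le> k \<Longrightarrow> inner (diag_op k j x) x = seq_energy j (coef k x)"
  by (simp add: inner_diag_op seq_energy_def power2_norm_eq_inner)

lemma inner_diag_op_commute: "j \<le> k \<Longrightarrow> inner (diag_op k j x) y = inner (diag_op k j y) x"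
  unfolding inner_diag_op by (simp only: inner_commute)

lemma energy_pairing_field:
  assumes j: "j \<le> k"
  shows "inner (diag_op k j (fst z)) (fst (fock_field k z)) + inner (diag_op k j (snd z)) (snd (fock_field k z))
    = flux j (coef k (fst z)) (coef k (snd z)) / (2 * pi)"
proof -
  define a where "a = coef k (fst z)"
  define b where "b = coef k (snd z)"
  let ?\<alpha> = "fock_mult a b"
  have dot: "u \<bullet> (coupling * v) = Im (cnj u * v) / (2 * pi)" for u v
    by (simp add: coupling_def inner_complex_def field_simps)
  have f: "coef k (fst (fock_field k z)) n = coupling * fock_comult b ?\<alpha> n"
      "coef k (snd (fock_field k z)) n = coupling * fock_comult a ?\<alpha> n" for n
    by (simp_all add: fock_field_def coef_phase_op coef_comult_op coef_mult_op a_def b_def)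
  have S: "summable (\<lambda>n. energy_weight j n * (coef k x n \<bullet> coef k y n))" for x y
    unfolding coord_diag_op_inner[OF j, symmetric]
    by (rule square_summable_inner(2)[OF coord_square_summable coord_square_summable])
  have fl: "(\<lambda>n. energy_weight j n * (Im (cnj (a n) * fock_comult b ?\<alpha> n) + Im (cnj (b n) * fock_comult a ?\<alpha> n))) sums flux j a b"
    unfolding a_def b_def by (intro flux_eq_pairings energy_summable j coef_square_summable)
  have "inner (diag_op k j (fst z)) (fst (fock_field k z)) + inner (diag_op k j (snd z)) (snd (fock_field k z))
    = (\<Sum>n. energy_weight j n * (a n \<bullet> (coupling * fock_comult b ?\<alpha> n)) + energy_weight j n * (b n \<bullet> (coupling * fock_comult a ?\<alpha> n)))"
    unfolding inner_diag_op[OF j] f a_def[symmetric] b_def[symmetric]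
    by (rule suminf_add[OF S[of "fst z" "fst (fock_field k z)", unfolded f(1), folded a_def]
          S[of "snd z" "snd (fock_field k z)", unfolded f(2), folded b_def]])
  also have "\<dots> = (\<Sum>n. energy_weight j n * (Im (cnj (a n) * fock_comult b ?\<alpha> n) + Im (cnj (b n) * fock_comult a ?\<alpha> n)) / (2 * pi))"
    unfolding dot distrib_left add_divide_distrib times_divide_eq_right ..
  also have "\<dots> = flux j a b / (2 * pi)"
    by (rule sums_unique[symmetric]) (rule sums_divide[OF fl])
  finally show ?thesis by (simp add: a_def b_def)
qed

text \<open>Solutions of the equation slowed down by a factor \<open>\<theta>\<close>. The energy estimates are insensitive to this factor, and the
cut-off equations in the existence proof are of this form.\<close>

definition admissible :: "nat \<Rightarrow> ell2 \<times> ell2 \<Rightarrow> (real \<Rightarrow> real) \<Rightarrow> (real \<Rightarrow> ell2 \<times> ell2) \<Rightarrow> bool" where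
  "admissible k z0 \<theta> z \<longleftrightarrow> (\<forall>t. 0 \<le> \<theta> t \<and> \<theta> t \<le> 1) \<and> z 0 = z0 \<and>
     (\<forall>t. (z has_vector_derivative \<theta> t *\<^sub>R fock_field k (z t)) (at t))"

lemma energy_has_derivative:
  assumes j: "j \<le> k" and z: "(z has_vector_derivative \<theta> t *\<^sub>R fock_field k (z t)) (at t)"
  shows "((\<lambda>t. energy k j (z t)) has_real_derivative \<theta> t * flux j (coef k (fst (z t))) (coef k (snd (z t))) / pi) (at t)"
proof -
  have part: "((\<lambda>t. seq_energy j (coef k (x t))) has_real_derivative 2 * inner (diag_op k j (x t)) x') (at t)"
    if x: "(x has_vector_derivative x') (at t)" for x x'
  proof -
    have "((\<lambda>t. inner (diag_op k j (x t)) (x t)) has_vector_derivative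
        (inner (diag_op k j (x t)) x' + inner (diag_op k j x') (x t))) (at t)"
      by (intro bounded_bilinear.has_vector_derivative[OF bounded_bilinear_inner]
          bounded_linear.has_vector_derivative[OF diag_op_linear[OF j]] x)
    moreover have "inner (diag_op k j x') (x t) = inner (diag_op k j (x t)) x'"
      by (rule inner_diag_op_commute[OF j])
    ultimately show ?thesis
      unfolding has_real_derivative_iff_has_vector_derivative inner_diag_op_self[OF j] by simp
  qed
  have "((\<lambda>t. fst (z t)) has_vector_derivative fst (\<theta> t *\<^sub>R fock_field k (z t))) (at t)"
    by (rule bounded_linear.has_vector_derivative[OF bounded_linear_fst z])
  note 1 = part[OF this]
  have "((\<lambda>t. snd (z t)) has_vector_derivative snd (\<theta> t *\<^sub>R fock_field k (z t))) (at t)"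
    by (rule bounded_linear.has_vector_derivative[OF bounded_linear_snd z])
  note 2 = part[OF this]
  have eq: "2 * inner (diag_op k j (fst (z t))) (fst (\<theta> t *\<^sub>R fock_field k (z t))) +
      2 * inner (diag_op k j (snd (z t))) (snd (\<theta> t *\<^sub>R fock_field k (z t)))
      = 2 * \<theta> t * (inner (diag_op k j (fst (z t))) (fst (fock_field k (z t))) + inner (diag_op k j (snd (z t))) (snd (fock_field k (z t))))"
    by (simp add: algebra_simps)
  have "((\<lambda>t. energy k j (z t)) has_real_derivative
      2 * inner (diag_op k j (fst (z t))) (fst (\<theta> t *\<^sub>R fock_field k (z t))) +
      2 * inner (diag_op k j (snd (z t))) (snd (\<theta> t *\<^sub>R fock_field k (z t)))) (at t)"
    unfolding energy_def by (rule DERIV_add[OF 1 2])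
  then show ?thesis unfolding eq energy_pairing_field[OF j] by simp
qed

text \<open>The constant depends on the initial value only, neither on \<open>\<theta>\<close> nor on the solution.\<close>

definition grows :: "nat \<Rightarrow> ell2 \<times> ell2 \<Rightarrow> nat \<Rightarrow> real \<Rightarrow> bool" where
  "grows k z0 j r \<longleftrightarrow> (\<exists>C\<ge>0. \<forall>\<theta> z t. admissible k z0 \<theta> z \<longrightarrow> energy k j (z t) \<le> C * (1 + \<bar>t\<bar>) powr r)"

lemma seq_energy_nonneg: "j \<le> k \<Longrightarrow> 0 \<le> seq_energy j (coef k x)"
  unfolding seq_energy_def
  by (intro suminf_nonneg energy_summable) (auto intro: mult_nonneg_nonneg less_imp_le[OF energy_weight_pos])

lemma energy_nonneg: "j \<le> k \<Longrightarrow> 0 \<le> energy k j z"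
  unfolding energy_def by (intro add_nonneg_nonneg seq_energy_nonneg)

lemma energy_increment:
  assumes j: "j \<le> k" and adm: "admissible k z0 \<theta> z"
    and B: "\<And>s. \<bar>s\<bar> \<le> \<bar>t\<bar> \<Longrightarrow> \<bar>flux j (coef k (fst (z s))) (coef k (snd (z s)))\<bar> \<le> B"
  shows "energy k j (z t) \<le> energy k j z0 + B * \<bar>t\<bar>"
proof -
  let ?f = "\<lambda>s. flux j (coef k (fst (z s))) (coef k (snd (z s)))"
  have "norm (energy k j (z t) - energy k j (z 0)) \<le> B * norm (t - 0)"
  proof (rule field_differentiable_bound[where S = "{-\<bar>t\<bar>..\<bar>t\<bar>}" and f' = "\<lambda>s. \<theta> s * ?f s / pi"])
    fix s assume s: "s \<in> {-\<bar>t\<bar>..\<bar>t\<bar>}"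
    show "((\<lambda>s. energy k j (z s)) has_field_derivative \<theta> s * ?f s / pi) (at s within {-\<bar>t\<bar>..\<bar>t\<bar>})"
      using energy_has_derivative[OF j, of z \<theta> s] adm
      by (auto simp: admissible_def intro: DERIV_subset)
    have "\<bar>\<theta> s\<bar> \<le> 1" using adm by (auto simp: admissible_def)
    moreover have "\<bar>?f s\<bar> \<le> B" using s by (intro B) auto
    moreover have "1 \<le> pi" using pi_gt3 by simp
    ultimately have "\<bar>\<theta> s\<bar> * \<bar>?f s\<bar> / pi \<le> 1 * B / 1"
      by (intro frac_le mult_mono) auto
    then show "norm (\<theta> s * ?f s / pi) \<le> B" by (simp add: abs_mult)
  qed auto
  then show ?thesis using adm by (simp add: admissible_def)
qed

lemma grows_conserved:
  assumes "j \<le> 1" "j \<le> k"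
  shows "grows k z0 j 0"
  unfolding grows_def
proof (intro exI conjI allI impI)
  show "0 \<le> energy k j z0" by (rule energy_nonneg) fact
  fix \<theta> z and t :: real assume adm: "admissible k z0 \<theta> z"
  have "energy k j (z t) \<le> energy k j z0 + 0 * \<bar>t\<bar>"
    by (rule energy_increment[OF assms(2) adm]) (simp add: flux_low[OF assms(1)])
  then show "energy k j (z t) \<le> energy k j z0 * (1 + \<bar>t\<bar>) powr 0"
    using abs_ge_zero[of t] by (simp add: add_nonneg_eq_0_iff)
qed

text \<open>With \<open>E\<^sub>1\<close> conserved the flux is at most a constant times the energy two orders lower, and integration in time
costs one power of \<open>1 + |t|\<close>.\<close>

lemma grows_step:
  assumes j: "j + 2 \<le> k" and g: "grows k z0 (max 1 j) r" and r: "0 \<le> r"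
  shows "grows k z0 (j + 2) (r + 1)"
proof -
  let ?J = "max 1 j"
  have J: "?J \<le> k" "1 \<le> k" using j by auto
  obtain K where K: "K \<ge> 0" and fl: "\<And>a b. weighted_summable (energy_weight ?J) a \<Longrightarrow>
     weighted_summable (energy_weight ?J) b \<Longrightarrow>
     \<bar>flux (j + 2) a b\<bar> \<le> K * (seq_energy ?J a * seq_energy 1 b + seq_energy 1 a * seq_energy ?J b)"
    by (rule flux_bound[of j]) blast
  obtain C where C: "C \<ge> 0" "\<And>\<theta> z t. admissible k z0 \<theta> z \<Longrightarrow> energy k ?J (z t) \<le> C * (1 + \<bar>t\<bar>) powr r"
    using g unfolding grows_def by blast
  obtain D where D: "D \<ge> 0" "\<And>\<theta> z t. admissible k z0 \<theta> z \<Longrightarrow> energy k 1 (z t) \<le> D * (1 + \<bar>t\<bar>) powr 0"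
    using grows_conserved[of 1 k z0] J unfolding grows_def by auto
  let ?E0 = "energy k (j + 2) z0"
  have E0: "0 \<le> ?E0" by (rule energy_nonneg[OF j])
  show ?thesis
    unfolding grows_def
  proof (intro exI[of _ "?E0 + K * (C * D)"] conjI allI impI)
    show "0 \<le> ?E0 + K * (C * D)" using E0 K C D by simp
    fix \<theta> z and t :: real assume adm: "admissible k z0 \<theta> z"
    let ?B = "K * (C * (1 + \<bar>t\<bar>) powr r * D)"
    have "energy k (j + 2) (z t) \<le> ?E0 + ?B * \<bar>t\<bar>"
    proof (rule energy_increment[OF j adm])
      fix s :: real assume s: "\<bar>s\<bar> \<le> \<bar>t\<bar>"
      let ?a = "coef k (fst (z s))" and ?b = "coef k (snd (z s))"
      have "energy k ?J (z s) \<le> C * (1 + \<bar>s\<bar>) powr r" by (rule C(2)[OF adm])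
      also have "\<dots> \<le> C * (1 + \<bar>t\<bar>) powr r"
        using s r C(1) by (intro mult_left_mono powr_mono2) auto
      finally have eJ: "energy k ?J (z s) \<le> C * (1 + \<bar>t\<bar>) powr r" .
      have e1: "energy k 1 (z s) \<le> D" using D(2)[OF adm, of s] abs_ge_zero[of s] by (simp add: add_nonneg_eq_0_iff)
      have "seq_energy ?J ?a * seq_energy 1 ?b + seq_energy 1 ?a * seq_energy ?J ?b \<le> energy k ?J (z s) * energy k 1 (z s)"
        using seq_energy_nonneg[OF J(1), of "fst (z s)"] seq_energy_nonneg[OF J(1), of "snd (z s)"]
          seq_energy_nonneg[OF J(2), of "fst (z s)"] seq_energy_nonneg[OF J(2), of "snd (z s)"]
        unfolding energy_def by (simp add: algebra_simps)
      also have "\<dots> \<le> (C * (1 + \<bar>t\<bar>) powr r) * D"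
        using eJ e1 energy_nonneg[OF J(1)] energy_nonneg[OF J(2)] C by (intro mult_mono) auto
      finally show "\<bar>flux (j + 2) ?a ?b\<bar> \<le> ?B"
        by (rule order_trans[OF fl[OF energy_summable[OF J(1)] energy_summable[OF J(1)]] mult_left_mono[OF _ K]])
    qed
    also have "\<dots> \<le> ?E0 * (1 + \<bar>t\<bar>) powr (r + 1) + ?B * (1 + \<bar>t\<bar>)"
    proof (rule add_mono)
      have "1 \<le> (1 + \<bar>t\<bar>) powr (r + 1)" using r by (intro ge_one_powr_ge_zero) auto
      then show "?E0 \<le> ?E0 * (1 + \<bar>t\<bar>) powr (r + 1)" using E0 mult_left_mono[of 1 "(1 + \<bar>t\<bar>) powr (r + 1)" ?E0] by simp
      show "?B * \<bar>t\<bar> \<le> ?B * (1 + \<bar>t\<bar>)" using K C D by (intro mult_left_mono) auto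
    qed
    also have "\<dots> = (?E0 + K * (C * D)) * (1 + \<bar>t\<bar>) powr (r + 1)"
      by (simp add: powr_add algebra_simps)
    finally show "energy k (j + 2) (z t) \<le> (?E0 + K * (C * D)) * (1 + \<bar>t\<bar>) powr (r + 1)" .
  qed
qed

text \<open>The inequality between arithmetic and geometric means, applied to the weights:
\<open>w\<^sup>2 \<le> (l w + w\<^sup>3 / l) / 2\<close>.\<close>

lemma seq_energy_interpolate:
  assumes k: "3 \<le> k" and l: "l > 0"
  shows "seq_energy 2 (coef k x) \<le> (l * seq_energy 1 (coef k x) + seq_energy 3 (coef k x) / l) / 2"
proof -
  let ?c = "\<lambda>n. (cmod (coef k x n))\<^sup>2"
  have s: "(\<lambda>n. energy_weight j n * ?c n) sums seq_energy j (coef k x)" if "j \<le> k" for j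
    unfolding seq_energy_def by (rule summable_sums[OF energy_summable[OF that]])
  have R: "(\<lambda>n. (l * (energy_weight 1 n * ?c n) + (energy_weight 3 n * ?c n) / l) / 2) sums
    ((l * seq_energy 1 (coef k x) + seq_energy 3 (coef k x) / l) / 2)"
    using k by (intro sums_divide sums_add sums_mult s) auto
  show ?thesis
  proof (rule sums_le[OF _ s R])
    fix n
    let ?w = "2 * real n + 1"
    have "0 \<le> ?w * (l - ?w)\<^sup>2 / l / 2" using l by (intro divide_nonneg_pos mult_nonneg_nonneg) auto
    also have "\<dots> = (l * ?w + ?w ^ 3 / l) / 2 - ?w\<^sup>2"
      using l by (simp add: field_simps power2_eq_square power3_eq_cube)
    finally have "energy_weight 2 n \<le> (l * energy_weight 1 n + energy_weight 3 n / l) / 2"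
      by (simp add: energy_weight_def)
    from mult_right_mono[OF this, of "?c n"]
    show "energy_weight 2 n * ?c n \<le> (l * (energy_weight 1 n * ?c n) + (energy_weight 3 n * ?c n) / l) / 2"
      by (simp add: algebra_simps add_divide_distrib)
  qed (use k in simp)
qed

text \<open>Interpolation between the conserved \<open>E\<^sub>1\<close> and the linearly growing \<open>E\<^sub>3\<close>, with parameter \<open>l = (1+|t|)\<^sup>1\<^sup>/\<^sup>2\<close>.\<close>

lemma grows_two_of_three:
  assumes k: "3 \<le> k"
  shows "grows k z0 2 (1/2)"
proof -
  have g1: "grows k z0 1 0" using k by (intro grows_conserved) auto
  have g3: "grows k z0 3 1" using grows_step[of 1 k z0 0] k g1 by (simp add: numeral_3_eq_3)
  obtain C where C: "C \<ge> 0" "\<And>\<theta> z t. admissible k z0 \<theta> z \<Longrightarrow> energy k 1 (z t) \<le> C * (1 + \<bar>t\<bar>) powr 0"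
    using g1 unfolding grows_def by blast
  obtain D where D: "D \<ge> 0" "\<And>\<theta> z t. admissible k z0 \<theta> z \<Longrightarrow> energy k 3 (z t) \<le> D * (1 + \<bar>t\<bar>) powr 1"
    using g3 unfolding grows_def by blast
  show ?thesis
    unfolding grows_def
  proof (intro exI[of _ "C + D"] conjI allI impI)
    show "0 \<le> C + D" using C D by simp
    fix \<theta> z and t :: real assume adm: "admissible k z0 \<theta> z"
    define l where "l = (1 + \<bar>t\<bar>) powr (1/2)"
    have l: "l > 0" "l * l = 1 + \<bar>t\<bar>" by (auto simp: l_def powr_add[symmetric])
    have "energy k 2 (z t) \<le> (l * energy k 1 (z t) + energy k 3 (z t) / l) / 2"
      using seq_energy_interpolate[OF k l(1), of "fst (z t)"] seq_energy_interpolate[OF k l(1), of "snd (z t)"]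
      unfolding energy_def by (simp add: algebra_simps add_divide_distrib)
    also have "\<dots> \<le> (l * C + (D * (l * l)) / l) / 2"
    proof -
      have "energy k 1 (z t) \<le> C" using C(2)[OF adm, of t] abs_ge_zero[of t] by (simp add: add_nonneg_eq_0_iff)
      moreover have "energy k 3 (z t) \<le> D * (l * l)" using D(2)[OF adm, of t] l by simp
      ultimately show ?thesis using l by (intro divide_right_mono add_mono mult_left_mono) auto
    qed
    also have "\<dots> = (C + D) / 2 * l" using l(1) by (simp add: field_simps)
    also have "\<dots> \<le> (C + D) * l" using C D l by (intro mult_right_mono) auto
    finally show "energy k 2 (z t) \<le> (C + D) * (1 + \<bar>t\<bar>) powr (1/2)" by (simp add: l_def)
  qed
qed

lemma grows_high:
  assumes k: "3 \<le> k" and j: "1 \<le> j" "j \<le> k"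
  shows "grows k z0 j ((real j - 1) / 2)"
  using j
proof (induction j rule: less_induct)
  case (less j)
  consider "j = 1" | "j = 2" | i where "j = i + 2" "1 \<le> i"
    using less.prems by (metis One_nat_def Suc_1 add_2_eq_Suc' le_antisym le_simps(3) not_less_eq_eq nat_le_iff_add add.commute plus_1_eq_Suc Suc_leI le_neq_implies_less)
  then show ?case
  proof cases
    case 1
    then show ?thesis using grows_conserved[of 1 k z0] k by simp
  next
    case 2
    then show ?thesis using grows_two_of_three[OF k] by simp
  next
    case 3
    have "grows k z0 i ((real i - 1) / 2)" using 3 less by simp
    then have "grows k z0 (i + 2) ((real i - 1) / 2 + 1)"
      using 3 less.prems by (intro grows_step) (auto simp: max_def)
    moreover have "(real i - 1) / 2 + 1 = (real j - 1) / 2" using 3 by (simp add: add_divide_distrib diff_divide_distrib)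
    ultimately show ?thesis using 3 by simp
  qed
qed

lemma grows_top: "\<exists>r\<ge>0. grows k z0 k r"
proof -
  consider "k \<le> 1" | "k = 2" | "3 \<le> k" by linarith
  then show ?thesis
  proof cases
    case 1 then show ?thesis using grows_conserved[of k k z0] by auto
  next
    case 2 then show ?thesis using grows_step[of 0 k z0 0] grows_conserved[of 1 k z0] by (auto intro!: exI[of _ 1] simp: numeral_2_eq_2)
  next
    case 3 then show ?thesis using grows_high[OF 3, of k z0] by (intro exI[of _ "(real k - 1) / 2"]) auto
  qed
qed

lemma fock_weight_le_energy_weight: "fock_weight j n \<le> (real j + 2) ^ j * energy_weight j n"
proof -
  have "fock_weight j n \<le> (real j + 2) ^ j * (real n + 1) ^ j" by (rule fock_weight_upper)
  also have "\<dots> \<le> (real j + 2) ^ j * energy_weight j n"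
    unfolding energy_weight_def by (intro mult_left_mono power_mono) auto
  finally show ?thesis .
qed

lemma weighted_sum_le_energy:
  assumes "j \<le> k"
  shows "weighted_sum (fock_weight j) (coef k x) \<le> (real j + 2) ^ j * seq_energy j (coef k x)"
  unfolding seq_energy_def
  by (rule weighted_sum_mono[OF energy_summable[OF assms] less_imp_le[OF fock_weight_pos] fock_weight_le_energy_weight])

lemma norm_le_energy: "(norm x)\<^sup>2 \<le> (real k + 2) ^ k * seq_energy k (coef k x)"
  unfolding norm_eq_coef[of x k] by (rule weighted_sum_le_energy) simp

text \<open>The energy of order \<open>k\<close> dominates the squared norm, and its bound is uniform over the slowed-down
equations; this is the a priori bound required for global existence.\<close>

theorem fock_flow_exists:
  "\<exists>z. z 0 = z0 \<and> (\<forall>t. (z has_vector_derivative fock_field k (z t)) (at t))"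
proof (rule global_solution_of_apriori_bound)
  show "\<exists>L. L-lipschitz_on (cball 0 R) (fock_field k)" for R by (rule fock_field_locally_lipschitz)
  fix T :: real
  obtain r where r: "r \<ge> 0" and "grows k z0 k r" using grows_top[of k z0] by blast
  then obtain C where C: "C \<ge> 0" "\<And>\<theta> z t. admissible k z0 \<theta> z \<Longrightarrow> energy k k (z t) \<le> C * (1 + \<bar>t\<bar>) powr r"
    unfolding grows_def by blast
  show "\<exists>R. \<forall>\<theta> z. (\<forall>t. 0 \<le> \<theta> t \<and> \<theta> t \<le> 1) \<longrightarrow> z 0 = z0 \<longrightarrow>
      (\<forall>t. (z has_vector_derivative \<theta> t *\<^sub>R fock_field k (z t)) (at t)) \<longrightarrow> (\<forall>t. \<bar>t\<bar> \<le> T \<longrightarrow> norm (z t) \<le> R)"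
  proof (intro exI allI impI)
    fix \<theta> :: "real \<Rightarrow> real" and z :: "real \<Rightarrow> ell2 \<times> ell2" and t :: real
    assume "\<forall>t. 0 \<le> \<theta> t \<and> \<theta> t \<le> 1" "z 0 = z0"
      "\<forall>t. (z has_vector_derivative \<theta> t *\<^sub>R fock_field k (z t)) (at t)" and t: "\<bar>t\<bar> \<le> T"
    then have adm: "admissible k z0 \<theta> z" by (simp add: admissible_def)
    have "(norm (z t))\<^sup>2 = (norm (fst (z t)))\<^sup>2 + (norm (snd (z t)))\<^sup>2"
      by (simp add: norm_prod_def)
    also have "\<dots> \<le> (real k + 2) ^ k * energy k k (z t)"
      unfolding energy_def distrib_left by (intro add_mono norm_le_energy)
    also have "\<dots> \<le> (real k + 2) ^ k * (C * (1 + \<bar>t\<bar>) powr r)"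
      by (intro mult_left_mono C(2)[OF adm]) auto
    also have "\<dots> \<le> (real k + 2) ^ k * (C * (1 + T) powr r)"
      using t r C by (intro mult_left_mono powr_mono2) auto
    finally show "norm (z t) \<le> sqrt ((real k + 2) ^ k * (C * (1 + T) powr r))"
      by (rule real_le_rsqrt)
  qed
qed

section \<open>The Fock space and its projection in coefficients\<close>

lemma has_bochner_integral_of_nn:
  fixes f :: "complex \<Rightarrow> real"
  assumes "f \<in> borel_measurable borel" "\<And>z. 0 \<le> f z" "(\<integral>\<^sup>+ z. ennreal (f z) \<partial>lborel) = ennreal x" "0 \<le> x"
  shows "has_bochner_integral lborel f x"
  using assms by (intro has_bochner_integral_nn_integral) auto

lemma fact_pochhammer_shift: "fact (n + j) = fact n * pochhammer (real n + 1) j"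
  by (induction j) (simp_all add: pochhammer_Suc algebra_simps)

lemma nn_integral_fock_moment:
  "(\<integral>\<^sup>+ z. ennreal ((1 + (cmod z)\<^sup>2) ^ k * exp (- (cmod z)\<^sup>2) * cmod z ^ (2 * n)) \<partial>lborel)
    = ennreal (pi * fact n * fock_weight k n)"
proof -
  have e: "ennreal ((1 + (cmod z)\<^sup>2) ^ k * exp (- (cmod z)\<^sup>2) * cmod z ^ (2 * n))
    = (\<Sum>j\<le>k. ennreal (real (k choose j)) * ennreal (cmod z ^ (2 * (n + j)) * exp (- 1 * (cmod z)\<^sup>2)))" for z
  proof -
    have "(1 + (cmod z)\<^sup>2) ^ k = (\<Sum>j\<le>k. real (k choose j) * ((cmod z)\<^sup>2) ^ j)"
      using binomial_ring[of "(cmod z)\<^sup>2" 1 k] by (simp add: add.commute)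
    then have "(1 + (cmod z)\<^sup>2) ^ k * exp (- (cmod z)\<^sup>2) * cmod z ^ (2 * n)
      = (\<Sum>j\<le>k. real (k choose j) * (cmod z ^ (2 * (n + j)) * exp (- 1 * (cmod z)\<^sup>2)))"
      by (simp only: sum_distrib_right) (intro sum.cong refl, simp add: power_mult[symmetric] power_add distrib_left mult_ac)
    then show ?thesis by (simp add: ennreal_mult[symmetric])
  qed
  have "(\<integral>\<^sup>+ z. ennreal ((1 + (cmod z)\<^sup>2) ^ k * exp (- (cmod z)\<^sup>2) * cmod z ^ (2 * n)) \<partial>lborel)
    = (\<Sum>j\<le>k. ennreal (real (k choose j)) * ennreal (pi * fact (n + j)))"
  proof -
    have M: "(\<integral>\<^sup>+ z. ennreal (cmod z ^ (2 * (n + j)) * exp (- 1 * (cmod z)\<^sup>2)) \<partial>lborel) = ennreal (pi * fact (n + j))" for j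
      using nn_integral_gaussian_moment[of 1 "n + j"] by simp
    have "(\<integral>\<^sup>+ z. ennreal (real (k choose j)) * ennreal (cmod z ^ (2 * (n + j)) * exp (- 1 * (cmod z)\<^sup>2)) \<partial>lborel)
      = ennreal (real (k choose j)) * ennreal (pi * fact (n + j))" for j
      unfolding M[symmetric] by (rule nn_integral_cmult) measurable
    then show ?thesis unfolding e by (subst nn_integral_sum) auto
  qed
  also have "\<dots> = ennreal (\<Sum>j\<le>k. real (k choose j) * (pi * fact (n + j)))"
    by (simp add: ennreal_mult[symmetric] del: fact_pochhammer_shift)
  also have "(\<Sum>j\<le>k. real (k choose j) * (pi * fact (n + j))) = pi * fact n * fock_weight k n"
    unfolding fock_weight_def sum_distrib_left fact_pochhammer_shift by (simp add: mult_ac)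
  finally show ?thesis .
qed

definition fock_coeff :: "(nat \<Rightarrow> complex) \<Rightarrow> nat \<Rightarrow> complex" where
  "fock_coeff a n = a n / of_real (sqrt (pi * fact n))"

definition fock_entire :: "(nat \<Rightarrow> complex) \<Rightarrow> complex \<Rightarrow> complex" where
  "fock_entire a z = (\<Sum>n. fock_coeff a n * z ^ n)"

definition fock_fun :: "(nat \<Rightarrow> complex) \<Rightarrow> complex \<Rightarrow> complex" where
  "fock_fun a z = of_real (exp (- (cmod z)\<^sup>2 / 2)) * fock_entire a z"

lemma exp_coefficients_square_summable:
  "summable (\<lambda>n. (cmod (z ^ n * of_real c / of_real (sqrt (pi * fact n))))\<^sup>2)"
proof -
  have "(cmod (z ^ n * of_real c / of_real (sqrt (pi * fact n))))\<^sup>2 = c\<^sup>2 / pi * (inverse (fact n) * ((cmod z)\<^sup>2) ^ n)" for n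
    by (simp add: norm_divide norm_mult norm_power power_divide power_mult_distrib field_simps flip: power_mult)
  then show ?thesis using summable_exp[of "(cmod z)\<^sup>2"] by (simp add: summable_mult)
qed

lemma fock_series_abs_summable:
  assumes "square_summable a"
  shows "summable (\<lambda>n. cmod (fock_coeff a n * z ^ n))"
  using square_summable_inner(1)[OF assms exp_coefficients_square_summable[of z 1]]
  by (simp add: fock_coeff_def norm_divide norm_mult)

lemma fock_entire_sums:
  assumes "square_summable a"
  shows "(\<lambda>n. fock_coeff a n * z ^ n) sums fock_entire a z"
  unfolding fock_entire_def by (rule summable_sums) (rule summable_norm_cancel[OF fock_series_abs_summable[OF assms]])

lemma holomorphic_of_power_series:
  assumes "\<And>z. (\<lambda>n. c n * z ^ n) sums f z"
  shows "f holomorphic_on UNIV"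
proof -
  have "f field_differentiable at z" for z
  proof (rule holomorphic_on_imp_differentiable_at)
    show "f holomorphic_on ball 0 (cmod z + 1)"
      by (rule power_series_holomorphic[where a = c]) (use assms in simp)
  qed auto
  then show ?thesis by (simp add: holomorphic_on_def)
qed

lemma weighted_fock_norm:
  "(cmod (weighted (real k) (\<lambda>z. of_real (exp (- (cmod z)\<^sup>2 / 2)) * f z) z))\<^sup>2
   = (1 + (cmod z)\<^sup>2) ^ k * exp (- (cmod z)\<^sup>2) * (cmod (f z))\<^sup>2"
proof -
  have j: "0 < japanese z" by (simp add: japanese_def add_pos_nonneg)
  have "(japanese z powr real k)\<^sup>2 = ((japanese z)\<^sup>2) ^ k"
    using j by (simp add: powr_realpow power_mult[symmetric] mult.commute)
  also have "(japanese z)\<^sup>2 = 1 + (cmod z)\<^sup>2" by (simp add: japanese_def)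
  finally have 1: "(japanese z powr real k)\<^sup>2 = (1 + (cmod z)\<^sup>2) ^ k" .
  have 2: "(exp (- (cmod z)\<^sup>2 / 2))\<^sup>2 = exp (- (cmod z)\<^sup>2)"
    by (simp add: power2_eq_square exp_add[symmetric])
  show ?thesis
    unfolding weighted_def norm_mult power_mult_distrib norm_of_real power2_abs 1 2 by (simp add: mult.assoc)
qed

lemma weighted_zero: "weighted 0 u = u"
proof -
  have "japanese z \<noteq> 0" for z
    using add_pos_nonneg[of 1 "(cmod z)\<^sup>2"] by (simp add: japanese_def)
  then show ?thesis by (simp add: weighted_def)
qed

text \<open>Because the sum is allowed to be infinite, this both computes the norm and shows that membership in
\<open>L2E k\<close> is summability of the weighted coefficients.\<close>

lemma nn_integral_weighted_fock:
  assumes f: "\<And>z. (\<lambda>n. fock_coeff a n * z ^ n) sums f z"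
  shows "(\<integral>\<^sup>+ z. ennreal ((cmod (weighted (real k) (\<lambda>z. of_real (exp (- (cmod z)\<^sup>2 / 2)) * f z) z))\<^sup>2) \<partial>lborel)
    = (\<Sum>n. ennreal (fock_weight k n * (cmod (a n))\<^sup>2))"
proof -
  let ?W = "\<lambda>z. (1 + (cmod z)\<^sup>2) ^ k * exp (- (cmod z)\<^sup>2)"
  have "(\<integral>\<^sup>+ z. ennreal (?W z * (cmod (f z))\<^sup>2) \<partial>lborel)
    = (\<Sum>n. ennreal ((cmod (fock_coeff a n))\<^sup>2) * (\<integral>\<^sup>+ z. ennreal (?W z * cmod z ^ (2 * n)) \<partial>lborel))"
    by (rule radial_parseval[OF f]) (auto intro!: continuous_intros simp: norm_mult)
  also have "\<dots> = (\<Sum>n. ennreal (fock_weight k n * (cmod (a n))\<^sup>2))"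
  proof (rule suminf_cong)
    fix n
    have "(cmod (fock_coeff a n))\<^sup>2 * (pi * fact n * fock_weight k n) = fock_weight k n * (cmod (a n))\<^sup>2"
      by (simp add: fock_coeff_def norm_divide power_divide)
    then show "ennreal ((cmod (fock_coeff a n))\<^sup>2) * (\<integral>\<^sup>+ z. ennreal (?W z * cmod z ^ (2 * n)) \<partial>lborel)
      = ennreal (fock_weight k n * (cmod (a n))\<^sup>2)"
      unfolding nn_integral_fock_moment
      using fock_weight_pos[of k n] by (simp add: ennreal_mult[symmetric] less_imp_le)
  qed
  finally show ?thesis unfolding weighted_fock_norm .
qed

lemma weighted_fock_measurable:
  assumes "f holomorphic_on UNIV"
  shows "weighted (real k) (\<lambda>z. of_real (exp (- (cmod z)\<^sup>2 / 2)) * f z) \<in> borel_measurable lborel"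
proof -
  have "continuous_on UNIV f" using assms by (rule holomorphic_on_imp_continuous_on)
  then have "continuous_on UNIV (weighted (real k) (\<lambda>z. of_real (exp (- (cmod z)\<^sup>2 / 2)) * f z))"
    unfolding weighted_def japanese_def
    by (intro continuous_intros) (auto simp: add_pos_nonneg add_nonneg_eq_0_iff)
  then show ?thesis by (simp add: borel_measurable_continuous_onI)
qed

lemma fock_fun_weighted:
  assumes "weighted_summable (fock_weight k) a"
  shows "square_integrable (weighted (real k) (fock_fun a))"
    and "L2E_norm (real k) (fock_fun a) = sqrt (weighted_sum (fock_weight k) a)"
proof -
  have a: "square_summable a"
    using weighted_summable_mono[OF assms, of "\<lambda>_. 1" 1] fock_weight_ge_1[of k] by simp
  note s = fock_entire_sums[OF a]
  have nn: "0 \<le> fock_weight k n * (cmod (a n))\<^sup>2" for n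
    using fock_weight_pos[of k n] by simp
  have m: "weighted (real k) (fock_fun a) \<in> borel_measurable lborel"
    unfolding fock_fun_def[abs_def] by (rule weighted_fock_measurable[OF holomorphic_of_power_series[OF s]])
  have h: "has_bochner_integral lborel (\<lambda>z. (cmod (weighted (real k) (fock_fun a) z))\<^sup>2) (weighted_sum (fock_weight k) a)"
  proof (rule has_bochner_integral_of_nn)
    show "(\<integral>\<^sup>+ z. ennreal ((cmod (weighted (real k) (fock_fun a) z))\<^sup>2) \<partial>lborel) = ennreal (weighted_sum (fock_weight k) a)"
      unfolding fock_fun_def[abs_def] nn_integral_weighted_fock[OF s] using assms nn by (simp add: suminf_ennreal2)
    show "(\<lambda>z. (cmod (weighted (real k) (fock_fun a) z))\<^sup>2) \<in> borel_measurable borel" using m by simp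
  qed (use assms nn in \<open>auto intro: suminf_nonneg\<close>)
  show "square_integrable (weighted (real k) (fock_fun a))"
    using m h by (simp add: square_integrable_def has_bochner_integral_iff)
  show "L2E_norm (real k) (fock_fun a) = sqrt (weighted_sum (fock_weight k) a)"
    using h by (simp add: L2E_norm_def L2_norm_def has_bochner_integral_iff)
qed

lemma fock_fun_in_L2E:
  assumes "weighted_summable (fock_weight k) a"
  shows "fock_fun a \<in> L2E (real k)"
proof -
  have a: "square_summable a"
    using weighted_summable_mono[OF assms, of "\<lambda>_. 1" 1] fock_weight_ge_1[of k] by simp
  have "square_integrable (fock_fun a)"
    using fock_fun_weighted(1)[of 0 a] a by (simp add: weighted_zero fock_weight_def)
  moreover have "fock_entire a holomorphic_on UNIV"
    by (rule holomorphic_of_power_series[OF fock_entire_sums[OF a]])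
  ultimately have "fock_fun a \<in> bargmann_fock"
    unfolding bargmann_fock_def fock_fun_def[abs_def] by blast
  then show ?thesis using fock_fun_weighted(1)[OF assms] by (simp add: L2E_def)
qed

lemma L2E_obtain_coefficients:
  assumes u: "u \<in> L2E (real k)"
  obtains a where "weighted_summable (fock_weight k) a" "u = fock_fun a"
proof -
  obtain f where f: "f holomorphic_on UNIV" and uf: "u = (\<lambda>z. of_real (exp (- (cmod z)\<^sup>2 / 2)) * f z)"
    and sq: "square_integrable (weighted (real k) u)"
    using u by (auto simp: L2E_def bargmann_fock_def)
  define c where "c n = (deriv ^^ n) f 0 / fact n" for n
  define a where "a n = c n * of_real (sqrt (pi * fact n))" for n
  have ca: "fock_coeff a = c" by (auto simp: fock_coeff_def a_def fun_eq_iff)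
  have s: "(\<lambda>n. fock_coeff a n * z ^ n) sums f z" for z
  proof -
    have "f holomorphic_on ball 0 (cmod z + 1)" using f by (rule holomorphic_on_subset) auto
    from holomorphic_power_series[OF this, of z] show ?thesis by (simp add: ca c_def)
  qed
  have nn: "0 \<le> fock_weight k n * (cmod (a n))\<^sup>2" for n
    using fock_weight_pos[of k n] by simp
  have "(\<integral>\<^sup>+ z. ennreal ((cmod (weighted (real k) u z))\<^sup>2) \<partial>lborel) < \<infinity>"
    using sq by (auto simp: square_integrable_def integrable_iff_bounded)
  then have "(\<Sum>n. ennreal (fock_weight k n * (cmod (a n))\<^sup>2)) \<noteq> \<infinity>"
    unfolding uf nn_integral_weighted_fock[OF s] by simp
  then have sm: "weighted_summable (fock_weight k) a"
    using nn by (intro summable_suminf_not_top) auto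
  have "fock_entire a = f" using s by (auto simp: fock_entire_def sums_iff fun_eq_iff)
  then have "u = fock_fun a" by (auto simp: fock_fun_def uf)
  with sm that show thesis by blast
qed

text \<open>The coefficient of \<open>z\<^sup>S\<close> in a product of two normalised series is this factor times \<open>fock_mult\<close>.\<close>

definition mult_norming :: "nat \<Rightarrow> real" where
  "mult_norming S = sqrt (2 ^ S / fact S) / pi"

lemma fock_entire_product:
  assumes a: "square_summable a" and b: "square_summable b"
  shows "(\<lambda>S. of_real (mult_norming S) * fock_mult a b S * z ^ S) sums (fock_entire a z * fock_entire b z)"
proof -
  have "(\<lambda>S. \<Sum>n\<le>S. (fock_coeff a n * z ^ n) * (fock_coeff b (S - n) * z ^ (S - n))) sums (fock_entire a z * fock_entire b z)"
    unfolding fock_entire_def by (intro Cauchy_product_sums fock_series_abs_summable a b)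
  moreover have "(\<Sum>n\<le>S. (fock_coeff a n * z ^ n) * (fock_coeff b (S - n) * z ^ (S - n)))
     = of_real (mult_norming S) * fock_mult a b S * z ^ S" for S
  proof -
    have "(fock_coeff a n * z ^ n) * (fock_coeff b (S - n) * z ^ (S - n))
      = of_real (mult_norming S) * (of_real (binom_weight S n) * (a n * b (S - n))) * z ^ S" if n: "n \<le> S" for n
    proof -
      have "mult_norming S * binom_weight S n = 1 / (sqrt (pi * fact n) * sqrt (pi * fact (S - n)))"
      proof -
        have "mult_norming S * binom_weight S n = sqrt (2 ^ S / fact S * (real (S choose n) / 2 ^ S)) / pi"
          by (simp only: mult_norming_def binom_weight_def real_sqrt_mult[of "2 ^ S / fact S"] times_divide_eq_left[of _ pi])
        also have "2 ^ S / fact S * (real (S choose n) / 2 ^ S) = 1 / (fact n * fact (S - n))"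
          using binomial_fact[OF n, where 'a = real] by simp
        also have "sqrt (1 / (fact n * fact (S - n))) / pi = 1 / (sqrt (pi * fact n) * sqrt (pi * fact (S - n)))"
          by (simp add: real_sqrt_mult real_sqrt_divide)
        finally show ?thesis .
      qed
      then have "of_real (mult_norming S) * of_real (binom_weight S n)
        = 1 / (of_real (sqrt (pi * fact n)) * of_real (sqrt (pi * fact (S - n))) :: complex)"
        by (metis of_real_1 of_real_divide of_real_mult)
      moreover have "z ^ S = z ^ n * z ^ (S - n)" using n by (simp add: power_add[symmetric])
      ultimately show ?thesis
        by (simp add: fock_coeff_def mult.assoc[symmetric]) 
    qed
    then show ?thesis by (simp add: fock_mult_def sum_distrib_left sum_distrib_right)
  qed
  ultimately show ?thesis by simp
qed

lemma quartic_gaussian_norm: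
  assumes F: "\<And>w. (\<lambda>S. of_real (mult_norming S) * \<gamma> S * w ^ S) sums F w" and \<gamma>: "square_summable \<gamma>"
  shows "has_bochner_integral lborel (\<lambda>w. exp (- 2 * (cmod w)\<^sup>2) * (cmod (F w))\<^sup>2) ((square_sum \<gamma>) / (2 * pi))"
proof (rule has_bochner_integral_of_nn)
  have "continuous_on UNIV F"
    by (rule holomorphic_on_imp_continuous_on) (rule holomorphic_of_power_series[OF F])
  then show "(\<lambda>w. exp (- 2 * (cmod w)\<^sup>2) * (cmod (F w))\<^sup>2) \<in> borel_measurable borel"
    by (intro borel_measurable_continuous_onI continuous_intros)
  show "0 \<le> (square_sum \<gamma>) / (2 * pi)" using \<gamma> by (simp add: suminf_nonneg)
  have "(\<integral>\<^sup>+ w. ennreal (exp (- 2 * (cmod w)\<^sup>2) * (cmod (F w))\<^sup>2) \<partial>lborel)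
    = (\<Sum>S. ennreal ((cmod (of_real (mult_norming S) * \<gamma> S))\<^sup>2) * (\<integral>\<^sup>+ w. ennreal (exp (- 2 * (cmod w)\<^sup>2) * cmod w ^ (2 * S)) \<partial>lborel))"
    by (rule radial_parseval[OF F]) (auto intro!: continuous_intros simp: norm_mult)
  also have "\<dots> = (\<Sum>S. ennreal ((cmod (\<gamma> S))\<^sup>2 / (2 * pi)))"
  proof (rule suminf_cong)
    fix S
    have m: "(\<integral>\<^sup>+ w. ennreal (exp (- 2 * (cmod w)\<^sup>2) * cmod w ^ (2 * S)) \<partial>lborel) = ennreal (pi * fact S / 2 ^ Suc S)"
      using nn_integral_gaussian_moment[of 2 S] by (simp add: mult.commute)
    have "(mult_norming S)\<^sup>2 = 2 ^ S / fact S / pi\<^sup>2"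
      by (simp add: mult_norming_def power_divide)
    then have "(mult_norming S)\<^sup>2 * (cmod (\<gamma> S))\<^sup>2 * (pi * fact S / 2 ^ Suc S) = (cmod (\<gamma> S))\<^sup>2 / (2 * pi)"
      by (simp add: power2_eq_square)
    then show "ennreal ((cmod (of_real (mult_norming S) * \<gamma> S))\<^sup>2) * (\<integral>\<^sup>+ w. ennreal (exp (- 2 * (cmod w)\<^sup>2) * cmod w ^ (2 * S)) \<partial>lborel)
      = ennreal ((cmod (\<gamma> S))\<^sup>2 / (2 * pi))"
      unfolding m by (simp add: ennreal_mult[symmetric] norm_mult power_mult_distrib del: power_Suc)
  qed
  also have "\<dots> = ennreal ((square_sum \<gamma>) / (2 * pi))"
    using \<gamma> by (subst suminf_ennreal2) (auto simp: suminf_divide intro: summable_divide)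
  finally show "(\<integral>\<^sup>+ w. ennreal (exp (- 2 * (cmod w)\<^sup>2) * (cmod (F w))\<^sup>2) \<partial>lborel) = ennreal ((square_sum \<gamma>) / (2 * pi))" .
qed auto

lemma polarization: "4 * (x * cnj y) = of_real ((cmod (x + y))\<^sup>2) - of_real ((cmod (x - y))\<^sup>2)
    + \<i> * of_real ((cmod (x + \<i> * y))\<^sup>2) - \<i> * of_real ((cmod (x - \<i> * y))\<^sup>2)" for x y :: complex
  unfolding complex_norm_square by (simp add: algebra_simps)

text \<open>Polarisation of the norm identity.\<close>

lemma quartic_gaussian_pairing:
  assumes F: "\<And>w. (\<lambda>S. of_real (mult_norming S) * \<alpha> S * w ^ S) sums F w" and \<alpha>: "square_summable \<alpha>"
    and G: "\<And>w. (\<lambda>S. of_real (mult_norming S) * \<beta> S * w ^ S) sums G w" and \<beta>: "square_summable \<beta>"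
  shows "(\<integral>w. of_real (exp (- 2 * (cmod w)\<^sup>2)) * (F w * cnj (G w)) \<partial>lborel) = (\<Sum>S. \<alpha> S * cnj (\<beta> S)) / of_real (2 * pi)"
proof -
  let ?N = "\<lambda>c. (\<Sum>S. (cmod (\<alpha> S + c * \<beta> S))\<^sup>2)" and ?e = "\<lambda>w. exp (- 2 * (cmod w)\<^sup>2)"
  have c: "summable (\<lambda>S. (cmod (\<alpha> S + c * \<beta> S))\<^sup>2)" for c
  proof (rule square_summable_add[OF \<alpha>])
    show "summable (\<lambda>n. (cmod (c * \<beta> n))\<^sup>2)"
      using summable_mult[OF \<beta>, of "(cmod c)\<^sup>2"] by (simp add: norm_mult power_mult_distrib)
  qed
  have FG: "(\<lambda>S. of_real (mult_norming S) * (\<alpha> S + c * \<beta> S) * w ^ S) sums (F w + c * G w)" for c w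
    using sums_add[OF F[of w] sums_mult[OF G[of w], of c]] by (simp add: algebra_simps)
  have N: "has_bochner_integral lborel (\<lambda>w. complex_of_real (?e w * (cmod (F w + c * G w))\<^sup>2)) (of_real (?N c / (2 * pi)))" for c
    by (rule has_bochner_integral_of_real) (rule quartic_gaussian_norm[OF FG c])
  have pol: "has_bochner_integral lborel (\<lambda>w.
      of_real (?e w * (cmod (F w + 1 * G w))\<^sup>2) - of_real (?e w * (cmod (F w + (-1) * G w))\<^sup>2)
      + \<i> * of_real (?e w * (cmod (F w + \<i> * G w))\<^sup>2) - \<i> * of_real (?e w * (cmod (F w + (-\<i>) * G w))\<^sup>2))
    (of_real (?N 1 / (2 * pi)) - of_real (?N (-1) / (2 * pi)) + \<i> * of_real (?N \<i> / (2 * pi)) - \<i> * of_real (?N (-\<i>) / (2 * pi)))"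
    by (intro has_bochner_integral_diff has_bochner_integral_add has_bochner_integral_mult_right N)
  have 1: "of_real (?e w * (cmod (F w + 1 * G w))\<^sup>2) - of_real (?e w * (cmod (F w + (-1) * G w))\<^sup>2)
      + \<i> * of_real (?e w * (cmod (F w + \<i> * G w))\<^sup>2) - \<i> * of_real (?e w * (cmod (F w + (-\<i>) * G w))\<^sup>2)
      = 4 * (of_real (?e w) * (F w * cnj (G w)))" for w
  proof -
    have "4 * (of_real (?e w) * (F w * cnj (G w))) = of_real (?e w) * (4 * (F w * cnj (G w)))" by simp
    then show ?thesis unfolding polarization by (simp add: algebra_simps)
  qed
  have cs: "(\<lambda>S. complex_of_real ((cmod (\<alpha> S + c * \<beta> S))\<^sup>2)) sums of_real (?N c)" for c
    by (rule sums_of_real) (rule summable_sums[OF c])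
  have "(\<lambda>S. of_real ((cmod (\<alpha> S + 1 * \<beta> S))\<^sup>2) - of_real ((cmod (\<alpha> S + (-1) * \<beta> S))\<^sup>2)
      + \<i> * of_real ((cmod (\<alpha> S + \<i> * \<beta> S))\<^sup>2) - \<i> * of_real ((cmod (\<alpha> S + (-\<i>) * \<beta> S))\<^sup>2))
      sums (of_real (?N 1) - of_real (?N (-1)) + \<i> * of_real (?N \<i>) - \<i> * of_real (?N (-\<i>)))"
    by (intro sums_diff sums_add sums_mult cs)
  moreover have "of_real ((cmod (\<alpha> S + 1 * \<beta> S))\<^sup>2) - of_real ((cmod (\<alpha> S + (-1) * \<beta> S))\<^sup>2)
      + \<i> * of_real ((cmod (\<alpha> S + \<i> * \<beta> S))\<^sup>2) - \<i> * of_real ((cmod (\<alpha> S + (-\<i>) * \<beta> S))\<^sup>2) = 4 * (\<alpha> S * cnj (\<beta> S))" for S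
    unfolding polarization by simp
  ultimately have 4: "(\<lambda>S. 4 * (\<alpha> S * cnj (\<beta> S))) sums (of_real (?N 1) - of_real (?N (-1)) + \<i> * of_real (?N \<i>) - \<i> * of_real (?N (-\<i>)))"
    by (simp only:)
  have 2: "X = 4 * (\<Sum>S. x S)" if "(\<lambda>S. 4 * x S) sums X" for x :: "nat \<Rightarrow> complex" and X
    using sums_mult[OF that, of "1/4"] by (auto simp: sums_iff)
  have "(\<integral>w. 4 * (of_real (?e w) * (F w * cnj (G w))) \<partial>lborel)
     = of_real (?N 1 / (2 * pi)) - of_real (?N (-1) / (2 * pi)) + \<i> * of_real (?N \<i> / (2 * pi)) - \<i> * of_real (?N (-\<i>) / (2 * pi))"
    using has_bochner_integral_integral_eq[OF pol] unfolding 1 .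
  also have "\<dots> = (of_real (?N 1) - of_real (?N (-1)) + \<i> * of_real (?N \<i>) - \<i> * of_real (?N (-\<i>))) / of_real (2 * pi)"
    by (simp only: of_real_divide diff_divide_distrib add_divide_distrib times_divide_eq_right)
  also have "\<dots> = 4 * ((\<Sum>S. \<alpha> S * cnj (\<beta> S)) / of_real (2 * pi))"
    unfolding 2[OF 4] times_divide_eq_right ..
  finally have "(4::complex) = 0 \<or> (\<integral>w. of_real (?e w) * (F w * cnj (G w)) \<partial>lborel) = (\<Sum>S. \<alpha> S * cnj (\<beta> S)) / of_real (2 * pi)"
    unfolding integral_mult_right_zero mult_cancel_left .
  then show ?thesis by (rule disjE) (simp, assumption)
qed

lemma fock_mult_square_summable:
  assumes "square_summable a" "square_summable b"
  shows "square_summable (fock_mult a b)"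
  using fock_mult_weighted(1)[of "\<lambda>_. 1" 1 a b] assms by simp

text \<open>Apart from the prefactor \<open>exp (-|z|\<^sup>2/2) / \<pi>\<close>, the projection integral is the inner product, for the weight
\<open>exp (-2 |w|\<^sup>2)\<close>, of \<open>f g\<close> with \<open>exp (w cnj z) g\<close>, where \<open>f\<close>, \<open>g\<close> are the entire parts of the two functions. Both are products
of functions in the Fock space, since \<open>exp (w cnj z)\<close> has square-summable coefficients \<open>e\<^sub>n\<close>. The pairing is therefore a
sum over \<open>S\<close> of products of \<open>fock_mult\<close>, and adjointness turns it into a power series in \<open>z\<close>.\<close>

theorem fock_proj_cubic:
  assumes a: "square_summable a" and b: "square_summable b"
  shows "fock_proj (\<lambda>w. of_real ((cmod (fock_fun b w))\<^sup>2) * fock_fun a w) z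
    = fock_fun (fock_comult b (fock_mult a b)) z / of_real (2 * pi)"
proof -
  \<comment> \<open>The normalised coefficients of \<open>w \<mapsto> exp (w cnj z)\<close>.\<close>
  define e where "e n = cnj z ^ n * of_real pi / of_real (sqrt (pi * fact n))" for n
  have e: "square_summable e"
    unfolding e_def by (rule exp_coefficients_square_summable)
  have exp_entire: "fock_entire e w = exp (w * cnj z)" for w
  proof -
    have "fock_coeff e n * w ^ n = (w * cnj z) ^ n /\<^sub>R fact n" for n
    proof -
      have "complex_of_real (sqrt (pi * fact n)) * of_real (sqrt (pi * fact n)) = of_real (pi * fact n)"
        by (simp only: of_real_mult[symmetric]) simp
      then show ?thesis
        by (simp add: fock_coeff_def e_def power_mult_distrib scaleR_conv_of_real field_simps)
    qed
    then show ?thesis unfolding fock_entire_def exp_def by simp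
  qed
  let ?T = "fock_comult b (fock_mult a b)"
  have \<alpha>: "square_summable (fock_mult a b)" by (rule fock_mult_square_summable[OF a b])
  have T: "square_summable ?T"
    using fock_comult_weighted(1)[of "\<lambda>_. 1" b "fock_mult a b"] b \<alpha> by simp
  have integrand: "exp (cnj w * z - of_real ((cmod w)\<^sup>2 / 2)) * (of_real ((cmod (fock_fun b w))\<^sup>2) * fock_fun a w)
     = of_real (exp (- 2 * (cmod w)\<^sup>2)) * ((fock_entire a w * fock_entire b w) * cnj (fock_entire e w * fock_entire b w))" for w
  proof -
    define r where "r = (cmod w)\<^sup>2"
    have 1: "complex_of_real ((cmod (fock_fun b w))\<^sup>2) = of_real (exp (- r)) * (fock_entire b w * cnj (fock_entire b w))"
    proof -
      have "(cmod (fock_fun b w))\<^sup>2 = exp (- r) * (cmod (fock_entire b w))\<^sup>2"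
        by (simp add: fock_fun_def norm_mult power_mult_distrib r_def power2_eq_square[of "exp _"] exp_add[symmetric])
      then show ?thesis by (simp only: of_real_mult complex_norm_square)
    qed
    have 2: "cnj (fock_entire e w) = exp (cnj w * z)" by (simp add: exp_entire exp_cnj)
    have 3: "exp (cnj w * z - of_real (r / 2)) = exp (cnj w * z) * of_real (exp (- r / 2))"
    proof -
      have "complex_of_real (exp (- r / 2)) = exp (- of_real (r / 2))"
        by (simp add: exp_of_real[symmetric])
      then show ?thesis by (simp only: exp_add[symmetric] add_uminus_conv_diff)
    qed
    have 4: "exp (- r / 2) * exp (- r) * exp (- r / 2) = exp (- 2 * r)"
      by (simp add: exp_add[symmetric])
    have 5: "complex_of_real (exp (- r / 2)) * of_real (exp (- r)) * of_real (exp (- r / 2)) = of_real (exp (- 2 * r))"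
      by (simp only: of_real_mult[symmetric] 4)
    show ?thesis
      unfolding r_def[symmetric] 1 complex_cnj_mult 2 3 5[symmetric] fock_fun_def[of a w] by (simp only: r_def[symmetric] mult_ac)
  qed
  have "(\<integral>w. exp (cnj w * z - of_real ((cmod w)\<^sup>2 / 2)) * (of_real ((cmod (fock_fun b w))\<^sup>2) * fock_fun a w) \<partial>lborel)
    = (\<Sum>S. fock_mult a b S * cnj (fock_mult e b S)) / of_real (2 * pi)"
    unfolding integrand
    by (rule quartic_gaussian_pairing) (intro fock_entire_product fock_mult_square_summable a b e)+
  also have "(\<Sum>S. fock_mult a b S * cnj (fock_mult e b S)) = (\<Sum>n. cnj (e n) * ?T n)"
    using fock_comult_pairing(1)[of "\<lambda>_. 1" e b "fock_mult a b"] e b \<alpha>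
    by (simp add: sums_iff fock_mult_def[of e b])
  also have "(\<Sum>n. cnj (e n) * ?T n) = of_real pi * fock_entire ?T z"
  proof -
    have "cnj (e n) * ?T n = of_real pi * (fock_coeff ?T n * z ^ n)" for n
      by (simp add: e_def fock_coeff_def)
    moreover have "(\<Sum>n. of_real pi * (fock_coeff ?T n * z ^ n)) = of_real pi * fock_entire ?T z"
      using sums_mult[OF fock_entire_sums[OF T], of "of_real pi" z] by (simp add: sums_iff)
    ultimately show ?thesis by simp
  qed
  finally have I: "(\<integral>w. exp (cnj w * z - of_real ((cmod w)\<^sup>2 / 2)) * (of_real ((cmod (fock_fun b w))\<^sup>2) * fock_fun a w) \<partial>lborel)
    = of_real pi * fock_entire ?T z / of_real (2 * pi)" .
  show ?thesis unfolding fock_proj_def I fock_fun_def[of ?T z] by simp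
qed

section \<open>Solutions of the system\<close>

lemma fock_fun_add:
  assumes "square_summable a" "square_summable b"
  shows "fock_fun (\<lambda>n. c * a n + d * b n) z = c * fock_fun a z + d * fock_fun b z"
proof -
  have "(\<lambda>n. c * (fock_coeff a n * z ^ n) + d * (fock_coeff b n * z ^ n)) sums (c * fock_entire a z + d * fock_entire b z)"
    by (intro sums_add sums_mult fock_entire_sums assms)
  moreover have "(\<lambda>n. c * (fock_coeff a n * z ^ n) + d * (fock_coeff b n * z ^ n)) = (\<lambda>n. fock_coeff (\<lambda>n. c * a n + d * b n) n * z ^ n)"
    by (rule ext) (simp add: fock_coeff_def add_divide_distrib distrib_right mult.assoc)
  ultimately have "(\<lambda>n. fock_coeff (\<lambda>n. c * a n + d * b n) n * z ^ n) sums (c * fock_entire a z + d * fock_entire b z)"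
    by (simp only:)
  then have "fock_entire (\<lambda>n. c * a n + d * b n) z = c * fock_entire a z + d * fock_entire b z"
    unfolding fock_entire_def[of "\<lambda>n. c * a n + d * b n"] by (rule sums_unique[symmetric])
  then show ?thesis unfolding fock_fun_def by (simp add: algebra_simps)
qed

text \<open>A linear isometry of \<open>ell2\<close> onto \<open>L2E k\<close>.\<close>

definition fock_map :: "nat \<Rightarrow> ell2 \<Rightarrow> complex \<Rightarrow> complex" where
  "fock_map k x = fock_fun (coef k x)"

lemma fock_map_in_L2E: "fock_map k x \<in> L2E (real k)"
  unfolding fock_map_def by (rule fock_fun_in_L2E[OF coef_summable])

lemma L2E_norm_fock_map: "L2E_norm (real k) (fock_map k x) = norm x"
  unfolding fock_map_def fock_fun_weighted(2)[OF coef_summable] norm_eq_coef[of x k, symmetric] by simp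

lemma fock_map_surj:
  assumes "u \<in> L2E (real k)"
  obtains x where "u = fock_map k x"
proof -
  obtain a where a: "weighted_summable (fock_weight k) a" "u = fock_fun a"
    using L2E_obtain_coefficients[OF assms] by blast
  then have "u = fock_map k (of_coef k a)" by (simp add: fock_map_def coef_of_coef)
  then show thesis by (rule that)
qed

lemma fock_map_diff: "fock_map k (x - y) z = fock_map k x z - fock_map k y z"
proof -
  have "coef k (x - y) = (\<lambda>n. 1 * coef k x n + (-1) * coef k y n)" by (auto simp: fun_eq_iff)
  then show ?thesis
    unfolding fock_map_def using fock_fun_add[OF coef_square_summable coef_square_summable, of 1 k x "-1" k y z] by simp
qed

lemma fock_map_scaleR: "fock_map k (r *\<^sub>R x) z = of_real r * fock_map k x z"
proof -
  have "coef k (r *\<^sub>R x) = (\<lambda>n. of_real r * coef k x n + 0 * coef k x n)" by (auto simp: fun_eq_iff scaleR_conv_of_real)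
  then show ?thesis
    unfolding fock_map_def using fock_fun_add[OF coef_square_summable coef_square_summable, of "of_real r" k x 0 k x z] by simp
qed

lemma fock_map_inject:
  assumes "fock_map k x = fock_map k y"
  shows "x = y"
proof -
  have "fock_map k (x - y) = fock_map k (0 *\<^sub>R x)"
    unfolding fun_eq_iff fock_map_diff fock_map_scaleR assms by simp
  from arg_cong[OF this, of "L2E_norm (real k)"] have "norm (x - y) = norm (0 *\<^sub>R x)"
    unfolding L2E_norm_fock_map .
  then show ?thesis by simp
qed

lemma has_L2E_derivative_fock_map:
  "has_L2E_derivative (real k) (\<lambda>t. fock_map k (x t)) (fock_map k x') t \<longleftrightarrow> (x has_vector_derivative x') (at t)"
proof -
  have "(\<lambda>z. (fock_map k (x (t + h)) z - fock_map k (x t) z) / of_real h - fock_map k x' z)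
    = fock_map k ((x (t + h) - x t) /\<^sub>R h - x')" for h
    by (rule ext) (simp only: fock_map_diff fock_map_scaleR of_real_inverse divide_inverse mult.commute)
  then have "has_L2E_derivative (real k) (\<lambda>t. fock_map k (x t)) (fock_map k x') t
    \<longleftrightarrow> ((\<lambda>h. norm ((x (t + h) - x t) /\<^sub>R h - x')) \<longlongrightarrow> 0) (at 0)"
    by (simp add: has_L2E_derivative_def fock_map_in_L2E L2E_norm_fock_map)
  also have "\<dots> \<longleftrightarrow> ((\<lambda>h. norm (x (t + h) - x t - h *\<^sub>R x') / norm h) \<longlongrightarrow> 0) (at 0)"
  proof (rule filterlim_cong[OF refl refl])
    have "norm ((x (t + h) - x t) /\<^sub>R h - x') = norm (x (t + h) - x t - h *\<^sub>R x') / norm h" if "h \<noteq> 0" for h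
    proof -
      have "x (t + h) - x t - h *\<^sub>R x' = h *\<^sub>R ((x (t + h) - x t) /\<^sub>R h - x')"
        using that by (simp add: scaleR_diff_right)
      then show ?thesis using that by simp
    qed
    then show "\<forall>\<^sub>F h in at 0. norm ((x (t + h) - x t) /\<^sub>R h - x') = norm (x (t + h) - x t - h *\<^sub>R x') / norm h"
      by (auto simp: eventually_at intro!: exI[of _ 1])
  qed
  also have "\<dots> \<longleftrightarrow> (x has_vector_derivative x') (at t)"
    unfolding has_vector_derivative_def has_derivative_at by (simp add: bounded_linear_scaleR_left)
  finally show ?thesis .
qed

lemma fock_map_phase_comult:
  "\<i> * fock_map k (phase_op (comult_op k y (mult_op k x y))) z
   = fock_proj (\<lambda>w. of_real ((cmod (fock_map k y w))\<^sup>2) * fock_map k x w) z"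
proof -
  let ?T = "fock_comult (coef k y) (fock_mult (coef k x) (coef k y))"
  have T: "square_summable ?T"
    using coef_square_summable[of k "comult_op k y (mult_op k x y)"] by (simp add: coef_comult_op coef_mult_op)
  have "coef k (phase_op (comult_op k y (mult_op k x y))) = (\<lambda>n. coupling * ?T n + 0 * ?T n)"
    by (auto simp: fun_eq_iff coef_phase_op coef_comult_op coef_mult_op)
  then have "fock_map k (phase_op (comult_op k y (mult_op k x y))) z = coupling * fock_fun ?T z"
    unfolding fock_map_def using fock_fun_add[OF T T, of coupling 0 z] by simp
  then show ?thesis
    unfolding fock_map_def fock_proj_cubic[OF coef_square_summable coef_square_summable]
    by (simp add: coupling_def)
qed

text \<open>Transport of the whole initial value problem through the isometry; every pair of curves in \<open>L2E k\<close> is of the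
form on the left-hand side.\<close>

lemma is_solution_fock_map:
  "is_solution (real k) u0 v0 (\<lambda>t. fock_map k (fst (z t))) (\<lambda>t. fock_map k (snd (z t))) \<longleftrightarrow>
     fock_map k (fst (z 0)) = u0 \<and> fock_map k (snd (z 0)) = v0 \<and>
     (\<forall>t. (z has_vector_derivative fock_field k (z t)) (at t))"
proof
  let ?u = "\<lambda>t. fock_map k (fst (z t))" and ?v = "\<lambda>t. fock_map k (snd (z t))"
  have eqn: "d = fock_map k (phase_op (comult_op k y (mult_op k x y)))"
    if d: "d \<in> L2E (real k)" "\<forall>z. \<i> * d z = fock_proj (\<lambda>w. of_real ((cmod (fock_map k y w))\<^sup>2) * fock_map k x w) z" for d x y
  proof -
    obtain x' where x': "d = fock_map k x'" by (rule fock_map_surj[OF d(1)])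
    have "\<i> * fock_map k x' z = \<i> * fock_map k (phase_op (comult_op k y (mult_op k x y))) z" for z
      using d(2) unfolding x' fock_map_phase_comult by blast
    then have "fock_map k x' z = fock_map k (phase_op (comult_op k y (mult_op k x y))) z" for z
      by (simp only: mult_cancel_left) simp
    then show ?thesis unfolding x' by (rule ext)
  qed
  assume sol: "is_solution (real k) u0 v0 ?u ?v"
  have "(z has_vector_derivative fock_field k (z t)) (at t)" for t
  proof -
    obtain du where du: "has_L2E_derivative (real k) ?u du t"
      "\<forall>w. \<i> * du w = fock_proj (\<lambda>w. of_real ((cmod (?v t w))\<^sup>2) * ?u t w) w"
      using sol unfolding is_solution_def by blast
    obtain dv where dv: "has_L2E_derivative (real k) ?v dv t"
      "\<forall>w. \<i> * dv w = fock_proj (\<lambda>w. of_real ((cmod (?u t w))\<^sup>2) * ?v t w) w"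
      using sol unfolding is_solution_def by blast
    have mem: "du \<in> L2E (real k)" "dv \<in> L2E (real k)" using du(1) dv(1) unfolding has_L2E_derivative_def by blast+
    have "((\<lambda>t. fst (z t)) has_vector_derivative fst (fock_field k (z t))) (at t)"
      using du(1) unfolding eqn[OF mem(1) du(2)] has_L2E_derivative_fock_map by (simp only: fock_field_def fst_conv)
    moreover have "((\<lambda>t. snd (z t)) has_vector_derivative snd (fock_field k (z t))) (at t)"
      using dv(1) unfolding eqn[OF mem(2) dv(2)] has_L2E_derivative_fock_map mult_op_commute[of k "snd (z t)" "fst (z t)"]
      by (simp only: fock_field_def snd_conv)
    ultimately have "((\<lambda>t. fst (z t)) has_vector_derivative fst (fock_field k (z t))) (at t)"
      "((\<lambda>t. snd (z t)) has_vector_derivative snd (fock_field k (z t))) (at t)" .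
    from has_vector_derivative_Pair[OF this] show ?thesis by simp
  qed
  then show "fock_map k (fst (z 0)) = u0 \<and> fock_map k (snd (z 0)) = v0 \<and>
     (\<forall>t. (z has_vector_derivative fock_field k (z t)) (at t))"
    using sol unfolding is_solution_def by blast
next
  let ?u = "\<lambda>t. fock_map k (fst (z t))" and ?v = "\<lambda>t. fock_map k (snd (z t))"
  assume "fock_map k (fst (z 0)) = u0 \<and> fock_map k (snd (z 0)) = v0 \<and>
     (\<forall>t. (z has_vector_derivative fock_field k (z t)) (at t))"
  then have init: "?u 0 = u0" "?v 0 = v0" and z: "\<And>t. (z has_vector_derivative fock_field k (z t)) (at t)" by blast+
  have td: "times_differentiable n z" for n
    by (rule autonomous_solution_smooth[OF fock_field_times_differentiable z])
  have smooth: "smooth_L2E_curve (real k) (\<lambda>t. fock_map k (x t))" if "\<And>n. times_differentiable n x" for x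
  proof -
    have "\<exists>D. D 0 = x \<and> (\<forall>n t. (D n has_vector_derivative D (Suc n) t) (at t))"
      by (rule smooth_derivative_sequence) (rule that)
    then show ?thesis
    proof (elim exE conjE)
      fix D assume D: "D 0 = x" "\<forall>n t. (D n has_vector_derivative D (Suc n) t) (at t)"
      show ?thesis
        unfolding smooth_L2E_curve_def
      proof (intro exI[of _ "\<lambda>n t. fock_map k (D n t)"] conjI allI)
        show "(\<lambda>t. fock_map k (D 0 t)) = (\<lambda>t. fock_map k (x t))" by (simp only: D(1))
        show "fock_map k (D n t) \<in> L2E (real k)" for n t by (rule fock_map_in_L2E)
        show "has_L2E_derivative (real k) (\<lambda>t. fock_map k (D n t)) (fock_map k (D (Suc n) t)) t" for n t
          unfolding has_L2E_derivative_fock_map using D(2) by (elim allE)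
      qed
    qed
  qed
  have dz: "((\<lambda>t. fst (z t)) has_vector_derivative fst (fock_field k (z t))) (at t)"
    "((\<lambda>t. snd (z t)) has_vector_derivative snd (fock_field k (z t))) (at t)" for t
    by (rule bounded_linear.has_vector_derivative[OF bounded_linear_fst z], rule bounded_linear.has_vector_derivative[OF bounded_linear_snd z])
  show "is_solution (real k) u0 v0 ?u ?v"
    unfolding is_solution_def
  proof (intro conjI allI init)
    show "smooth_L2E_curve (real k) ?u" "smooth_L2E_curve (real k) ?v"
      by (intro smooth times_differentiable_linear[OF bounded_linear_fst] times_differentiable_linear[OF bounded_linear_snd] td)+
    show "\<exists>du. has_L2E_derivative (real k) ?u du t \<and> (\<forall>w. \<i> * du w = fock_proj (\<lambda>w. of_real ((cmod (?v t w))\<^sup>2) * ?u t w) w)" for t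
      using dz(1)[of t] unfolding fock_field_def fst_conv fock_map_phase_comult[symmetric]
      by (intro exI[of _ "fock_map k (phase_op (comult_op k (snd (z t)) (mult_op k (fst (z t)) (snd (z t)))))"]
          conjI allI refl has_L2E_derivative_fock_map[THEN iffD2])
    show "\<exists>dv. has_L2E_derivative (real k) ?v dv t \<and> (\<forall>w. \<i> * dv w = fock_proj (\<lambda>w. of_real ((cmod (?u t w))\<^sup>2) * ?v t w) w)" for t
      using dz(2)[of t] unfolding fock_field_def snd_conv mult_op_commute[of k "fst (z t)" "snd (z t)"]
        fock_map_phase_comult[symmetric]
      by (intro exI[of _ "fock_map k (phase_op (comult_op k (fst (z t)) (mult_op k (snd (z t)) (fst (z t)))))"]
          conjI allI refl has_L2E_derivative_fock_map[THEN iffD2])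
  qed
qed

text \<open>Lower weights of a function represented at level \<open>k\<close> are controlled by the energies of lower order.\<close>

lemma L2E_norm_fock_map_le:
  assumes "j \<le> k"
  shows "fock_map k x \<in> L2E (real j)"
    and "L2E_norm (real j) (fock_map k x) \<le> sqrt ((real j + 2) ^ j * seq_energy j (coef k x))"
proof -
  have s: "weighted_summable (fock_weight j) (coef k x)"
    by (rule weighted_summable_mono[OF energy_summable[OF assms] less_imp_le[OF fock_weight_pos] fock_weight_le_energy_weight])
  show "fock_map k x \<in> L2E (real j)" unfolding fock_map_def by (rule fock_fun_in_L2E[OF s])
  show "L2E_norm (real j) (fock_map k x) \<le> sqrt ((real j + 2) ^ j * seq_energy j (coef k x))"
    unfolding fock_map_def fock_fun_weighted(2)[OF s] by (intro real_sqrt_le_mono weighted_sum_le_energy assms)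
qed

lemma grows_norm_bound:
  assumes g: "grows k z0 j r" and j: "j \<le> k" and z0: "z 0 = z0"
    and z: "\<And>t. (z has_vector_derivative fock_field k (z t)) (at t)"
  shows "\<exists>C. \<forall>t. L2E_norm (real j) (fock_map k (fst (z t))) + L2E_norm (real j) (fock_map k (snd (z t)))
    \<le> C * (1 + \<bar>t\<bar>) powr (r / 2)"
proof -
  obtain C where C: "C \<ge> 0" "\<And>\<theta> z t. admissible k z0 \<theta> z \<Longrightarrow> energy k j (z t) \<le> C * (1 + \<bar>t\<bar>) powr r"
    using g unfolding grows_def by blast
  have adm: "admissible k z0 (\<lambda>_. 1) z" using z z0 by (simp add: admissible_def)
  let ?K = "sqrt ((real j + 2) ^ j * C)"
  have "L2E_norm (real j) (fock_map k (fst (z t))) + L2E_norm (real j) (fock_map k (snd (z t)))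
    \<le> 2 * ?K * (1 + \<bar>t\<bar>) powr (r / 2)" for t
  proof -
    have "L2E_norm (real j) (fock_map k x) \<le> ?K * (1 + \<bar>t\<bar>) powr (r / 2)"
      if "seq_energy j (coef k x) \<le> energy k j (z t)" for x
    proof -
      have "L2E_norm (real j) (fock_map k x) \<le> sqrt ((real j + 2) ^ j * seq_energy j (coef k x))"
        by (rule L2E_norm_fock_map_le(2)[OF j])
      also have "\<dots> \<le> sqrt ((real j + 2) ^ j * (C * (1 + \<bar>t\<bar>) powr r))"
        using order_trans[OF that C(2)[OF adm]] by (intro real_sqrt_le_mono mult_left_mono) auto
      also have "\<dots> = ?K * sqrt ((1 + \<bar>t\<bar>) powr r)" by (simp add: real_sqrt_mult)
      also have "sqrt ((1 + \<bar>t\<bar>) powr r) = (1 + \<bar>t\<bar>) powr (r / 2)"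
        by (rule real_sqrt_unique) (simp_all add: power2_eq_square powr_add[symmetric])
      finally show ?thesis .
    qed
    from this[of "fst (z t)"] this[of "snd (z t)"] show ?thesis
      using seq_energy_nonneg[OF j, of "fst (z t)"] seq_energy_nonneg[OF j, of "snd (z t)"] by (simp add: energy_def)
  qed
  then show ?thesis by blast
qed

text \<open>The inclusion of \<open>L2E m\<close> into \<open>L2E k\<close> for \<open>k \<le> m\<close>, in the two coordinate systems.\<close>

definition lower_regularity :: "nat \<Rightarrow> nat \<Rightarrow> ell2 \<Rightarrow> ell2" where
  "lower_regularity m k x = of_coef k (coef m x)"

lemma coef_lower_regularity:
  assumes "k \<le> m"
  shows "coef k (lower_regularity m k x) = coef m x"
    and "(norm (lower_regularity m k x))\<^sup>2 \<le> (real k + 2) ^ k * (norm x)\<^sup>2"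
proof -
  have le: "fock_weight k n \<le> (real k + 2) ^ k * fock_weight m n" for n
  proof -
    have "fock_weight k n \<le> (real k + 2) ^ k * (real n + 1) ^ k" by (rule fock_weight_upper)
    also have "\<dots> \<le> (real k + 2) ^ k * (real n + 1) ^ m"
      using assms by (intro mult_left_mono power_increasing) auto
    also have "\<dots> \<le> (real k + 2) ^ k * fock_weight m n"
      by (intro mult_left_mono fock_weight_lower) auto
    finally show ?thesis .
  qed
  have s: "weighted_summable (fock_weight k) (coef m x)"
    by (rule weighted_summable_mono[OF coef_summable less_imp_le[OF fock_weight_pos] le])
  show c: "coef k (lower_regularity m k x) = coef m x"
    unfolding lower_regularity_def by (rule coef_of_coef[OF s])
  show "(norm (lower_regularity m k x))\<^sup>2 \<le> (real k + 2) ^ k * (norm x)\<^sup>2"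
    unfolding norm_eq_coef[of "lower_regularity m k x" k] norm_eq_coef[of x m] c
    by (rule weighted_sum_mono[OF coef_summable less_imp_le[OF fock_weight_pos] le])
qed

lemma fock_map_lower_regularity: "k \<le> m \<Longrightarrow> fock_map k (lower_regularity m k x) = fock_map m x"
  by (simp add: fock_map_def coef_lower_regularity)

lemma lower_regularity_linear:
  assumes "k \<le> m"
  shows "bounded_linear (lower_regularity m k)"
proof (rule bounded_linear_intro[where K = "sqrt ((real k + 2) ^ k)"])
  fix x y :: ell2 and r :: real
  show "lower_regularity m k (x + y) = lower_regularity m k x + lower_regularity m k y"
    by (rule coef_inject[of k]) (auto simp: fun_eq_iff coef_lower_regularity[OF assms])
  show "lower_regularity m k (r *\<^sub>R x) = r *\<^sub>R lower_regularity m k x"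
    by (rule coef_inject[of k]) (auto simp: fun_eq_iff coef_lower_regularity[OF assms])
  have "(norm (lower_regularity m k x))\<^sup>2 \<le> (norm x * sqrt ((real k + 2) ^ k))\<^sup>2"
    using coef_lower_regularity(2)[OF assms, of x] by (simp add: power_mult_distrib mult.commute)
  from power2_le_imp_le[OF this] show "norm (lower_regularity m k x) \<le> norm x * sqrt ((real k + 2) ^ k)" by simp
qed

lemma lower_regularity_solution:
  assumes "k \<le> m" and z: "(z has_vector_derivative fock_field m (z t)) (at t)"
  shows "((\<lambda>t. (lower_regularity m k (fst (z t)), lower_regularity m k (snd (z t)))) has_vector_derivative
    fock_field k (lower_regularity m k (fst (z t)), lower_regularity m k (snd (z t)))) (at t)"
proof -
  let ?J = "lower_regularity m k"
  note J = lower_regularity_linear[OF assms(1)] and cJ = coef_lower_regularity(1)[OF assms(1)]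
  have "((\<lambda>t. (?J (fst (z t)), ?J (snd (z t)))) has_vector_derivative (?J (fst (fock_field m (z t))), ?J (snd (fock_field m (z t))))) (at t)"
    by (intro has_vector_derivative_Pair bounded_linear.has_vector_derivative[OF J]
        bounded_linear.has_vector_derivative[OF bounded_linear_fst z] bounded_linear.has_vector_derivative[OF bounded_linear_snd z])
  moreover have "?J (phase_op (comult_op m y (mult_op m x x'))) = phase_op (comult_op k (?J y) (mult_op k (?J x) (?J x')))" for x x' y
    by (rule coef_inject[of k]) (auto simp: fun_eq_iff cJ coef_phase_op coef_comult_op coef_mult_op)
  ultimately show ?thesis by (simp add: fock_field_def)
qed

lemma field_solution_unique:
  assumes "\<And>t. (x has_vector_derivative fock_field k (x t)) (at t)" "\<And>t. (y has_vector_derivative fock_field k (y t)) (at t)"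
    "x 0 = y 0"
  shows "x = y"
proof
  fix t :: real
  show "x t = y t"
    by (rule ode_solution_unique[where F = "fock_field k" and T = "\<bar>t\<bar> + 1"])
       (simp_all add: fock_field_locally_lipschitz assms)
qed

theorem theorem1p3:
  fixes k :: nat and u0 v0 :: "complex \<Rightarrow> complex"
  assumes "u0 \<in> L2E (real k)" and "v0 \<in> L2E (real k)"
  shows "\<exists>u v.
    is_solution (real k) u0 v0 u v \<and>
    (\<forall>u' v'. is_solution (real k) u0 v0 u' v' \<longrightarrow> u' = u \<and> v' = v) \<and>
    (k \<ge> 3 \<longrightarrow>
      (\<exists>C. \<forall>t. L2E_norm (real k) (u t) + L2E_norm (real k) (v t)
                \<le> C * (1 + \<bar>t\<bar>) powr ((real k - 1) / 4))) \<and>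
    (k = 2 \<longrightarrow>
      (\<exists>C. \<forall>t. L2E_norm 2 (u t) + L2E_norm 2 (v t) \<le> C * (1 + \<bar>t\<bar>) powr (1 / 2))) \<and>
    (square_integrable (weighted 3 u0) \<and> square_integrable (weighted 3 v0) \<longrightarrow>
      (\<exists>C. \<forall>t. u t \<in> L2E 2 \<and> v t \<in> L2E 2 \<and>
                L2E_norm 2 (u t) + L2E_norm 2 (v t) \<le> C * (1 + \<bar>t\<bar>) powr (1 / 4)))"
proof -
  obtain x0 y0 where x0: "u0 = fock_map k x0" and y0: "v0 = fock_map k y0"
    using fock_map_surj[OF assms(1)] fock_map_surj[OF assms(2)] by metis
  obtain z where z0: "z 0 = (x0, y0)" and z: "\<And>t. (z has_vector_derivative fock_field k (z t)) (at t)"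
    using fock_flow_exists[of "(x0, y0)" k] by blast
  let ?u = "\<lambda>t. fock_map k (fst (z t))" and ?v = "\<lambda>t. fock_map k (snd (z t))"
  have sol: "is_solution (real k) u0 v0 ?u ?v"
    unfolding is_solution_fock_map using z z0 x0 y0 by simp
  have uniq: "u' = ?u \<and> v' = ?v" if sol': "is_solution (real k) u0 v0 u' v'" for u' v'
  proof -
    have "u' t \<in> L2E (real k)" "v' t \<in> L2E (real k)" for t
      using sol' by (auto simp: is_solution_def smooth_L2E_curve_def)
    then have "\<exists>p. u' t = fock_map k (fst p) \<and> v' t = fock_map k (snd p)" for t
      by (metis fock_map_surj fst_conv snd_conv)
    then obtain p where p: "u' = (\<lambda>t. fock_map k (fst (p t)))" "v' = (\<lambda>t. fock_map k (snd (p t)))"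
      by metis
    have "fock_map k (fst (p 0)) = u0" "fock_map k (snd (p 0)) = v0" and dp: "\<And>t. (p has_vector_derivative fock_field k (p t)) (at t)"
      using sol' unfolding p is_solution_fock_map by auto
    then have "p 0 = z 0" using z0 x0 y0 fock_map_inject by (metis prod.collapse)
    then have "p = z" using field_solution_unique dp z by blast
    then show ?thesis by (simp add: p)
  qed
  have high: "\<exists>C. \<forall>t. L2E_norm (real k) (?u t) + L2E_norm (real k) (?v t) \<le> C * (1 + \<bar>t\<bar>) powr ((real k - 1) / 4)" if "k \<ge> 3"
    using grows_norm_bound[OF grows_high[OF that _ order_refl] order_refl z0 z] that by simp
  have two: "\<exists>C. \<forall>t. L2E_norm 2 (?u t) + L2E_norm 2 (?v t) \<le> C * (1 + \<bar>t\<bar>) powr (1 / 2)" if k: "k = 2"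
  proof -
    have "grows k (x0, y0) (0 + 2) (0 + 1)"
      using k by (intro grows_step grows_conserved) auto
    from grows_norm_bound[OF this _ z0 z] show ?thesis using k by simp
  qed
  have three: "\<exists>C. \<forall>t. ?u t \<in> L2E 2 \<and> ?v t \<in> L2E 2 \<and> L2E_norm 2 (?u t) + L2E_norm 2 (?v t) \<le> C * (1 + \<bar>t\<bar>) powr (1 / 4)"
    if "square_integrable (weighted 3 u0)" "square_integrable (weighted 3 v0)"
  proof -
    \<comment> \<open>The initial data lie in \<open>L2E m\<close>; the solution there coincides with \<open>z\<close>, and its energy of order three is finite even if \<open>k < 3\<close>.\<close>
    define m where "m = max k 3"
    have m: "k \<le> m" "3 \<le> m" by (auto simp: m_def)
    have "u0 \<in> L2E (real m)" "v0 \<in> L2E (real m)"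
      using assms that by (auto simp: m_def L2E_def max_def)
    then obtain x1 y1 where x1: "u0 = fock_map m x1" and y1: "v0 = fock_map m y1"
      using fock_map_surj by metis
    obtain w where w0: "w 0 = (x1, y1)" and w: "\<And>t. (w has_vector_derivative fock_field m (w t)) (at t)"
      using fock_flow_exists[of "(x1, y1)" m] by blast
    let ?J = "lower_regularity m k"
    have "fock_map k (?J x1) = fock_map k x0" "fock_map k (?J y1) = fock_map k y0"
      using fock_map_lower_regularity[OF m(1)] x0 y0 x1 y1 by auto
    then have "?J x1 = x0" "?J y1 = y0" using fock_map_inject by blast+
    then have init: "(?J (fst (w 0)), ?J (snd (w 0))) = z 0" by (simp add: w0 z0)
    have Jz: "(\<lambda>t. (?J (fst (w t)), ?J (snd (w t)))) = z"
      by (rule field_solution_unique[where k = k]) (rule lower_regularity_solution[OF m(1) w], rule z, rule init)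
    have "z t = (?J (fst (w t)), ?J (snd (w t)))" for t by (rule fun_cong[OF Jz, of t, symmetric])
    then have uv: "?u t = fock_map m (fst (w t))" "?v t = fock_map m (snd (w t))" for t
      by (simp_all add: fock_map_lower_regularity[OF m(1)])
    obtain C where C: "\<And>t. L2E_norm (real 2) (fock_map m (fst (w t))) + L2E_norm (real 2) (fock_map m (snd (w t)))
      \<le> C * (1 + \<bar>t\<bar>) powr ((1/2) / 2)"
      using grows_norm_bound[OF grows_two_of_three[OF m(2)] _ w0 w] m by auto
    then show ?thesis
      using L2E_norm_fock_map_le(1)[of 2 m] m unfolding uv by (intro exI[of _ C]) simp
  qed
  show ?thesis
  proof (rule exI[of _ ?u], rule exI[of _ ?v], intro conjI impI allI)
    show "is_solution (real k) u0 v0 ?u ?v" by (rule sol)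
    show "u' = ?u" "v' = ?v" if "is_solution (real k) u0 v0 u' v'" for u' v'
      by (rule conjunct1[OF uniq[OF that]], rule conjunct2[OF uniq[OF that]])
    show "\<exists>C. \<forall>t. L2E_norm (real k) (?u t) + L2E_norm (real k) (?v t) \<le> C * (1 + \<bar>t\<bar>) powr ((real k - 1) / 4)" if "3 \<le> k"
      by (rule high[OF that])
    show "\<exists>C. \<forall>t. L2E_norm 2 (?u t) + L2E_norm 2 (?v t) \<le> C * (1 + \<bar>t\<bar>) powr (1 / 2)" if "k = 2"
      by (rule two[OF that])
    show "\<exists>C. \<forall>t. ?u t \<in> L2E 2 \<and> ?v t \<in> L2E 2 \<and> L2E_norm 2 (?u t) + L2E_norm 2 (?v t) \<le> C * (1 + \<bar>t\<bar>) powr (1 / 4)"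
      if "square_integrable (weighted 3 u0) \<and> square_integrable (weighted 3 v0)"
      by (rule three[OF conjunct1[OF that] conjunct2[OF that]])
  qed
qed

end
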